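(* Let $\mathbb{M}^2=(\mathbb{R}^2,\|\cdot\|)$ be a strictly convex normed plane. If $K\subset\mathbb{M}^2$ is a set of $n$ points and $\lambda\ge\lambda_K$, then the $\lambda$-ball hull $\mathrm{bh}(K,\lambda)$ can be built with a divide-and-conquer algorithm taking $O(n\log n)$ time.
   Context: $B(x,\lambda)=\{y:\|y-x\|\le\lambda\}$ is the disc with center $x$ and radius $\lambda>0$, and $S(x,\lambda)$ is its boundary circle. The normed plane is strictly convex if its unit circle contains no non-degenerate line segment. For a finite set $K$ of points, $\lambda_K$ (the circumradius) is the smallest number such that $K$ is contained in a translate of $\lambda_K B(o,1)$, where $o$ is the origin. The $\lambda$-ball hull of $K$ is $\mathrm{bh}(K,\lambda)=\bigcap_{K\subset B(x,\lambda)}B(x,\lambda)$, the intersection of all discs of radius $\lambda$ that contain $K$; its boundary consists of circular arcs of radius $\lambda$ whose endpoints, the vertices of $\mathrm{bh}(K,\lambda)$, are points of $K$. Building $\mathrm{bh}(K,\lambda)$ means producing the list of its vertices in their cyclic order along the boundary. Divide-and-conquer means: the points are sorted by $x$-coordinate (ties broken by $y$-coordinate), the sorted set is split into a left and a right half, the ball hulls of the two halves are built recursively, and they are then combined into the ball hull of the whole set. Running time is counted as the number of elementary operations, where the norm is fixed and the following are constant-time operations: arithmetic and comparison of real coordinates, evaluation of the norm, computing the intersection points of two circles of the same radius $\lambda$, and comparing the positions of points along a circle. *)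

theory Defs
  imports "HOL-Analysis.Analysis" "HOL-Library.Landau_Symbols"
begin

section \<open>Strictly convex normed planes and ball hulls\<close>

type_synonym point = "real \<times> real"

definition plane_norm :: "(point \<Rightarrow> real) \<Rightarrow> bool" where
  "plane_norm N \<longleftrightarrow>
     (\<forall>p. N p \<ge> 0) \<and> (\<forall>p. N p = 0 \<longleftrightarrow> p = 0) \<and>
     (\<forall>a p. N (a *\<^sub>R p) = \<bar>a\<bar> * N p) \<and> (\<forall>p q. N (p + q) \<le> N p + N q)"

definition disc :: "(point \<Rightarrow> real) \<Rightarrow> point \<Rightarrow> real \<Rightarrow> point set" where
  "disc N x r = {y. N (y - x) \<le> r}"

definition circle :: "(point \<Rightarrow> real) \<Rightarrow> point \<Rightarrow> real \<Rightarrow> point set" where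
  "circle N x r = {y. N (y - x) = r}"

definition strictly_convex_norm :: "(point \<Rightarrow> real) \<Rightarrow> bool" where
  "strictly_convex_norm N \<longleftrightarrow>
     plane_norm N \<and> (\<forall>p q. p \<noteq> q \<longrightarrow> \<not> closed_segment p q \<subseteq> circle N 0 1)"

definition circumradius :: "(point \<Rightarrow> real) \<Rightarrow> point set \<Rightarrow> real" where
  "circumradius N K = (LEAST r. r \<ge> 0 \<and> (\<exists>x. K \<subseteq> disc N x r))"

definition ball_hull :: "(point \<Rightarrow> real) \<Rightarrow> point set \<Rightarrow> real \<Rightarrow> point set" where
  "ball_hull N K r = \<Inter>{disc N x r | x. K \<subseteq> disc N x r}"

definition cross :: "point \<Rightarrow> point \<Rightarrow> real" where
  "cross u v = fst u * snd v - snd u * fst v"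

text \<open>
  The arc of \<open>circle N c r\<close> run through counterclockwise from \<open>p\<close> to \<open>q\<close>: it is the part of the
  circle that lies on or to the right of the directed line from \<open>p\<close> to \<open>q\<close>. For \<open>p = q\<close> it is the
  single point \<open>p\<close>, never the full circle; this is needed only when the ball hull is a single point.
\<close>

definition ccw_arc :: "(point \<Rightarrow> real) \<Rightarrow> point \<Rightarrow> real \<Rightarrow> point \<Rightarrow> point \<Rightarrow> point set" where
  "ccw_arc N c r p q =
     (if p = q then {p} else {z \<in> circle N c r. cross (q - p) (z - p) \<le> 0})"

text \<open>
  The points of \<open>K\<close> on the boundary cut it into its circular arcs. Taking all of them, rather than
  only the points where the boundary changes from one circle to another, also covers the case that
  the hull is a full disc (e.g. if \<open>r\<close> is the circumradius of an acute triangle in the Euclidean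
  plane), where no such change occurs.
\<close>

definition hull_vertices :: "(point \<Rightarrow> real) \<Rightarrow> point set \<Rightarrow> real \<Rightarrow> point set" where
  "hull_vertices N K r = K \<inter> frontier (ball_hull N K r)"

text \<open>
  \<open>vs\<close> lists the vertices in counterclockwise order, starting anywhere: \<open>c i\<close> is the centre of the
  boundary arc from the \<open>i\<close>-th vertex to its cyclic successor.
\<close>

definition lists_hull_vertices ::
  "(point \<Rightarrow> real) \<Rightarrow> point set \<Rightarrow> real \<Rightarrow> point list \<Rightarrow> bool" where
  "lists_hull_vertices N K r vs \<longleftrightarrow>
     distinct vs \<and> set vs = hull_vertices N K r \<and>
     (\<exists>c :: nat \<Rightarrow> point.
        let nxt = (\<lambda>i. vs ! (Suc i mod length vs));
            arc = (\<lambda>i. ccw_arc N (c i) r (vs ! i) (nxt i))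
        in (\<forall>i < length vs. vs ! i \<in> circle N (c i) r \<and> nxt i \<in> circle N (c i) r \<and>
              arc i \<inter> set vs = {vs ! i, nxt i}) \<and>
           frontier (ball_hull N K r) = (\<Union>i < length vs. arc i))"

definition lex_less :: "point \<Rightarrow> point \<Rightarrow> bool" where
  "lex_less p q \<longleftrightarrow> fst p < fst q \<or> fst p = fst q \<and> snd p < snd q"


section \<open>The model of computation\<close>

text \<open>
  A real-number machine in the form of a first-order functional language. Values are built from
  reals, truth values and immutable cons cells; a program is a finite list of procedure bodies.
  There is no way to inspect a real except through the primitives. Since a program is finite and
  its variables refer to a frame of bounded size, every rule below does a constant amount of work.
\<close>

datatype val = VReal real | VBool bool | VNil | VCons val val

datatype prim =
    PZero | POne | PAdd | PSub | PMul | PDiv | PLess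
  | PNorm | PIntersect | PBefore
  | PNil | PCons | PHead | PTail | PIsNil

text \<open>Variables are de Bruijn indices into the current frame; \<open>ELet\<close> pushes onto it.\<close>

datatype expr =
    EVar nat
  | ELet expr expr
  | EIf expr expr expr
  | EPrim prim "expr list"
  | ECall nat "expr list"

fun enc_point :: "point \<Rightarrow> val" where
  "enc_point (x, y) = VCons (VReal x) (VReal y)"

fun enc_points :: "point list \<Rightarrow> val" where
  "enc_points [] = VNil"
| "enc_points (p # ps) = VCons (enc_point p) (enc_points ps)"

text \<open>
  The position of a point along a circle around \<open>c\<close> is its angle as seen from \<open>c\<close>, measured
  counterclockwise from the positive first axis.
\<close>

definition angle_about :: "point \<Rightarrow> point \<Rightarrow> real" where
  "angle_about c p = Arg2pi (Complex (fst (p - c)) (snd (p - c)))"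

text \<open>
  A primitive applied to anything not listed here is undefined, and the computation is stuck. The
  intersection of two circles is returned in lexicographic order; it is undefined if it is infinite
  (two equal circles).
\<close>

inductive apply_prim :: "(point \<Rightarrow> real) \<Rightarrow> prim \<Rightarrow> val list \<Rightarrow> val \<Rightarrow> bool"
  for N :: "point \<Rightarrow> real"
where
  Zero: "apply_prim N PZero [] (VReal 0)"
| One: "apply_prim N POne [] (VReal 1)"
| Add: "apply_prim N PAdd [VReal a, VReal b] (VReal (a + b))"
| Sub: "apply_prim N PSub [VReal a, VReal b] (VReal (a - b))"
| Mul: "apply_prim N PMul [VReal a, VReal b] (VReal (a * b))"
| Div: "b \<noteq> 0 \<Longrightarrow> apply_prim N PDiv [VReal a, VReal b] (VReal (a / b))"
| Less: "apply_prim N PLess [VReal a, VReal b] (VBool (a < b))"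
| Norm: "apply_prim N PNorm [enc_point p] (VReal (N p))"
| Intersect: "sorted_wrt lex_less ps \<Longrightarrow> set ps = circle N c r \<inter> circle N d r \<Longrightarrow>
    apply_prim N PIntersect [enc_point c, enc_point d, VReal r] (enc_points ps)"
| Before: "p \<in> circle N c r \<Longrightarrow> q \<in> circle N c r \<Longrightarrow> r > 0 \<Longrightarrow>
    apply_prim N PBefore [enc_point c, enc_point p, enc_point q]
      (VBool (angle_about c p < angle_about c q))"
| NilList: "apply_prim N PNil [] VNil"
| ConsCell: "apply_prim N PCons [u, v] (VCons u v)"
| Head: "apply_prim N PHead [VCons u v] u"
| Tail: "apply_prim N PTail [VCons u v] v"
| IsNilTrue: "apply_prim N PIsNil [VNil] (VBool True)"
| IsNilFalse: "apply_prim N PIsNil [VCons u v] (VBool False)"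

lemma enc_point_eq_iff: "enc_point p = enc_point q \<longleftrightarrow> p = q"
  by (cases p; cases q) auto

lemma sorted_lex_unique:
  assumes "sorted_wrt lex_less ps" "sorted_wrt lex_less qs" "set ps = set qs"
  shows "ps = qs"
  using assms
proof (induction ps arbitrary: qs)
  case Nil
  then show ?case by simp
next
  case (Cons p ps)
  then obtain q qs' where qs: "qs = q # qs'" by (cases qs) auto
  have irrefl: "\<not> lex_less u u" and asym: "lex_less u w \<Longrightarrow> \<not> lex_less w u" for u w
    by (auto simp: lex_less_def)
  have pq: "p = q"
    using Cons.prems asym unfolding qs by (metis list.set_intros(1) set_ConsD sorted_wrt.simps(2))
  have "p \<notin> set ps" "p \<notin> set qs'"
    using Cons.prems(1,2) irrefl[of p] pq unfolding qs by (metis sorted_wrt.simps(2))+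
  then have "set ps = set qs'"
    using Cons.prems(3) pq unfolding qs by auto
  then show ?case
    using Cons pq unfolding qs by simp
qed

lemma apply_prim_deterministic:
  assumes "apply_prim N g us v" "apply_prim N g us w"
  shows "w = v"
  using assms(1)
proof cases
  case (Intersect ps c r d)
  from assms(2) Intersect show ?thesis
    by cases (auto simp: enc_point_eq_iff intro: arg_cong[OF sorted_lex_unique])
qed (use assms(2) in \<open>cases; auto simp: enc_point_eq_iff\<close>)+

text \<open>
  Big-step call-by-value semantics: in frame \<open>env\<close> the expression terminates with the given value
  after the given number of elementary operations, one for each evaluated node.
\<close>

inductive evaluates ::
    "(point \<Rightarrow> real) \<Rightarrow> expr list \<Rightarrow> val list \<Rightarrow> expr \<Rightarrow> val \<Rightarrow> nat \<Rightarrow> bool"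
  and evaluates_list ::
    "(point \<Rightarrow> real) \<Rightarrow> expr list \<Rightarrow> val list \<Rightarrow> expr list \<Rightarrow> val list \<Rightarrow> nat \<Rightarrow> bool"
  for N :: "point \<Rightarrow> real" and P :: "expr list"
where
  Var: "i < length env \<Longrightarrow> evaluates N P env (EVar i) (env ! i) 1"
| Let: "evaluates N P env e u s \<Longrightarrow> evaluates N P (u # env) f v t \<Longrightarrow>
    evaluates N P env (ELet e f) v (Suc (s + t))"
| IfTrue: "evaluates N P env b (VBool True) s \<Longrightarrow> evaluates N P env e v t \<Longrightarrow>
    evaluates N P env (EIf b e f) v (Suc (s + t))"
| IfFalse: "evaluates N P env b (VBool False) s \<Longrightarrow> evaluates N P env f v t \<Longrightarrow>
    evaluates N P env (EIf b e f) v (Suc (s + t))"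
| Prim: "evaluates_list N P env es us s \<Longrightarrow> apply_prim N g us v \<Longrightarrow>
    evaluates N P env (EPrim g es) v (Suc s)"
| Call: "evaluates_list N P env es us s \<Longrightarrow> k < length P \<Longrightarrow> evaluates N P us (P ! k) v t \<Longrightarrow>
    evaluates N P env (ECall k es) v (Suc (s + t))"
| Nil: "evaluates_list N P env [] [] 0"
| Cons: "evaluates N P env e u s \<Longrightarrow> evaluates_list N P env es us t \<Longrightarrow>
    evaluates_list N P env (e # es) (u # us) (s + t)"

lemma evaluates_deterministic:
  "evaluates N P env e v t \<Longrightarrow> evaluates N P env e v' t' \<Longrightarrow> v' = v \<and> t' = t"
  "evaluates_list N P env es vs t \<Longrightarrow> evaluates_list N P env es vs' t' \<Longrightarrow> vs' = vs \<and> t' = t"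
proof (induction arbitrary: v' t' and vs' t' rule: evaluates_evaluates_list.inducts)
  case (Var i env)
  from Var.prems show ?case by cases auto
next
  case (Let env e u s f v t)
  from Let.prems show ?case by cases (use Let.IH in blast)
next
  case (IfTrue env b s e v t f)
  from IfTrue.prems show ?case by cases (use IfTrue.IH in blast)+
next
  case (IfFalse env b s f v t e)
  from IfFalse.prems show ?case by cases (use IfFalse.IH in blast)+
next
  case (Prim env es us s g v)
  from Prim.prems show ?case by cases (metis Prim.IH Prim(2) apply_prim_deterministic)
next
  case (Call env es us s k v t)
  from Call.prems show ?case by cases (use Call.IH in blast)
next
  case (Nil env)
  from Nil.prems show ?case by cases auto
next
  case (Cons env e u s es us t)
  from Cons.prems show ?case by cases (use Cons.IH in blast)
qed

definition runs ::
  "(point \<Rightarrow> real) \<Rightarrow> expr list \<Rightarrow> nat \<Rightarrow> val list \<Rightarrow> val \<Rightarrow> nat \<Rightarrow> bool" where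
  "runs N P k args v t \<longleftrightarrow> k < length P \<and> evaluates N P args (P ! k) v t"


section \<open>Divide-and-conquer programs\<close>

text \<open>
  Procedure 0 is the entry point and procedure 1 the recursion, both with frame \<open>[points, radius]\<close>;
  procedures 2, 3 and 4 are sorting, splitting and combining:

  \<open>main xs r = build (sort xs) r\<close>

  \<open>build xs r = (if xs has at most one element then xs else\<close>
  \<open>let (ls, rs) = split xs in combine (build ls r) (build rs r) r)\<close>

  In particular, combining has access to nothing but the two vertex lists and the radius.
\<close>

definition main_body :: expr where
  "main_body = ECall 1 [ECall 2 [EVar 0], EVar 1]"

definition build_body :: expr where
  "build_body =
     EIf (EPrim PIsNil [EVar 0]) (EVar 0)
       (EIf (EPrim PIsNil [EPrim PTail [EVar 0]]) (EVar 0)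
         (ELet (ECall 3 [EVar 0])
           (ECall 4 [ECall 1 [EPrim PHead [EVar 0], EVar 2],
                     ECall 1 [EPrim PTail [EVar 0], EVar 2],
                     EVar 2])))"

fun callees :: "expr \<Rightarrow> nat set" where
  "callees (EVar i) = {}"
| "callees (ELet e f) = callees e \<union> callees f"
| "callees (EIf b e f) = callees b \<union> callees e \<union> callees f"
| "callees (EPrim g es) = (\<Union>e \<in> set es. callees e)"
| "callees (ECall k es) = insert k (\<Union>e \<in> set es. callees e)"

definition divide_and_conquer :: "(point \<Rightarrow> real) \<Rightarrow> expr list \<Rightarrow> bool" where
  "divide_and_conquer N P \<longleftrightarrow>
     (\<exists>sort_body split_body combine_body aux.
        P = [main_body, build_body, sort_body, split_body, combine_body] @ aux \<and>
        (\<forall>e \<in> set ([sort_body, split_body, combine_body] @ aux). callees e \<inter> {0, 1} = {})) \<and>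
     (\<forall>xs. distinct xs \<longrightarrow>
        (\<exists>ys t. runs N P 2 [enc_points xs] (enc_points ys) t \<and>
           set ys = set xs \<and> sorted_wrt lex_less ys)) \<and>
     (\<forall>xs. distinct xs \<longrightarrow>
        (\<exists>ls rs t. runs N P 3 [enc_points xs] (VCons (enc_points ls) (enc_points rs)) t \<and>
           xs = ls @ rs \<and> length ls \<le> Suc (length rs) \<and> length rs \<le> Suc (length ls)))"

end

theory Submission
  imports Defs
begin

text \<open>
  Let \<open>C K\<close> be the set of all centres of discs of radius \<open>r\<close> that contain \<open>K\<close>. A point of \<open>K\<close> is a
  vertex of the ball hull iff some centre in \<open>C K\<close> has distance exactly \<open>r\<close> from it. For \<open>p \<noteq> q\<close> with
  distance at most \<open>2 r\<close> there is exactly one centre \<open>lc p q\<close> to the left of the line from \<open>p\<close> to \<open>q\<close> (or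
  on it) whose circle passes through both points; strict convexity enters through the fact that the
  part of this disc to the right of the line lies in every disc of radius \<open>r\<close> that contains \<open>p\<close> and \<open>q\<close>.
  It follows that for two successive vertices \<open>a\<close>, \<open>b\<close> in counterclockwise order \<open>lc a b\<close> lies in
  \<open>C K\<close>, so that the boundary of the hull consists of the arcs around these centres.

  To combine two hulls, the vertices of the right one are inserted into the left one in lexicographic
  order. A new point \<open>p\<close> sees one of the two edges at the greatest vertex \<open>m\<close> found so far, so that
  one test decides whether \<open>p\<close> is a vertex. If it is, the vertices that disappear form an
  interval around \<open>p\<close> in the cyclic order, and whether \<open>v\<close> with neighbours \<open>u\<close>, \<open>w\<close> disappears can be
  seen from \<open>u\<close>, \<open>v\<close>, \<open>w\<close>, \<open>p\<close> alone. Since the interval may extend from \<open>p\<close> in both directions, the vertices are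
  kept in a double-ended queue; every vertex is removed at most once, so that combining takes linear
  time.
\<close>

section \<open>Strictly convex norms\<close>

text \<open>The distance estimates come from the triangle inequality: a linear identity
  \<open>D u = a v + b w\<close> is written down and the size of \<open>D\<close> is compared with
  that of the weights; strict convexity decides the equality cases. Sides of lines are signs of
  \<open>cross\<close>, so angles along circles are never measured. Since
  \<open>N (k - x) \<le> r\<close> is symmetric in points and centres, the statement about caps of a
  disc also controls how a disc can rotate about a point of its boundary, with the roles exchanged.
  Degenerate positions shape the statements: a chord may be a diameter, several successive vertices
  may lie on one circle, and a hull may have only two vertices. Touching some admissible circle is a
  notion of vertex that survives all of these. The linear cost of combining rests on a potential.
  Every vertex in the queue carries a credit for its removal, and the difference in length between
  the two lists of the queue carries a credit for the next time that half of one list is moved to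
  the other.\<close>

locale strictly_convex_plane =
  fixes N :: "point \<Rightarrow> real"
  assumes strictly_convex: "strictly_convex_norm N"
begin

lemma plane_norm: "plane_norm N"
  using strictly_convex by (simp add: strictly_convex_norm_def)

lemma N_nonneg: "0 \<le> N p"
  using plane_norm unfolding plane_norm_def by blast

lemma N_eq_0 [simp]: "N p = 0 \<longleftrightarrow> p = 0"
  using plane_norm unfolding plane_norm_def by blast

lemma N_scale: "N (a *\<^sub>R p) = \<bar>a\<bar> * N p"
  using plane_norm unfolding plane_norm_def by blast

lemma N_triangle: "N (p + q) \<le> N p + N q"
  using plane_norm unfolding plane_norm_def by blast

lemma N_minus [simp]: "N (- p) = N p"
  using N_scale[of "-1" p] by simp

lemma N_commute: "N (p - q) = N (q - p)"
  using N_minus[of "p - q"] by simp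

text \<open>Triangle inequality for an unnormalised combination. The typical use has
  \<open>N u = r\<close> and \<open>D\<close> positive, which leaves a relation between the
  coefficients alone.\<close>

lemma N_comb2:
  assumes "D *\<^sub>R u = a *\<^sub>R v + b *\<^sub>R w" "N v \<le> r" "N w \<le> r"
  shows "\<bar>D\<bar> * N u \<le> (\<bar>a\<bar> + \<bar>b\<bar>) * r"
proof -
  have "\<bar>D\<bar> * N u = N (a *\<^sub>R v + b *\<^sub>R w)"
    using assms(1) N_scale by metis
  also have "\<dots> \<le> \<bar>a\<bar> * N v + \<bar>b\<bar> * N w"
    using N_triangle by (metis N_scale)
  also have "\<dots> \<le> \<bar>a\<bar> * r + \<bar>b\<bar> * r"
    using assms(2,3) by (intro add_mono mult_left_mono) auto
  finally show ?thesis
    by (simp add: algebra_simps)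
qed

text \<open>The norm is convex along the segment and at most \<open>r\<close> at both ends. If it
  reached \<open>r\<close> at an inner point, it would be constantly \<open>r\<close>, and scaling
  by \<open>1 / r\<close> would put a segment on the unit circle.\<close>

lemma N_segment_less:
  assumes "N a \<le> r" "N b \<le> r" "a \<noteq> b" "0 < s" "s < 1"
  shows "N (a + s *\<^sub>R (b - a)) < r"
proof (rule ccontr)
  define g where "g = (\<lambda>t. a + t *\<^sub>R (b - a))"
  assume "\<not> ?thesis"
  then have s: "N (g s) \<ge> r"
    by (simp add: g_def)
  have le: "N (g t) \<le> r" if "0 \<le> t" "t \<le> 1" for t
  proof -
    have "1 *\<^sub>R g t = (1 - t) *\<^sub>R a + t *\<^sub>R b"
      by (simp add: g_def algebra_simps)
    from N_comb2[OF this assms(1,2)] that show ?thesis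
      by simp
  qed
  have const: "N (g t) = r" if t: "0 \<le> t" "t \<le> 1" for t
  proof (rule ccontr)
    assume "N (g t) \<noteq> r"
    then have lt: "N (g t) < r" and "t \<noteq> s"
      using le[OF t] s by force+
    \<comment> \<open>\<open>e\<close> is the end of the segment that lies beyond \<open>s\<close>
      as seen from \<open>t\<close>. So \<open>g s\<close> lies strictly between \<open>g t\<close>,
      where the norm is below \<open>r\<close>, and \<open>g e\<close>.\<close>
    define e :: real where "e = (if t < s then 1 else 0)"
    have e: "0 \<le> e" "e \<le> 1" and es: "(e < s \<and> s < t) \<or> (t < s \<and> s < e)"
      using assms \<open>t \<noteq> s\<close> by (auto simp: e_def)
    have "(t - e) *\<^sub>R g s = (s - e) *\<^sub>R g t + (t - s) *\<^sub>R g e"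
      by (simp add: g_def algebra_simps)
    then have "\<bar>t - e\<bar> * N (g s) \<le> \<bar>s - e\<bar> * N (g t) + \<bar>t - s\<bar> * N (g e)"
      by (metis N_scale N_triangle)
    also have "\<dots> < \<bar>s - e\<bar> * r + \<bar>t - s\<bar> * r"
      using lt le[OF e] es by (intro add_less_le_mono mult_strict_left_mono mult_left_mono) auto
    also have "\<dots> = \<bar>t - e\<bar> * r"
      using es by (auto simp: algebra_simps)
    finally show False
      using s es by (auto simp: mult_less_cancel_left)
  qed
  have "r \<noteq> 0"
    using const[of 0] const[of 1] assms(3) by (auto simp: g_def)
  then have r: "r > 0"
    using const[of 0] N_nonneg[of "g 0"] by auto
  have "closed_segment ((1 / r) *\<^sub>R a) ((1 / r) *\<^sub>R b) \<subseteq> circle N 0 1"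
  proof
    fix z assume "z \<in> closed_segment ((1 / r) *\<^sub>R a) ((1 / r) *\<^sub>R b)"
    then obtain t where t: "0 \<le> t" "t \<le> 1" and
      z: "z = (1 - t) *\<^sub>R ((1 / r) *\<^sub>R a) + t *\<^sub>R ((1 / r) *\<^sub>R b)"
      by (auto simp: in_segment)
    have "z = (1 / r) *\<^sub>R g t"
      unfolding z g_def by (simp add: algebra_simps flip: scaleR_add_left add_divide_distrib)
    then show "z \<in> circle N 0 1"
      using const[OF t] r by (simp add: circle_def N_scale)
  qed
  moreover have "(1 / r) *\<^sub>R a \<noteq> (1 / r) *\<^sub>R b"
    using r assms(3) by simp
  ultimately show False
    using strictly_convex unfolding strictly_convex_norm_def by blast
qed

text \<open>With positive weights, \<open>u \<noteq> w\<close> implies \<open>v \<noteq> w\<close>,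
  so \<open>u\<close> is an inner point of a proper segment in the disc. This settles the equality
  cases that \<open>N_comb2\<close> leaves open.\<close>

lemma N_comb2_less:
  assumes "(a + b) *\<^sub>R u = a *\<^sub>R v + b *\<^sub>R w" "N v \<le> r" "N w \<le> r" "u \<noteq> w" "0 < a" "0 < b"
  shows "N u < r"
proof -
  have "v \<noteq> w"
    using assms by (auto simp flip: scaleR_add_left)
  have "a + b \<noteq> 0"
    using assms by simp
  then have "u = (1 / (a + b)) *\<^sub>R ((a + b) *\<^sub>R u)"
    by simp
  also have "\<dots> = (a / (a + b)) *\<^sub>R v + (b / (a + b)) *\<^sub>R w"
    unfolding assms(1) by (simp add: scaleR_add_right)
  also have "a / (a + b) = 1 - b / (a + b)"
    using assms by (simp add: field_simps)
  finally have "u = v + (b / (a + b)) *\<^sub>R (w - v)"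
    by (simp add: algebra_simps)
  then show ?thesis
    using N_segment_less[of v r w "b / (a + b)"] assms \<open>v \<noteq> w\<close> by simp
qed

text \<open>Points of the circle are extreme points of the disc. The main use is for antipodal
  points, where \<open>cross\<close> vanishes and there is no basis to compute in.\<close>

lemma midpoint_eq:
  assumes "N a \<le> r" "N b \<le> r" "N c = r" "2 *\<^sub>R c = a + b"
  shows "a = c" "b = c"
proof -
  show "b = c"
    using N_comb2_less[of 1 1 c a b r] assms by force
  then show "a = c"
    using assms(4) by (simp add: scaleR_2)
qed

text \<open>In coordinates with respect to \<open>p\<close> and \<open>q\<close>, the condition
  \<open>1 \<le> \<alpha> + \<beta>\<close> places \<open>z\<close> on or beyond the chord, and
  \<open>y\<close> is another centre whose disc contains both ends. Unless \<open>y = 0\<close>, a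
  positive multiple of \<open>z - y\<close> is a combination of \<open>z\<close>,
  \<open>p - y\<close> and \<open>q - y\<close> whose coefficients add up to that multiple; the work
  lies in showing that these coefficients are nonnegative. Exchanging \<open>p\<close> and
  \<open>q\<close> exchanges \<open>s\<close> and \<open>t\<close>, hence the assumption
  \<open>t \<le> s\<close>.\<close>

lemma cap_aux:
  assumes pq: "N p = r" "N q = r" "p \<noteq> q" "p \<noteq> - q" and r: "r > 0"
    and z: "z = \<alpha> *\<^sub>R p + \<beta> *\<^sub>R q" "0 \<le> \<alpha>" "0 \<le> \<beta>" "1 \<le> \<alpha> + \<beta>" "N z \<le> r"
    and y: "y = s *\<^sub>R p + t *\<^sub>R q" "N (p - y) \<le> r" "N (q - y) \<le> r" and st: "t \<le> s"
  shows "N (z - y) \<le> r \<and> (1 < \<alpha> + \<beta> \<and> N z < r \<longrightarrow> N (z - y) < r)"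
proof -
  have main: ?thesis if st: "s + t > 0" and mu: "0 \<le> \<alpha> * t - \<beta> * s + s" and nu: "0 \<le> \<beta> * s - \<alpha> * t + t"
  proof -
    let ?D = "\<alpha> + \<beta> - 1 + (s + t)"
    have "?D *\<^sub>R (z - y) = (\<alpha> + \<beta> - 1) *\<^sub>R z + ((\<alpha> * t - \<beta> * s + s) *\<^sub>R (p - y) + (\<beta> * s - \<alpha> * t + t) *\<^sub>R (q - y))"
      unfolding z y by (simp add: algebra_simps)
    then have "?D * N (z - y) \<le> (\<alpha> + \<beta> - 1) * N z + N ((\<alpha> * t - \<beta> * s + s) *\<^sub>R (p - y) + (\<beta> * s - \<alpha> * t + t) *\<^sub>R (q - y))"
      using N_triangle N_scale st z by (smt (verit) abs_of_nonneg)
    also have "N ((\<alpha> * t - \<beta> * s + s) *\<^sub>R (p - y) + (\<beta> * s - \<alpha> * t + t) *\<^sub>R (q - y)) \<le> (s + t) * r"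
      using N_comb2[OF _ y(2,3), of 1 "(\<alpha> * t - \<beta> * s + s) *\<^sub>R (p - y) + (\<beta> * s - \<alpha> * t + t) *\<^sub>R (q - y)"] mu nu by fastforce
    finally have *: "?D * N (z - y) \<le> (\<alpha> + \<beta> - 1) * N z + (s + t) * r"
      by simp
    have "(\<alpha> + \<beta> - 1) * N z \<le> (\<alpha> + \<beta> - 1) * r"
      using z by (intro mult_left_mono) auto
    then have "?D * N (z - y) \<le> ?D * r"
      using * by (simp add: algebra_simps)
    then have "N (z - y) \<le> r"
      using st z by (simp add: mult_le_cancel_left)
    moreover have "N (z - y) < r" if "1 < \<alpha> + \<beta>" "N z < r"
    proof -
      have "(\<alpha> + \<beta> - 1) * N z < (\<alpha> + \<beta> - 1) * r"
        using that by (intro mult_strict_left_mono) auto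
      then have "?D * N (z - y) < ?D * r"
        using * by (simp add: algebra_simps)
      then show ?thesis
        using st z by (simp add: mult_less_cancel_left)
    qed
    ultimately show ?thesis by blast
  qed
  \<comment> \<open>A negative coefficient would make \<open>?D\<close> times \<open>q\<close> a
    combination of \<open>z\<close> and \<open>q - y\<close> with total weight below
    \<open>?D\<close>, which contradicts \<open>N q = r\<close>.\<close>
  have mu: "0 \<le> \<alpha> * t - \<beta> * s + s" if "s > 0"
  proof (rule ccontr)
    assume "\<not> ?thesis"
    then have D: "s * \<beta> + \<alpha> - \<alpha> * t > s + \<alpha>" (is "?D > _")
      by (simp add: algebra_simps)
    have "?D *\<^sub>R q = s *\<^sub>R z + \<alpha> *\<^sub>R (q - y)"
      unfolding z y by (simp add: algebra_simps)
    from N_comb2[OF this z(5) y(3)] D that z pq have "?D * r \<le> (s + \<alpha>) * r"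
      by simp
    then show False
      using D r by simp
  qed
  consider "s \<le> 0" | "t \<ge> 0" "s > 0" | "t < 0" "s > 0"
    by linarith
  then show ?thesis
  proof cases
    \<comment> \<open>Both coordinates of \<open>y\<close> are nonpositive here. The two identities
      give \<open>s = t\<close>, and strict convexity excludes a proper negative multiple of
      \<open>p + q\<close>, so \<open>y\<close> is the origin.\<close>
    case 1
    have "(1 - s) *\<^sub>R p = 1 *\<^sub>R (p - y) + t *\<^sub>R q"
      unfolding y by (simp add: algebra_simps)
    from N_comb2[OF this y(2)] pq 1 st have "(1 - s) * r \<le> (1 - t) * r"
      by simp
    moreover have "(1 - t) *\<^sub>R q = 1 *\<^sub>R (q - y) + s *\<^sub>R p"
      unfolding y by (simp add: algebra_simps)
    from N_comb2[OF this y(3)] pq 1 st have "(1 - t) * r \<le> (1 - s) * r"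
      by simp
    ultimately have "s = t"
      using r by simp
    have "s = 0"
    proof (rule ccontr)
      assume "s \<noteq> 0"
      have e: "(1 + (- s)) *\<^sub>R p = 1 *\<^sub>R (p - y) + (- s) *\<^sub>R (- q)"
        unfolding y using \<open>s = t\<close> by (simp add: algebra_simps)
      have "N p < r"
        using N_comb2_less[OF e y(2)] pq \<open>s \<noteq> 0\<close> 1 by auto
      then show False
        using pq by simp
    qed
    then show ?thesis
      using \<open>s = t\<close> z unfolding y by simp
  next
    case 2
    have "0 \<le> \<beta> * s - \<alpha> * t + t"
    proof (rule ccontr)
      assume neg: "\<not> ?thesis"
      then have D: "t * \<alpha> + \<beta> - \<beta> * s > t + \<beta>" (is "?D > _")
        by (simp add: algebra_simps)
      have "?D *\<^sub>R p = t *\<^sub>R z + \<beta> *\<^sub>R (p - y)"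
        unfolding z y by (simp add: algebra_simps)
      from N_comb2[OF this z(5) y(2)] D 2 z pq have "?D * r \<le> (t + \<beta>) * r"
        by simp
      then show False
        using D r by simp
    qed
    then show ?thesis
      using main mu 2 by auto
  next
    \<comment> \<open>The strict bound \<open>- t < s\<close> makes \<open>s + t\<close> positive;
      together with \<open>1 \<le> \<alpha> + \<beta>\<close> it also gives the sign of the second
      coefficient.\<close>
    case 3
    have e: "(1 - t) *\<^sub>R q = 1 *\<^sub>R (q - y) + s *\<^sub>R p"
      unfolding y by (simp add: algebra_simps)
    from N_comb2[OF this y(3)] pq 3 st have "(1 - t) * r \<le> (1 + s) * r"
      by simp
    then have "- t \<le> s"
      using r by simp
    have "- t \<noteq> s"
    proof
      assume ts: "- t = s"
      have "N q < r"
        using N_comb2_less[of 1 s q "q - y" p r] e y pq ts 3 by auto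
      then show False
        using pq by simp
    qed
    have "(- t) * 1 \<le> (- t) * (\<alpha> + \<beta>)"
      using 3 z by (intro mult_left_mono) auto
    also have "\<dots> \<le> \<beta> * s - \<alpha> * t"
      using mult_left_mono[OF \<open>- t \<le> s\<close> z(3)] by (simp add: algebra_simps)
    finally have "0 \<le> \<beta> * s - \<alpha> * t + t"
      by simp
    then show ?thesis
      using main mu 3 \<open>- t \<le> s\<close> \<open>- t \<noteq> s\<close> by auto
  qed
qed

lemma cross_zero_same_norm:
  assumes "cross p q = 0" "N p = r" "N q = r" "r > 0"
  shows "q = p \<or> q = - p"
proof -
  have "N p \<noteq> 0"
    using assms by simp
  then have "p \<noteq> 0"
    by auto
  have "\<exists>k. q = k *\<^sub>R p"
  proof (cases "fst p = 0")
    case True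
    then show ?thesis
      using \<open>p \<noteq> 0\<close> assms(1) by (intro exI[of _ "snd q / snd p"]) (auto simp: cross_def prod_eq_iff)
  next
    case False
    then show ?thesis
      using assms(1) by (intro exI[of _ "fst q / fst p"]) (auto simp: cross_def prod_eq_iff field_simps)
  qed
  then obtain k where k: "q = k *\<^sub>R p"
    by blast
  then have "\<bar>k\<bar> = 1"
    using assms by (simp add: N_scale)
  then show ?thesis
    using k by (auto simp: abs_if split: if_splits)
qed

text \<open>Cramer's rule for the basis \<open>p\<close>, \<open>q\<close>.\<close>

lemma cross_basis:
  assumes "cross p q \<noteq> 0"
  shows "z = (cross z q / cross p q) *\<^sub>R p + (cross p z / cross p q) *\<^sub>R q"
proof -
  have "cross p q *\<^sub>R z = cross z q *\<^sub>R p + cross p z *\<^sub>R q"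
    by (simp add: prod_eq_iff cross_def algebra_simps)
  then have "(1 / cross p q) *\<^sub>R (cross p q *\<^sub>R z) = (1 / cross p q) *\<^sub>R (cross z q *\<^sub>R p + cross p z *\<^sub>R q)"
    by simp
  then show ?thesis
    using assms by (simp add: scaleR_add_right)
qed

text \<open>The coordinates of \<open>z\<close> add up to one minus
  \<open>cross (q - p) (z - p) / cross p q\<close>, so the side of the chord is the sign that
  \<open>cap_aux\<close> asks for. A negative coordinate beyond the chord would again contradict
  strict convexity. Antipodal \<open>p\<close>, \<open>q\<close> give no basis, but then the disc
  around the origin is the only one that contains both.\<close>

lemma cap_lemma0:
  assumes pq: "N p = r" "N q = r" "p \<noteq> q" "cross p q \<ge> 0" and r: "r > 0"
    and z: "N z \<le> r" "cross (q - p) (z - p) \<le> 0"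
    and y: "N (p - y) \<le> r" "N (q - y) \<le> r"
  shows "N (z - y) \<le> r" "cross (q - p) (z - p) < 0 \<Longrightarrow> N z < r \<Longrightarrow> N (z - y) < r"
proof -
  have "N (z - y) \<le> r \<and> (cross (q - p) (z - p) < 0 \<and> N z < r \<longrightarrow> N (z - y) < r)"
  proof (cases "cross p q = 0")
    case True
    then have "q = - p"
      using cross_zero_same_norm pq r by metis
    then have "p - y = p"
      using midpoint_eq[of "p - y" r "p + y" p] pq y N_commute[of q y]
      by (simp add: scaleR_2 N_commute add.commute)
    then show ?thesis
      using z by simp
  next
    case False
    then have pos: "cross p q > 0"
      using pq by simp
    define \<alpha> \<beta> where "\<alpha> = cross z q / cross p q" and "\<beta> = cross p z / cross p q"
    have zz: "z = \<alpha> *\<^sub>R p + \<beta> *\<^sub>R q"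
      unfolding \<alpha>_def \<beta>_def using cross_basis[OF False] .
    have sum: "(\<alpha> + \<beta> - 1) * cross p q = - cross (q - p) (z - p)"
      using pos unfolding \<alpha>_def \<beta>_def by (simp add: field_simps) (simp add: cross_def algebra_simps)
    then have sum1: "1 \<le> \<alpha> + \<beta>"
      using z pos by (smt (verit) mult_neg_pos)
    have sum2: "1 < \<alpha> + \<beta>" if "cross (q - p) (z - p) < 0"
      using that sum pos by (smt (verit) mult_nonpos_nonneg)
    have aux: False if "N p = r" "N q = r" "p \<noteq> q" "z = \<alpha> *\<^sub>R p + \<beta> *\<^sub>R q" "1 \<le> \<alpha> + \<beta>" "\<beta> < 0" for p q \<alpha> \<beta>
    proof -
      have e: "\<alpha> *\<^sub>R p = 1 *\<^sub>R z + (- \<beta>) *\<^sub>R q"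
        using that by simp
      from N_comb2[OF this z(1)] that have "\<alpha> * r \<le> (1 - \<beta>) * r"
        by simp
      then have \<alpha>: "\<alpha> = 1 + (- \<beta>)"
        using r that by simp
      have "N p < r"
        using N_comb2_less[of 1 "- \<beta>" p z q r] e \<alpha> z that by simp
      then show False
        using that by simp
    qed
    have nonneg: "0 \<le> \<alpha>" "0 \<le> \<beta>"
      using aux[of p q \<alpha> \<beta>] aux[of q p \<beta> \<alpha>] zz sum1 pq by (force simp: add.commute)+
    define s t where "s = cross y q / cross p q" and "t = cross p y / cross p q"
    have yy: "y = s *\<^sub>R p + t *\<^sub>R q"
      unfolding s_def t_def using cross_basis[OF False] .
    have "p \<noteq> - q"
      using False by (auto simp: cross_def)
    then have "N (z - y) \<le> r \<and> (1 < \<alpha> + \<beta> \<and> N z < r \<longrightarrow> N (z - y) < r)"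
    proof (cases "t \<le> s")
      case True
      show ?thesis
        by (rule cap_aux[OF pq(1-3) \<open>p \<noteq> - q\<close> r zz nonneg sum1 z(1) yy y True])
    next
      case nts: False
      have "q \<noteq> - p"
        using \<open>p \<noteq> - q\<close> by auto
      have "N (z - y) \<le> r \<and> (1 < \<beta> + \<alpha> \<and> N z < r \<longrightarrow> N (z - y) < r)"
      proof (rule cap_aux[OF pq(2,1) _ \<open>q \<noteq> - p\<close> r _ nonneg(2,1) _ z(1) _ y(2,1)])
        show "z = \<beta> *\<^sub>R q + \<alpha> *\<^sub>R p" "y = t *\<^sub>R q + s *\<^sub>R p"
          using zz yy by (simp_all add: add.commute)
      qed (use pq sum1 nts in auto)
      then show ?thesis
        by (simp add: add.commute)
    qed
    then show ?thesis
      using sum2 by blast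
  qed
  then show "N (z - y) \<le> r" "cross (q - p) (z - p) < 0 \<Longrightarrow> N z < r \<Longrightarrow> N (z - y) < r"
    by auto
qed

text \<open>Identities between the five vectors squeeze \<open>s\<close>. For
  \<open>s \<ge> 0\<close> they give \<open>t < s\<close> and then \<open>s = 2 + t\<close>, which
  contradicts strict convexity; for \<open>s < 0\<close> the bounds \<open>t < - s\<close> and
  \<open>- s \<le> t\<close> collide.\<close>

lemma pivot_aux:
  assumes f: "N f = r" "N x = r" "f \<noteq> x" "f \<noteq> - x" and r: "r > 0"
    and g: "g = s *\<^sub>R f - t *\<^sub>R x" "t \<ge> 0" "g \<noteq> 0" "N (g - f) = r" "N (g - x) \<le> r"
  shows False
proof -
  have gf: "N (f - g) = r" "N (x - g) \<le> r"
    using g N_commute by metis+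
  show False
  proof (cases "s \<ge> 0")
    case True
    have e: "(1 + t) *\<^sub>R x = 1 *\<^sub>R (x - g) + s *\<^sub>R f"
      unfolding g by (simp add: algebra_simps)
    from N_comb2[OF this gf(2)] f g True have "(1 + t) * r \<le> (1 + s) * r"
      by simp
    then have "t \<le> s"
      using r by simp
    have "t \<noteq> s"
    proof
      assume "t = s"
      have "t \<noteq> 0"
        using g \<open>t = s\<close> by auto
      have "N x < r"
        using N_comb2_less[of 1 s x "x - g" f r] e gf f g \<open>t = s\<close> \<open>t \<noteq> 0\<close> by auto
      then show False
        using f by simp
    qed
    then have ts: "t < s"
      using \<open>t \<le> s\<close> by simp
    have "(1 + t) *\<^sub>R (f - g) = t *\<^sub>R (x - g) + (1 + t - s) *\<^sub>R f"
      unfolding g by (simp add: algebra_simps)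
    from N_comb2[OF this gf(2)] f g gf have "(1 + t) * r \<le> (t + \<bar>1 + t - s\<bar>) * r"
      by simp
    then have "1 + t \<le> t + \<bar>1 + t - s\<bar>"
      using r by simp
    then have s1: "s \<ge> 2 + t"
      using ts by linarith
    have e2: "(s - 1) *\<^sub>R f = 1 *\<^sub>R (g - f) + t *\<^sub>R x"
      unfolding g by (simp add: algebra_simps)
    from N_comb2[OF this, of r] f g s1 have "(s - 1) * r \<le> (1 + t) * r"
      by simp
    then have s2: "s = 2 + t"
      using s1 r by simp
    show False
    proof (cases "t = 0")
      case True
      then have "2 *\<^sub>R f = (g - x) + x"
        unfolding g s2 by simp
      then have "x = f"
        using midpoint_eq[of "g - x" r x f] f g by auto
      then show False
        using f by simp
    next
      case False
      have "N f < r"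
        using N_comb2_less[of 1 t f "g - f" x r] e2 s2 f g False by auto
      then show False
        using f by simp
    qed
  next
    case False
    have e: "(1 + t) *\<^sub>R x = 1 *\<^sub>R (x - g) + s *\<^sub>R f"
      unfolding g by (simp add: algebra_simps)
    from N_comb2[OF this gf(2)] f g False have "(1 + t) * r \<le> (1 - s) * r"
      by simp
    then have "t \<le> - s"
      using r by simp
    have "t \<noteq> - s"
    proof
      assume ts: "t = - s"
      have "x \<noteq> - f"
        using f(4) by auto
      then have "N x < r"
        using N_comb2_less[of 1 t x "x - g" "- f" r] e gf f ts False by auto
      then show False
        using f by simp
    qed
    have "(1 - s) *\<^sub>R f = 1 *\<^sub>R (f - g) + (- t) *\<^sub>R x"
      unfolding g by (simp add: algebra_simps)
    from N_comb2[OF this, of r] f gf g False have "(1 - s) * r \<le> (1 + t) * r"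
      by simp
    then show False
      using r \<open>t \<le> - s\<close> \<open>t \<noteq> - s\<close> by simp
  qed
qed

text \<open>The case \<open>x = - f\<close> of the pivoting argument: \<open>f\<close> is the
  midpoint of \<open>g + f\<close> and \<open>f - g\<close>.\<close>

lemma antipodal_pivot:
  assumes "N f = r" "r > 0" "N (g - f) = r" "N (g + f) \<le> r"
  shows "g = 0"
proof -
  have "g + f = f"
    using midpoint_eq[of "g + f" r "f - g" f] assms by (simp add: scaleR_2 N_commute)
  then show ?thesis
    by simp
qed

text \<open>Read \<open>f\<close> and \<open>x\<close> as centres of discs with the origin on their
  boundary. A disc that rotates about the origin while containing \<open>g\<close> is in an extreme
  position when its circle passes through \<open>g\<close>; the side of \<open>g\<close> on which
  \<open>f\<close> lies tells which extreme it is.\<close>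

lemma pivot_lemma:
  assumes f: "N f = r" "N x = r" and r: "r > 0"
    and g: "g \<noteq> 0" "N (g - f) = r" "N (g - x) \<le> r"
  shows "cross g f \<ge> 0 \<Longrightarrow> cross x f > 0 \<or> x = f"
    and "cross g f \<le> 0 \<Longrightarrow> cross f x > 0 \<or> x = f"
proof -
  have *: False if "x \<noteq> f" "cross g f * cross x f \<le> 0"
  proof (cases "cross x f = 0")
    case True
    then have "x = - f"
      using cross_zero_same_norm[of x f] f r that by auto
    then show False
      using antipodal_pivot f g r by auto
  next
    case False
    then have ne: "cross f x \<noteq> 0"
      by (simp add: cross_def mult.commute)
    have "g = (cross g x / cross f x) *\<^sub>R f + (cross f g / cross f x) *\<^sub>R x"
      by (rule cross_basis[OF ne])
    then have e: "g = (cross g x / cross f x) *\<^sub>R f - (- (cross f g / cross f x)) *\<^sub>R x"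
      by simp
    have "(cross f g / cross f x) = cross g f * cross x f / (cross x f)^2"
    proof -
      have "cross f g = - cross g f" "cross f x = - cross x f"
        by (simp_all add: cross_def)
      then show ?thesis
        using False by (simp add: power2_eq_square)
    qed
    also have "\<dots> \<le> 0"
      using that by (simp add: divide_le_0_iff)
    finally have "- (cross f g / cross f x) \<ge> 0"
      by simp
    moreover have "f \<noteq> - x"
      using ne by (auto simp: cross_def)
    ultimately show False
      using pivot_aux[OF f(1,2) _ _ r e] that g by auto
  qed
  show "cross g f \<ge> 0 \<Longrightarrow> cross x f > 0 \<or> x = f"
    using * by (meson linorder_not_less mult_nonneg_nonpos)
  show "cross g f \<le> 0 \<Longrightarrow> cross f x > 0 \<or> x = f"
  proof -
    assume "cross g f \<le> 0"
    moreover have "cross f x = - cross x f"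
      by (simp add: cross_def)
    ultimately show ?thesis
      using * by (smt (verit) mult_nonpos_nonneg)
  qed
qed

end

section \<open>Discs of a fixed radius\<close>

context strictly_convex_plane begin

lemma cross_commute: "cross p q = - cross q p"
  by (simp add: cross_def)

lemma cross_scaleR: "cross p (k *\<^sub>R q) = k * cross p q"
  by (simp add: cross_def algebra_simps)

lemma N_diff_le: "N x - N y \<le> N (x - y)"
  using N_triangle[of "x - y" y] by simp

section \<open>Continuity of the norm and convexity of its discs\<close>

lemma N_le_norm: "N x \<le> (N (1, 0) + N (0, 1)) * norm x"
proof -
  have "1 *\<^sub>R x = fst x *\<^sub>R (1, 0) + snd x *\<^sub>R (0, 1)"
    by (simp add: prod_eq_iff)
  then have "N x \<le> \<bar>fst x\<bar> * N (1, 0) + \<bar>snd x\<bar> * N (0, 1)"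
    using N_triangle N_scale by (metis scaleR_one)
  also have "\<dots> \<le> norm x * N (1, 0) + norm x * N (0, 1)"
    using norm_fst_le[of "fst x" "snd x"] norm_snd_le[of "snd x" "fst x"] N_nonneg
    by (intro add_mono mult_right_mono) simp_all
  finally show ?thesis
    by (simp add: algebra_simps)
qed

lemma continuous_on_N: "continuous_on S N"
proof -
  have "L-lipschitz_on UNIV N" if "L = N (1, 0) + N (0, 1)" for L
  proof (rule lipschitz_onI)
    show "0 \<le> L"
      using N_nonneg that by simp
    fix x y
    have "\<bar>N x - N y\<bar> \<le> N (x - y)"
      using N_diff_le[of x y] N_diff_le[of y x] N_commute[of x y] by linarith
    also have "\<dots> \<le> L * norm (x - y)"
      using N_le_norm that by simp
    finally show "dist (N x) (N y) \<le> L * dist x y"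
      by (simp add: dist_norm)
  qed
  then show ?thesis
    using lipschitz_on_continuous_on continuous_on_subset by blast
qed

lemma continuous_on_N_comp [continuous_intros]:
  "continuous_on S f \<Longrightarrow> continuous_on S (\<lambda>x. N (f x))"
  using continuous_on_compose2[OF continuous_on_N[of UNIV]] by blast

lemma N_ball_convex:
  assumes "N (k - x) \<le> r" "N (k - y) \<le> r" "0 \<le> t" "t \<le> 1"
  shows "N (k - (x + t *\<^sub>R (y - x))) \<le> r"
proof -
  have "1 *\<^sub>R (k - (x + t *\<^sub>R (y - x))) = (1 - t) *\<^sub>R (k - x) + t *\<^sub>R (k - y)"
    by (simp add: algebra_simps)
  from N_comb2[OF this assms(1,2)] assms(3,4) show ?thesis
    by simp
qed

end

definition common_centres :: "(point \<Rightarrow> real) \<Rightarrow> real \<Rightarrow> point set \<Rightarrow> point set" where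
  "common_centres N r K = {x. \<forall>k\<in>K. N (k - x) \<le> r}"

definition ball_vertices :: "(point \<Rightarrow> real) \<Rightarrow> real \<Rightarrow> point set \<Rightarrow> point set" where
  "ball_vertices N r K = {k \<in> K. \<exists>x\<in>common_centres N r K. N (k - x) = r}"

definition left_centre :: "(point \<Rightarrow> real) \<Rightarrow> real \<Rightarrow> point \<Rightarrow> point \<Rightarrow> point" where
  "left_centre N r p q = (SOME c. N (p - c) = r \<and> N (q - c) = r \<and> 0 \<le> cross (q - p) (c - p))"

locale ball_plane = strictly_convex_plane +
  fixes r :: real
  assumes r_pos: "0 < r"
begin

abbreviation "C \<equiv> common_centres N r"
abbreviation "V \<equiv> ball_vertices N r"
abbreviation "lc \<equiv> left_centre N r"

text \<open>The strict part is what excludes vertices: a point strictly beyond the chord and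
  strictly inside the disc around \<open>c\<close> is strictly inside every disc that contains
  \<open>p\<close> and \<open>q\<close>.\<close>

lemma cap_lemma:
  assumes c: "N (p - c) = r" "N (q - c) = r" "p \<noteq> q" "0 \<le> cross (q - p) (c - p)"
    and z: "N (z - c) \<le> r" "cross (q - p) (z - p) \<le> 0"
    and y: "N (p - y) \<le> r" "N (q - y) \<le> r"
  shows "N (z - y) \<le> r" "cross (q - p) (z - p) < 0 \<Longrightarrow> N (z - c) < r \<Longrightarrow> N (z - y) < r"
proof -
  have "cross (p - c) (q - c) = cross (q - p) (c - p)"
    by (simp add: cross_def algebra_simps)
  then show "N (z - y) \<le> r" "cross (q - p) (z - p) < 0 \<Longrightarrow> N (z - c) < r \<Longrightarrow> N (z - y) < r"
    using cap_lemma0[of "p - c" r "q - c" "z - c" "y - c"] assms r_pos by simp_all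
qed

text \<open>The centre is found by rotating: \<open>w \<tau>\<close> turns from the direction of
  \<open>q - p\<close> to its opposite through the left half plane, and \<open>c \<tau>\<close> is
  the point at distance \<open>r\<close> from \<open>p\<close> in that direction. Its distance to
  \<open>q\<close> is at most \<open>r\<close> at the start, because
  \<open>N (q - p) \<le> 2 * r\<close>, and at least \<open>r\<close> at the end.\<close>

lemma left_centre_exists:
  assumes "p \<noteq> q" "N (q - p) \<le> 2 * r"
  shows "\<exists>c. N (p - c) = r \<and> N (q - c) = r \<and> 0 \<le> cross (q - p) (c - p)"
proof -
  define u where "u = q - p"
  have u: "u \<noteq> 0"
    using assms(1) by (simp add: u_def)
  then have Nu: "0 < N u"
    using N_nonneg[of u] N_eq_0[of u] by linarith
  define w where "w = (\<lambda>\<tau>. cos \<tau> *\<^sub>R u + sin \<tau> *\<^sub>R (- snd u, fst u))"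
  have cross_w: "cross u (w \<tau>) = sin \<tau> * ((fst u)\<^sup>2 + (snd u)\<^sup>2)" for \<tau>
    by (simp add: w_def cross_def power2_eq_square algebra_simps)
  have w0: "w \<tau> \<noteq> 0" for \<tau>
  proof
    assume "w \<tau> = 0"
    then have w0: "fst (w \<tau>) = 0" "snd (w \<tau>) = 0"
      by (auto simp: prod_eq_iff)
    have "(fst (w \<tau>))\<^sup>2 + (snd (w \<tau>))\<^sup>2 = (sin \<tau>)\<^sup>2 * ((fst u)\<^sup>2 + (snd u)\<^sup>2) + (cos \<tau>)\<^sup>2 * ((fst u)\<^sup>2 + (snd u)\<^sup>2)"
      by (simp add: w_def power2_eq_square algebra_simps)
    then have "(fst u)\<^sup>2 + (snd u)\<^sup>2 = 0"
      using w0 by (simp flip: distrib_right)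
    then show False
      using u by (simp add: sum_power2_eq_zero_iff prod_eq_iff)
  qed
  then have Nw: "N (w \<tau>) > 0" for \<tau>
    using N_nonneg[of "w \<tau>"] N_eq_0[of "w \<tau>"] by (metis order_le_less)
  define c where "c = (\<lambda>\<tau>. p + (r / N (w \<tau>)) *\<^sub>R w \<tau>)"
  have cont_w: "continuous_on {0..pi} w"
    unfolding w_def by (intro continuous_intros)
  have cont: "continuous_on {0..pi} (\<lambda>\<tau>. N (q - c \<tau>))"
    unfolding c_def using cont_w Nw by (intro continuous_intros) (simp_all add: w0)
  have c0: "N (q - c 0) \<le> r"
  proof -
    have "w 0 = u"
      by (simp add: w_def prod_eq_iff)
    then have "q - c 0 = (1 - r / N u) *\<^sub>R u"
      unfolding c_def by (simp only:) (simp add: u_def algebra_simps)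
    then have "N (q - c 0) = \<bar>1 - r / N u\<bar> * N u"
      by (simp add: N_scale)
    also have "\<dots> = \<bar>N u - r\<bar>"
    proof -
      have "\<bar>1 - r / N u\<bar> * N u = \<bar>(1 - r / N u) * N u\<bar>"
        using Nu by (simp add: abs_mult)
      also have "(1 - r / N u) * N u = N u - r"
        using Nu u by (simp add: field_simps)
      finally show ?thesis .
    qed
    finally show ?thesis
      using assms(2) Nu by (simp add: u_def)
  qed
  have cpi: "r \<le> N (q - c pi)"
  proof -
    have "w pi = - u"
      by (simp add: w_def prod_eq_iff)
    then have "q - c pi = (1 + r / N u) *\<^sub>R u"
      unfolding c_def by (simp only: N_minus) (simp add: u_def algebra_simps)
    then have "N (q - c pi) = (1 + r / N u) * N u"
      using Nu r_pos by (simp add: N_scale)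
    also have "\<dots> = N u + r"
      using Nu u by (simp add: field_simps)
    finally show ?thesis
      using Nu by simp
  qed
  obtain \<tau> where \<tau>: "0 \<le> \<tau>" "\<tau> \<le> pi" "N (q - c \<tau>) = r"
    using IVT'[OF c0 cpi _ cont] by auto
  have "N (p - c \<tau>) = r"
    using Nw[of \<tau>] w0 r_pos by (simp add: c_def N_scale)
  moreover have "cross (q - p) (c \<tau> - p) = (r / N (w \<tau>)) * cross u (w \<tau>)"
    by (simp add: c_def u_def cross_scaleR)
  then have "0 \<le> cross (q - p) (c \<tau> - p)"
    using cross_w \<tau> Nw[of \<tau>] r_pos by (simp add: sin_ge_zero)
  ultimately show ?thesis
    using \<tau> by blast
qed

lemma left_centre:
  assumes "p \<noteq> q" "N (q - p) \<le> 2 * r"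
  shows "N (p - lc p q) = r" "N (q - lc p q) = r" "0 \<le> cross (q - p) (lc p q - p)"
  using someI_ex[OF left_centre_exists[OF assms]] by (simp_all add: left_centre_def)

text \<open>By \<open>pivot_lemma\<close>, each of two different candidates would lie strictly
  counterclockwise of the other as seen from \<open>p\<close>.\<close>

lemma left_centre_unique:
  assumes "p \<noteq> q" "N (p - c) = r" "N (q - c) = r" "0 \<le> cross (q - p) (c - p)"
  shows "c = lc p q"
proof -
  have "1 *\<^sub>R (q - p) = 1 *\<^sub>R (q - c) + (- 1) *\<^sub>R (p - c)"
    by simp
  from N_comb2[OF this, of r] assms have "N (q - p) \<le> 2 * r"
    by simp
  note l = left_centre[OF assms(1) this]
  have "N (c - p) = r" "N (lc p q - p) = r"
    using assms l N_commute by metis+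
  then have "0 < cross (lc p q - p) (c - p) \<or> lc p q - p = c - p"
    "0 < cross (c - p) (lc p q - p) \<or> c - p = lc p q - p"
    using pivot_lemma(1)[of "c - p" r "lc p q - p" "q - p"] pivot_lemma(1)[of "lc p q - p" r "c - p" "q - p"] assms l r_pos
    by simp_all
  then show ?thesis
    using cross_commute[of "c - p" "lc p q - p"] by auto
qed

lemma N_diff_le_2r:
  assumes "N (p - x) \<le> r" "N (q - x) \<le> r"
  shows "N (q - p) \<le> 2 * r"
proof -
  have "1 *\<^sub>R (q - p) = 1 *\<^sub>R (q - x) + (- 1) *\<^sub>R (p - x)"
    by simp
  from N_comb2[OF this, of r] assms show ?thesis
    by simp
qed

lemma left_centre_diff:
  assumes "p \<noteq> q" "N (q - p) \<le> 2 * r"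
  shows "N (lc p q - p) = r" "N (lc p q - q) = r"
  using left_centre[OF assms] N_commute by metis+

text \<open>The point reflection that exchanges \<open>p\<close> and \<open>q\<close> exchanges the
  two circles, and one of a point and its image lies to the left of the line. This determines what
  the intersection primitive returns.\<close>

lemma circles_inter:
  assumes "p \<noteq> q" "N (q - p) \<le> 2 * r"
  shows "circle N p r \<inter> circle N q r = {lc p q, p + q - lc p q}"
proof -
  note l = left_centre[OF assms] left_centre_diff[OF assms]
  have "x = lc p q \<or> x = p + q - lc p q" if x: "N (x - p) = r" "N (x - q) = r" for x
  proof (cases "0 \<le> cross (q - p) (x - p)")
    case True
    then show ?thesis
      using left_centre_unique[OF assms(1), of x] x N_commute by metis
  next
    case False
    have "cross (q - p) (p + q - x - p) = - cross (q - p) (x - p)"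
      by (simp add: cross_def algebra_simps)
    then have "p + q - x = lc p q"
      using False x by (intro left_centre_unique[OF assms(1)]) auto
    then show ?thesis
      by (metis add_diff_cancel_left' diff_diff_eq2 add.commute)
  qed
  moreover have "N (p + q - lc p q - p) = r" "N (p + q - lc p q - q) = r"
    using l by simp_all
  ultimately show ?thesis
    using l by (auto simp: circle_def)
qed

text \<open>Here \<open>cap_lemma\<close> is used with points and centres exchanged:
  \<open>x\<close> and \<open>z\<close> are the ends of a chord of the circle around
  \<open>a\<close>, \<open>y\<close> is on the arc between them, and \<open>v\<close> is the centre
  of a disc that contains \<open>x\<close> and \<open>z\<close>. Read back, the disc around
  \<open>y\<close> contains the intersection of the discs around \<open>x\<close> and
  \<open>z\<close>.\<close>

lemma arc_lemma:
  assumes s: "N (x - a) = r" "N (y - a) = r" "N (z - a) = r"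
    and c: "0 < cross (x - a) (z - a)" "0 \<le> cross (x - a) (y - a)" "0 \<le> cross (y - a) (z - a)"
    and v: "N (v - x) \<le> r" "N (v - z) \<le> r"
  shows "N (v - y) \<le> r"
proof -
  let ?D = "cross (x - a) (z - a)"
  define \<alpha> \<beta> where "\<alpha> = cross (y - a) (z - a) / ?D" and "\<beta> = cross (x - a) (y - a) / ?D"
  have nn: "0 \<le> \<alpha>" "0 \<le> \<beta>"
    using c by (simp_all add: \<alpha>_def \<beta>_def)
  have "1 *\<^sub>R (y - a) = \<alpha> *\<^sub>R (x - a) + \<beta> *\<^sub>R (z - a)"
    using cross_basis[of "x - a" "z - a" "y - a"] c unfolding \<alpha>_def \<beta>_def by simp
  from N_comb2[OF this, of r] s nn have "r \<le> (\<alpha> + \<beta>) * r"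
    by simp
  then have ge: "1 \<le> \<alpha> + \<beta>"
    using r_pos by simp
  have "cross (z - x) (y - x) = - (\<alpha> + \<beta> - 1) * ?D"
    using c unfolding \<alpha>_def \<beta>_def by (simp add: field_simps) (simp add: cross_def algebra_simps)
  then have cr: "cross (z - x) (y - x) \<le> 0"
    using ge c by (simp add: mult_nonpos_nonneg)
  have e: "cross (z - x) (a - x) = ?D"
    by (simp add: cross_def algebra_simps)
  have "x \<noteq> z"
    using c by (auto simp: cross_def)
  then have "N (y - v) \<le> r"
    using cap_lemma(1)[of x a z y v] s c v cr e N_commute[of v] by simp
  then show ?thesis
    using N_commute by metis
qed

text \<open>This is \<open>pivot_lemma\<close> with \<open>a\<close> as the origin: the centres of
  discs that contain \<open>v\<close> and have \<open>a\<close> on their circle run counterclockwise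
  from \<open>lc v a\<close> to \<open>lc a v\<close>.\<close>

lemma centre_order:
  assumes "v \<noteq> a" "N (a - x) = r" "N (v - x) \<le> r"
  shows "lc a v = x \<or> 0 < cross (x - a) (lc a v - a)"
    and "lc v a = x \<or> 0 < cross (lc v a - a) (x - a)"
proof -
  have d: "N (v - a) \<le> 2 * r" "N (a - v) \<le> 2 * r"
    using N_diff_le_2r[of a x v] N_diff_le_2r[of v x a] assms by simp_all
  have xa: "N (x - a) = r"
    using assms N_commute by metis
  note l1 = left_centre[OF assms(1)[symmetric] d(1)] left_centre_diff[OF assms(1)[symmetric] d(1)]
  note l2 = left_centre[OF assms(1) d(2)] left_centre_diff[OF assms(1) d(2)]
  show "lc a v = x \<or> 0 < cross (x - a) (lc a v - a)"
    using pivot_lemma(1)[of "lc a v - a" r "x - a" "v - a"] l1 xa r_pos assms by auto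
  have "cross (v - a) (lc v a - a) = - cross (a - v) (lc v a - v)"
    by (simp add: cross_def algebra_simps)
  then show "lc v a = x \<or> 0 < cross (lc v a - a) (x - a)"
    using pivot_lemma(2)[of "lc v a - a" r "x - a" "v - a"] l2 xa r_pos assms by auto
qed

section \<open>Admissible centres, vertices and their successors\<close>

lemma C_antimono: "A \<subseteq> B \<Longrightarrow> C B \<subseteq> C A"
  by (auto simp: common_centres_def)

lemma C_insert: "x \<in> C (insert k K) \<longleftrightarrow> N (k - x) \<le> r \<and> x \<in> C K"
  by (auto simp: common_centres_def)

lemma C_Un: "C (A \<union> B) = C A \<inter> C B"
  by (auto simp: common_centres_def)

lemma C_D: "x \<in> C K \<Longrightarrow> k \<in> K \<Longrightarrow> N (k - x) \<le> r"
  by (auto simp: common_centres_def)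

lemma C_dist: "x \<in> C K \<Longrightarrow> p \<in> K \<Longrightarrow> q \<in> K \<Longrightarrow> N (q - p) \<le> 2 * r"
  using N_diff_le_2r C_D by metis

lemma V_subset: "V K \<subseteq> K"
  by (auto simp: ball_vertices_def)

lemma V_I: "k \<in> K \<Longrightarrow> x \<in> C K \<Longrightarrow> N (k - x) = r \<Longrightarrow> k \<in> V K"
  by (auto simp: ball_vertices_def)

lemma V_D: "k \<in> V K \<Longrightarrow> \<exists>x. x \<in> C K \<and> N (k - x) = r"
  unfolding ball_vertices_def by blast

lemma V_antimono: "k \<in> V B \<Longrightarrow> A \<subseteq> B \<Longrightarrow> k \<in> A \<Longrightarrow> k \<in> V A"
  by (metis V_D V_I C_antimono subsetD)

text \<open>Rotate the disc around \<open>x\<close> counterclockwise about \<open>a\<close> until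
  its circle meets a point of \<open>K\<close>: this point is the successor. The induction keeps the
  first point that is met.\<close>

lemma successor_exists:
  assumes "finite K" "K \<noteq> {}" "a \<notin> K" "N (a - x) = r" "x \<in> C K"
  shows "\<exists>w\<in>K. lc a w \<in> C K"
  using assms
proof (induction K rule: finite_ne_induct)
  case (singleton v)
  then have "N (v - a) \<le> 2 * r"
    by (intro N_diff_le_2r[of _ x]) (auto simp: common_centres_def)
  then show ?case
    using left_centre[of a v] singleton by (auto simp: common_centres_def)
next
  case (insert v K)
  have av: "a \<noteq> v" and vx: "N (v - x) \<le> r" and xK: "x \<in> C K"
    using insert.prems by (auto simp: common_centres_def)
  obtain w where w: "w \<in> K" "lc a w \<in> C K"
    using insert xK by auto
  have wx: "N (w - x) \<le> r" "a \<noteq> w"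
    using w xK insert.prems by (auto simp: common_centres_def)
  have d: "N (v - a) \<le> 2 * r" "N (w - a) \<le> 2 * r"
    using N_diff_le_2r[of a x] insert.prems vx wx by auto
  note lv = left_centre[OF av d(1)] left_centre_diff[OF av d(1)]
  note lw = left_centre[OF wx(2) d(2)] left_centre_diff[OF wx(2) d(2)]
  have xa: "N (x - a) = r"
    using insert.prems N_commute by metis
  show ?case
  proof (cases "N (v - lc a w) \<le> r")
    case True
    then show ?thesis
      using w by (auto simp: C_insert)
  next
    case False
    then have "lc a w \<noteq> x"
      using vx by auto
    then have xw: "0 < cross (x - a) (lc a w - a)"
      using centre_order(1)[OF wx(2)[symmetric] insert.prems(2) wx(1)] by auto
    consider "lc a v = x" | "0 < cross (x - a) (lc a v - a)"
      using centre_order(1)[OF av[symmetric] insert.prems(2) vx] by auto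
    then show ?thesis
    proof cases
      case 1
      then show ?thesis
        using insert.prems by auto
    next
      case 2
      \<comment> \<open>Otherwise \<open>lc a w\<close> would lie between \<open>x\<close> and
        \<open>lc a v\<close>, and by \<open>arc_lemma\<close> its disc would contain
        \<open>v\<close>. So the rotation meets \<open>v\<close> before \<open>w\<close>.\<close>
      have "\<not> 0 \<le> cross (lc a w - a) (lc a v - a)"
        using arc_lemma[OF xa lw(4) lv(4) 2 _ _ vx] xw lv False by auto
      then have "0 \<le> cross (lc a v - a) (lc a w - a)"
        using cross_commute[of "lc a v - a" "lc a w - a"] by simp
      then have "N (u - lc a v) \<le> r" if "u \<in> K" for u
        using arc_lemma[OF xa lv(4) lw(4) xw _ _ C_D[OF xK that] C_D[OF w(2) that]] 2 by auto
      then have "lc a v \<in> C (insert v K)"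
        using lv by (auto simp: common_centres_def)
      then show ?thesis
        by blast
    qed
  qed
qed

text \<open>The definition of a vertex quantifies over all centres. Only finitely many candidates
  remain here, so that for a set of bounded size a constant number of circle intersections decides
  the question.\<close>

lemma V_iff_successor:
  assumes "finite K" "K \<noteq> {}" "a \<notin> K" "\<And>w. w \<in> K \<Longrightarrow> N (w - a) \<le> 2 * r"
  shows "a \<in> V (insert a K) \<longleftrightarrow> (\<exists>w\<in>K. lc a w \<in> C K)"
proof
  assume "a \<in> V (insert a K)"
  then show "\<exists>w\<in>K. lc a w \<in> C K"
    using successor_exists[OF assms(1-3)] by (metis V_D C_insert)
next
  assume "\<exists>w\<in>K. lc a w \<in> C K"
  then obtain w where w: "w \<in> K" "lc a w \<in> C K"
    by blast
  then have "N (a - lc a w) = r"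
    using left_centre(1)[of a w] assms by metis
  then show "a \<in> V (insert a K)"
    using w by (intro V_I[of _ _ "lc a w"]) (auto simp: C_insert)
qed

lemma successor_vertex:
  assumes "finite K" "a \<in> V K" "K \<noteq> {a}"
  shows "\<exists>w\<in>V K - {a}. lc a w \<in> C K"
proof -
  obtain x where x: "x \<in> C K" "N (a - x) = r" "a \<in> K"
    using assms by (auto simp: ball_vertices_def)
  have "x \<in> C (K - {a})"
    using x(1) by (simp add: common_centres_def)
  moreover have "K - {a} \<noteq> {}"
    using assms(3) x(3) by auto
  ultimately obtain w where w: "w \<in> K - {a}" "lc a w \<in> C (K - {a})"
    using successor_exists[of "K - {a}" a x] assms(1) x(2) by (meson Diff_iff finite_Diff insertI1)
  have aw: "a \<noteq> w" "N (w - a) \<le> 2 * r"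
    using w x C_dist[OF x(1)] by auto
  note l = left_centre[OF aw]
  have "lc a w \<in> C K"
    using w l by (auto simp: common_centres_def)
  moreover have "w \<in> V K"
    using calculation w l by (intro V_I[of _ _ "lc a w"]) auto
  ultimately show ?thesis
    using w by blast
qed

text \<open>Some vertex \<open>w\<close> has \<open>lc a w\<close> as an admissible centre. If
  \<open>w\<close> is not \<open>b\<close>, then \<open>b\<close> lies beyond the chord from
  \<open>a\<close> to \<open>w\<close> and, being a vertex, must lie on the same circle. So the
  centre belongs to \<open>b\<close> as well; this covers several vertices on one arc.\<close>

lemma consecutive_centre:
  assumes K: "finite K" and ab: "a \<in> V K" "b \<in> V K" "a \<noteq> b"
    and left: "\<And>v. v \<in> V K \<Longrightarrow> v \<noteq> a \<Longrightarrow> v \<noteq> b \<Longrightarrow> 0 < cross (b - a) (v - a)"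
  shows "lc a b \<in> C K"
proof -
  have "K \<noteq> {a}"
    using ab by (auto simp: ball_vertices_def)
  then obtain w where w: "w \<in> V K" "w \<noteq> a" "lc a w \<in> C K"
    using successor_vertex[OF K ab(1)] by blast
  show ?thesis
  proof (cases "w = b")
    case True
    then show ?thesis
      using w by simp
  next
    case False
    then have bw: "0 < cross (b - a) (w - a)"
      using left w by blast
    have in_K: "a \<in> K" "b \<in> K" "w \<in> K"
      using ab w V_subset by blast+
    note l = left_centre[OF w(2)[symmetric] C_dist[OF w(3) in_K(1,3)]]
    define L where "L = lc a w"
    have right: "cross (w - a) (b - a) < 0"
      using bw cross_commute[of "w - a" "b - a"] by simp
    obtain y where y: "y \<in> C K" "N (b - y) = r"
      using ab by (auto simp: ball_vertices_def)
    have "N (b - L) = r"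
    proof (rule ccontr)
      assume "N (b - L) \<noteq> r"
      then have "N (b - L) < r"
        using C_D[OF w(3) in_K(2)] by (simp add: L_def)
      then have "N (b - y) < r"
        using cap_lemma(2)[of a L w b y] l right w y in_K C_D[OF y(1)] by (auto simp: L_def)
      then show False
        using y by simp
    qed
    moreover have "0 \<le> cross (b - a) (L - a)"
    proof (rule ccontr)
      \<comment> \<open>Then \<open>a - L\<close> is a nonnegative combination of
        \<open>b - a\<close> and \<open>w - a\<close>. Rewritten relative to \<open>L\<close>, the
        factor \<open>1 + \<alpha> + \<beta>\<close> stands against weights
        \<open>\<alpha> + \<beta>\<close>, although all three points have distance \<open>r\<close>
        from \<open>L\<close>.\<close>
      assume neg: "\<not> ?thesis"
      let ?D = "cross (b - a) (w - a)"
      define \<alpha> \<beta> where "\<alpha> = - cross (L - a) (w - a) / ?D" and "\<beta> = - cross (b - a) (L - a) / ?D"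
      have "cross (w - a) (L - a) = - cross (L - a) (w - a)"
        by (simp add: cross_def)
      then have nn: "0 \<le> \<alpha>" "0 \<le> \<beta>"
        using neg bw l by (simp_all add: \<alpha>_def \<beta>_def L_def divide_le_0_iff)
      have "L - a = - \<alpha> *\<^sub>R (b - a) - \<beta> *\<^sub>R (w - a)"
        using cross_basis[of "b - a" "w - a" "L - a"] bw unfolding \<alpha>_def \<beta>_def by simp
      then have La: "a - L = \<alpha> *\<^sub>R (b - a) + \<beta> *\<^sub>R (w - a)"
        by (simp add: algebra_simps)
      have "(1 + \<alpha> + \<beta>) *\<^sub>R (a - L) = \<alpha> *\<^sub>R (b - L) + \<beta> *\<^sub>R (w - L)"
      proof -
        have "(1 + \<alpha> + \<beta>) *\<^sub>R (a - L) = (a - L) + (\<alpha> + \<beta>) *\<^sub>R (a - L)"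
          by (simp add: algebra_simps)
        then show ?thesis
          using La by (simp add: algebra_simps)
      qed
      from N_comb2[OF this, of r] nn have "(1 + \<alpha> + \<beta>) * r \<le> (\<alpha> + \<beta>) * r"
        using l \<open>N (b - L) = r\<close> by (simp add: L_def)
      then show False
        using r_pos by simp
    qed
    ultimately have "L = lc a b"
      using left_centre_unique[OF ab(3)] l by (simp add: L_def)
    then show ?thesis
      using w by (simp add: L_def)
  qed
qed

lemma C_remove_non_vertices:
  assumes "C K \<noteq> {}" "finite F" "F \<inter> V K = {}"
  shows "C (K - F) = C K"
  using assms(2,3)
proof (induction F rule: finite_induct)
  case empty
  then show ?case by simp
next
  case (insert q F)
  let ?K = "K - F"
  have IH: "C ?K = C K"
    using insert by auto
  have "y \<in> C K" if y: "y \<in> C (K - insert q F)" for y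
  proof (rule ccontr)
    assume "y \<notin> C K"
    have sub: "?K \<subseteq> insert q (K - insert q F)"
      by auto
    obtain k where k: "k \<in> ?K" "r < N (k - y)"
    proof -
      have "y \<notin> C ?K"
        using \<open>y \<notin> C K\<close> IH by simp
      then show thesis
        unfolding common_centres_def mem_Collect_eq using that by (meson not_le)
    qed
    then have "k = q"
      using C_D[OF y, of k] by (meson DiffD1 DiffD2 DiffI insertE not_le)
    with k have q: "r < N (q - y)" "q \<in> K"
      by auto
    obtain x where x: "x \<in> C K"
      using assms by blast
    define z where "z = (\<lambda>t. x + t *\<^sub>R (y - x))"
    have "\<exists>t. 0 \<le> t \<and> t \<le> 1 \<and> N (q - z t) = r"
      unfolding z_def using q C_D[OF x q(2)]
      by (intro IVT') (auto intro!: continuous_intros)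
    then obtain t where t: "0 \<le> t" "t \<le> 1" "N (q - z t) = r"
      by blast
    have "z t \<in> C (K - insert q F)"
      using t y x unfolding z_def common_centres_def by (auto intro!: N_ball_convex)
    then have "z t \<in> C (insert q (K - insert q F))"
      using t(3) by (simp add: C_insert)
    then have "z t \<in> C ?K"
      by (rule subsetD[OF C_antimono[OF sub]])
    then have "z t \<in> C K"
      using IH by simp
    then have "q \<in> V K"
      by (rule V_I[OF q(2) _ t(3)])
    then show False
      using insert by auto
  qed
  then show ?case
    using C_antimono[of "K - insert q F" K] by auto
qed

lemma C_V:
  assumes "C K \<noteq> {}" "finite K"
  shows "C (V K) = C K"
proof -
  have "K - (K - V K) = V K"
    using V_subset by blast
  then show ?thesis
    using C_remove_non_vertices[of K "K - V K"] assms by auto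
qed

text \<open>A vertex lies on the circle of an admissible disc, and points of that circle are extreme
  in the disc. The weights are not normalised, so that cross products can serve as barycentric
  coordinates.\<close>

lemma V_extreme:
  assumes v: "v \<in> V K" and "a \<in> K" "b \<in> K" "c \<in> K" "0 < \<alpha>" "0 \<le> \<beta>" "0 \<le> \<gamma>"
    and eq: "(\<alpha> + \<beta> + \<gamma>) *\<^sub>R v = \<alpha> *\<^sub>R a + \<beta> *\<^sub>R b + \<gamma> *\<^sub>R c"
  shows "a = v"
proof -
  obtain x where x: "x \<in> C K" "N (v - x) = r"
    using v by (auto simp: ball_vertices_def)
  have d: "N (a - x) \<le> r" "N (b - x) \<le> r" "N (c - x) \<le> r"
    using assms C_D[OF x(1)] by auto
  show ?thesis
  proof (cases "\<beta> + \<gamma> = 0")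
    case True
    then have "\<beta> = 0" "\<gamma> = 0"
      using assms by auto
    then show ?thesis
      using eq assms by simp
  next
    case False
    then have pos: "0 < \<beta> + \<gamma>"
      using assms by simp
    define m where "m = (1 / (\<beta> + \<gamma>)) *\<^sub>R (\<beta> *\<^sub>R b + \<gamma> *\<^sub>R c)"
    have m: "(\<beta> + \<gamma>) *\<^sub>R m = \<beta> *\<^sub>R b + \<gamma> *\<^sub>R c"
      using pos by (simp add: m_def)
    then have "(\<beta> + \<gamma>) *\<^sub>R (m - x) = \<beta> *\<^sub>R (b - x) + \<gamma> *\<^sub>R (c - x)"
      by (simp add: algebra_simps)
    from N_comb2[OF this d(2,3)] assms pos have mx: "N (m - x) \<le> r"
      by simp
    have e: "(\<alpha> + (\<beta> + \<gamma>)) *\<^sub>R v = \<alpha> *\<^sub>R a + (\<beta> + \<gamma>) *\<^sub>R m"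
      using eq m by (simp add: algebra_simps)
    then have "(\<alpha> + (\<beta> + \<gamma>)) *\<^sub>R (v - x) = \<alpha> *\<^sub>R (a - x) + (\<beta> + \<gamma>) *\<^sub>R (m - x)"
      by (simp add: algebra_simps)
    from N_comb2_less[OF this d(1) mx _ assms(5) pos] x(2) have "v = m"
      by force
    then have "\<alpha> *\<^sub>R v = \<alpha> *\<^sub>R a"
      using e by (simp add: scaleR_add_left)
    then show ?thesis
      using assms by simp
  qed
qed

text \<open>A centre that witnesses the local condition lies, as seen from \<open>v\<close>, between
  \<open>lc u v\<close> and \<open>lc v w\<close> by \<open>centre_order\<close>. Both of these are
  admissible for \<open>Q\<close>, hence so is everything between them by
  \<open>arc_lemma\<close>.\<close>

lemma V_insert_iff_local:
  assumes Q: "u \<in> V Q" "v \<in> V Q" "w \<in> V Q" "u \<noteq> v" "w \<noteq> v"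
    and c: "lc u v \<in> C Q" "lc v w \<in> C Q"
  shows "v \<in> V (insert p Q) \<longleftrightarrow> v \<in> V (insert v {u, w, p})"
proof
  assume "v \<in> V (insert p Q)"
  then show "v \<in> V (insert v {u, w, p})"
    by (rule V_antimono) (use Q V_subset in auto)
next
  assume "v \<in> V (insert v {u, w, p})"
  then obtain x where x: "N (v - x) = r" "N (u - x) \<le> r" "N (w - x) \<le> r" "N (p - x) \<le> r"
    by (auto simp: ball_vertices_def common_centres_def)
  have in_Q: "u \<in> Q" "v \<in> Q" "w \<in> Q"
    using Q V_subset by auto
  have d: "N (v - u) \<le> 2 * r" "N (w - v) \<le> 2 * r"
    using C_dist[OF c(1)] in_Q by auto
  note l1 = left_centre[OF Q(4) d(1)] left_centre_diff[OF Q(4) d(1)]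
  note l2 = left_centre[OF Q(5)[symmetric] d(2)] left_centre_diff[OF Q(5)[symmetric] d(2)]
  have "x \<in> C Q"
  proof (cases "x = lc u v \<or> x = lc v w")
    case True
    then show ?thesis
      using c by auto
  next
    case False
    then have a1: "0 < cross (lc u v - v) (x - v)" and a2: "0 < cross (x - v) (lc v w - v)"
      using centre_order[of u v x] centre_order[of w v x] x Q by auto
    have "lc v w = lc u v \<or> 0 < cross (lc u v - v) (lc v w - v)"
      using centre_order(1)[of w v "lc u v"] Q l1 C_D[OF c(1)] in_Q by auto
    moreover have "lc v w \<noteq> lc u v"
      using a1 a2 cross_commute[of "x - v" "lc u v - v"] by auto
    ultimately have a3: "0 < cross (lc u v - v) (lc v w - v)"
      by simp
    have "N (x - v) = r"
      using x N_commute by metis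
    then have "N (k - x) \<le> r" if "k \<in> Q" for k
      using arc_lemma[OF l1(5) _ l2(4) a3, of x k] a1 a2 that c C_D by simp
    then show ?thesis
      by (simp add: common_centres_def)
  qed
  then show "v \<in> V (insert p Q)"
    using x in_Q by (intro V_I[of _ _ x]) (auto simp: C_insert)
qed

end

section \<open>Cyclically ordered vertices\<close>

text \<open>All triples, not only successive ones, turn left. This is strictly convex position in
  counterclockwise order; it passes to sublists at once and allows rotating the list.\<close>

fun ccw_list :: "point list \<Rightarrow> bool" where
  "ccw_list [] \<longleftrightarrow> True"
| "ccw_list (x # xs) \<longleftrightarrow> sorted_wrt (\<lambda>a b. 0 < cross (a - x) (b - x)) xs \<and> ccw_list xs"

lemma ccw_list_nth:
  assumes "ccw_list xs" "i < j" "j < k" "k < length xs"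
  shows "0 < cross (xs ! j - xs ! i) (xs ! k - xs ! i)"
  using assms
proof (induction xs arbitrary: i j k)
  case Nil
  then show ?case by simp
next
  case (Cons x xs)
  obtain j' k' where jk: "j = Suc j'" "k = Suc k'"
    using Cons.prems by (cases j; cases k) auto
  show ?case
  proof (cases i)
    case 0
    have "sorted_wrt (\<lambda>a b. 0 < cross (a - x) (b - x)) xs"
      using Cons.prems by simp
    then show ?thesis
      using Cons.prems jk 0 sorted_wrt_nth_less[of _ xs j' k'] by simp
  next
    case (Suc i')
    then show ?thesis
      using Cons.prems jk Cons.IH[of i' j' k'] by simp
  qed
qed

lemma ccw_list_snoc:
  "ccw_list (xs @ [m]) \<longleftrightarrow> ccw_list xs \<and> sorted_wrt (\<lambda>a b. 0 < cross (b - a) (m - a)) xs"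
  by (induction xs) (auto simp: sorted_wrt_append)

lemma cross_cyclic: "cross (b - a) (c - a) = cross (c - b) (a - b)"
  by (simp add: cross_def algebra_simps)

lemma ccw_list_rotate1: "ccw_list (m # ws) \<Longrightarrow> ccw_list (ws @ [m])"
  by (simp add: ccw_list_snoc cross_cyclic[of _ m])

lemma ccw_list_filter: "ccw_list xs \<Longrightarrow> ccw_list (filter P xs)"
  by (induction xs) (auto intro: sorted_wrt_filter)

section \<open>Removing elements at both ends of a list\<close>

lemma sorted_wrt_filterI:
  assumes "\<And>i j. i < j \<Longrightarrow> j < length xs \<Longrightarrow> P (xs ! i) \<Longrightarrow> P (xs ! j) \<Longrightarrow> R (xs ! i) (xs ! j)"
  shows "sorted_wrt R (filter P xs)"
  using assms
proof (induction xs)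
  case Nil
  then show ?case by simp
next
  case (Cons x xs)
  have "sorted_wrt R (filter P xs)"
    using Cons.prems[of "Suc _" "Suc _"] by (intro Cons.IH) auto
  moreover have "R x y" if xy: "P x" "y \<in> set xs" "P y" for y
  proof -
    obtain j where "j < length xs" "y = xs ! j"
      using xy(2) by (metis in_set_conv_nth)
    then show ?thesis
      using Cons.prems[of 0 "Suc j"] xy by simp
  qed
  ultimately show ?case
    by auto
qed

text \<open>A removed element is passed on as left neighbour of the next, so every test uses the
  neighbours in the old hull. The last element is never tested.\<close>

fun trim :: "('a \<Rightarrow> 'a \<Rightarrow> 'a \<Rightarrow> bool) \<Rightarrow> 'a \<Rightarrow> 'a list \<Rightarrow> 'a list" where
  "trim alive u (v # w # ws) = (if alive u v w then v # w # ws else trim alive v (w # ws))"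
| "trim alive u vs = vs"

text \<open>The untested last element is harmless: if all earlier ones are removed, it is the
  survivor that the second assumption provides.\<close>

lemma trim_eq_dropWhile:
  assumes "\<And>xs u' v w ys. u # vs = xs @ u' # v # w # ys \<Longrightarrow> alive u' v w \<longleftrightarrow> P v" "\<exists>v\<in>set vs. P v"
  shows "trim alive u vs = dropWhile (\<lambda>v. \<not> P v) vs"
  using assms
proof (induction alive u vs rule: trim.induct)
  case (1 alive u v w ws)
  have "alive u v w \<longleftrightarrow> P v"
    using 1(2)[of "[]"] by simp
  moreover have "alive u' v' w' \<longleftrightarrow> P v'" if "v # w # ws = xs @ u' # v' # w' # ys" for xs u' v' w' ys
    using 1(2)[of "u # xs"] that by simp
  ultimately have "trim alive v (w # ws) = dropWhile (\<lambda>v. \<not> P v) (w # ws)" if "\<not> P v"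
    using that 1(3) by (intro 1(1)) auto
  then show ?case
    using \<open>alive u v w \<longleftrightarrow> P v\<close> by (cases "P v") simp_all
qed auto

text \<open>The second pass starts from \<open>hd D\<close>, even if the first pass removed it: it
  is the cyclic neighbour of the last element in the old hull.\<close>

definition trim_both :: "('a \<Rightarrow> 'a \<Rightarrow> 'a \<Rightarrow> bool) \<Rightarrow> 'a list \<Rightarrow> 'a list" where
  "trim_both alive D = rev (trim alive (hd D) (rev (trim alive (last D) D)))"

lemma filter_contiguous:
  assumes "\<And>i j k. i < j \<Longrightarrow> j < k \<Longrightarrow> k < length D \<Longrightarrow> P (D ! i) \<Longrightarrow> P (D ! k) \<Longrightarrow> P (D ! j)"
  shows "rev (dropWhile (\<lambda>v. \<not> P v) (rev (dropWhile (\<lambda>v. \<not> P v) D))) = filter P D"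
proof -
  define A where "A = takeWhile (\<lambda>v. \<not> P v) D"
  define E where "E = dropWhile (\<lambda>v. \<not> P v) D"
  define B where "B = rev (takeWhile (\<lambda>v. \<not> P v) (rev E))"
  define M where "M = rev (dropWhile (\<lambda>v. \<not> P v) (rev E))"
  have D: "D = A @ M @ B"
    unfolding A_def B_def M_def by (metis E_def rev_append rev_rev_ident takeWhile_dropWhile_id)
  have AB: "filter P A = []" "filter P B = []"
    unfolding A_def B_def by (auto simp: filter_empty_conv dest: set_takeWhileD)
  have "filter P M = M"
  proof (cases "M = []")
    case True
    then show ?thesis by simp
  next
    case False
    then have ne: "dropWhile (\<lambda>v. \<not> P v) (rev E) \<noteq> []"
      by (simp add: M_def)
    then have "P (last M)"
      using hd_dropWhile[OF ne] by (simp add: M_def last_rev)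
    have "E \<noteq> []"
      using ne by auto
    then have "P (hd E)"
      using hd_dropWhile[of "\<lambda>v. \<not> P v" D] by (simp add: E_def)
    moreover have "E = M @ B"
      unfolding B_def M_def by (metis rev_append rev_rev_ident takeWhile_dropWhile_id)
    ultimately have "P (hd M)"
      using False by simp
    have "P v" if v: "v \<in> set M" for v
    proof -
      obtain j where j: "j < length M" "v = M ! j"
        using v by (metis in_set_conv_nth)
      consider "j = 0" | "j = length M - 1" | "0 < j" "j < length M - 1"
        using j by linarith
      then show ?thesis
      proof cases
        case 1
        then show ?thesis
          using \<open>P (hd M)\<close> j False by (simp add: hd_conv_nth)
      next
        case 2
        then show ?thesis
          using \<open>P (last M)\<close> j False by (simp add: last_conv_nth)
      next
        case 3
        have nth: "D ! (length A + n) = M ! n" if "n < length M" for n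
          using that D by (simp add: nth_append)
        have "P (D ! (length A + j))"
        proof (rule assms[of "length A" _ "length A + (length M - 1)"])
          show "P (D ! length A)"
            using \<open>P (hd M)\<close> False nth[of 0] by (simp add: hd_conv_nth)
          show "P (D ! (length A + (length M - 1)))"
            using \<open>P (last M)\<close> False nth[of "length M - 1"] by (simp add: last_conv_nth)
        qed (use 3 D j in auto)
        then show ?thesis
          using j D by (simp add: nth_append)
      qed
    qed
    then show ?thesis
      by simp
  qed
  then have "filter P D = M"
    using AB by (simp add: D)
  then show ?thesis
    by (simp add: M_def E_def)
qed

lemma trim_both_eq_filter:
  assumes alive: "\<And>xs u v w ys. last D # D @ [hd D] = xs @ u # v # w # ys \<Longrightarrow> alive u v w \<longleftrightarrow> P v"
    and sym: "\<And>u v w. alive u v w \<longleftrightarrow> alive w v u"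
    and ex: "\<exists>v\<in>set D. P v"
    and contiguous: "\<And>i j k. i < j \<Longrightarrow> j < k \<Longrightarrow> k < length D \<Longrightarrow> P (D ! i) \<Longrightarrow> P (D ! k) \<Longrightarrow> P (D ! j)"
  shows "trim_both alive D = filter P D"
proof -
  have "trim alive (last D) D = dropWhile (\<lambda>v. \<not> P v) D"
    using alive ex by (intro trim_eq_dropWhile) (metis append.assoc append_Cons)+
  moreover have "trim alive (hd D) (rev (dropWhile (\<lambda>v. \<not> P v) D)) =
      dropWhile (\<lambda>v. \<not> P v) (rev (dropWhile (\<lambda>v. \<not> P v) D))"
  proof (rule trim_eq_dropWhile)
    fix xs u v w ys
    assume "hd D # rev (dropWhile (\<lambda>v. \<not> P v) D) = xs @ u # v # w # ys"
    then have "rev (hd D # rev (dropWhile (\<lambda>v. \<not> P v) D)) = rev (xs @ u # v # w # ys)"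
      by simp
    then have "dropWhile (\<lambda>v. \<not> P v) D @ [hd D] = rev ys @ w # v # u # rev xs"
      by simp
    then have "last D # D @ [hd D] = (last D # takeWhile (\<lambda>v. \<not> P v) D @ rev ys) @ w # v # u # rev xs"
      by (metis append.assoc append_Cons takeWhile_dropWhile_id)
    then show "alive u v w \<longleftrightarrow> P v"
      using alive sym by blast
  next
    show "\<exists>v\<in>set (rev (dropWhile (\<lambda>v. \<not> P v) D)). P v"
      using ex by (metis UnE set_append set_rev set_takeWhileD takeWhile_dropWhile_id)
  qed
  ultimately show ?thesis
    using filter_contiguous[of D P, OF contiguous] by (simp add: trim_both_def)
qed

text \<open>The six numbers are the cross products, seen from a point \<open>p\<close>, of four
  points \<open>f\<close>, \<open>a\<close>, \<open>b\<close>, \<open>l\<close> in convex position: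
  \<open>P\<close>, \<open>Q\<close>, \<open>R\<close> for successive pairs, \<open>S\<close> for
  \<open>f\<close>, \<open>l\<close>, and \<open>x\<close>, \<open>y\<close> for the pairs
  \<open>f\<close>, \<open>b\<close> and \<open>a\<close>, \<open>l\<close>. The four sums are the
  doubled areas of the triangles, and \<open>plucker\<close> is the Pluecker relation.
  Geometrically, \<open>p\<close> cannot lie beyond two opposite edges of a quadrilateral and inside
  the other two.\<close>

lemma crossing_impossible:
  fixes P Q R S x y :: real
  assumes "0 < P" "0 < R" "0 \<le> S" "Q \<le> 0"
    and "0 < P + Q - x" "0 < Q + R - y" "0 < x + R - S" "0 < P + y - S"
    and plucker: "x * y = P * R + S * Q"
  shows False
proof -
  define \<alpha> \<gamma> \<beta> q where "\<alpha> = P + Q - x" and "\<gamma> = Q + R - y" and "\<beta> = x + R - S" and "q = - Q"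
  have sub: "x = P - q - \<alpha>" "y = R - q - \<gamma>" "S = P + R - q - \<alpha> - \<beta>" "Q = - q"
    by (simp_all add: \<alpha>_def \<gamma>_def \<beta>_def q_def)
  have pos: "0 < \<alpha>" "0 < \<gamma>" "0 < \<beta>" "0 \<le> q" "\<gamma> < \<alpha> + \<beta>"
    using assms by (simp_all add: \<alpha>_def \<gamma>_def \<beta>_def q_def)
  have E: "P * \<gamma> + \<alpha> * R + q * \<beta> = \<gamma> * (\<alpha> + q)"
    using plucker unfolding sub by (simp add: algebra_simps)
  have "0 \<le> \<gamma> * S"
    using pos assms by simp
  then have 1: "\<beta> * (\<gamma> + q) \<le> R * (\<gamma> - \<alpha>)"
    using E unfolding sub by (simp add: algebra_simps)
  have "0 < \<beta> * (\<gamma> + q)"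
    using pos by simp
  then have ga: "\<alpha> < \<gamma>"
    using 1 assms(2) by (smt (verit) mult_nonneg_nonpos)
  have "0 < P * \<gamma>"
    using assms pos by simp
  then have "\<alpha> * R + q * \<beta> < \<gamma> * (\<alpha> + q)"
    using E by simp
  then have "(\<alpha> * R + q * \<beta>) * (\<gamma> - \<alpha>) < \<gamma> * (\<alpha> + q) * (\<gamma> - \<alpha>)"
    using ga by simp
  moreover have "\<alpha> * (\<beta> * (\<gamma> + q)) \<le> \<alpha> * (R * (\<gamma> - \<alpha>))"
    using 1 pos by simp
  ultimately have "\<gamma> * (\<alpha> + q) * \<beta> < \<gamma> * (\<alpha> + q) * (\<gamma> - \<alpha>)"
    by (simp add: algebra_simps)
  then have "\<beta> < \<gamma> - \<alpha>"
    using pos by (simp add: mult_less_cancel_left)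
  then show False
    using pos by simp
qed

section \<open>The position of a new point relative to the old vertices\<close>

context ball_plane begin

text \<open>The signs say that \<open>v\<close> lies in the triangle of \<open>p\<close>,
  \<open>e\<close> and \<open>g\<close>; the cross products are its barycentric coordinates.\<close>

lemma vertex_not_behind:
  assumes "v \<in> V K" "p \<in> K" "e \<in> K" "g \<in> K" "p \<noteq> v"
    and "0 < cross (v - e) (g - e)" "cross (v - e) (p - e) \<le> 0" "cross (g - v) (p - v) \<le> 0"
  shows False
proof -
  let ?T = "cross (v - e) (g - e)" and ?b = "- cross (g - v) (p - v)" and ?c = "- cross (v - e) (p - e)"
  have "(?T + ?b + ?c) *\<^sub>R v = ?T *\<^sub>R p + ?b *\<^sub>R e + ?c *\<^sub>R g"
    by (simp add: prod_eq_iff cross_def) (simp add: algebra_simps)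
  then have "p = v"
    using assms by (intro V_extreme[of v K p e g ?T ?b ?c]) auto
  then show False
    using assms by simp
qed

lemma collinear_cases:
  assumes "cross (b - a) (c - a) = 0" "a \<noteq> b"
  obtains s where "0 < s" "(1 + s) *\<^sub>R a = 1 *\<^sub>R c + s *\<^sub>R b"
    | s where "0 \<le> s" "s < 1" "((1 - s) + s) *\<^sub>R c = (1 - s) *\<^sub>R a + s *\<^sub>R b"
    | s where "0 \<le> s" "(1 + s) *\<^sub>R b = 1 *\<^sub>R c + s *\<^sub>R a"
proof -
  have "\<exists>k. c = a + k *\<^sub>R (b - a)"
  proof (cases "fst b = fst a")
    case True
    then show ?thesis
      using assms by (intro exI[of _ "(snd c - snd a) / (snd b - snd a)"]) (auto simp: prod_eq_iff cross_def)
  next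
    case False
    have "(fst c - fst a) * (snd b - snd a) = (fst b - fst a) * (snd c - snd a)"
      using assms by (simp add: cross_def)
    then show ?thesis
      using False by (intro exI[of _ "(fst c - fst a) / (fst b - fst a)"]) (simp add: prod_eq_iff)
  qed
  then obtain k where k: "c = a + k *\<^sub>R (b - a)"
    by blast
  then have kb: "k *\<^sub>R b = c + (k - 1) *\<^sub>R a"
    by (simp add: algebra_simps)
  consider "k < 0" | "0 \<le> k" "k < 1" | "1 \<le> k"
    by linarith
  then show thesis
  proof cases
    case 1
    then show thesis
      using that(1)[of "- k"] k by (simp add: algebra_simps)
  next
    case 2
    then show thesis
      using that(2)[of k] k by (simp add: algebra_simps)
  next
    case 3
    then show thesis
      using that(3)[of "k - 1"] kb by simp
  qed
qed

lemma V_extreme2: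
  assumes "v \<in> V K" "a \<in> K" "b \<in> K" "0 < \<alpha>" "0 \<le> \<beta>" "(\<alpha> + \<beta>) *\<^sub>R v = \<alpha> *\<^sub>R a + \<beta> *\<^sub>R b"
  shows "a = v"
  using V_extreme[of v K a b b \<alpha> \<beta> 0] assms by simp

lemma V_not_collinear:
  assumes "a \<in> V K" "b \<in> V K" "c \<in> V K" "a \<noteq> b" "a \<noteq> c" "b \<noteq> c"
  shows "cross (b - a) (c - a) \<noteq> 0"
proof
  have K: "a \<in> K" "b \<in> K" "c \<in> K"
    using assms V_subset by auto
  assume "cross (b - a) (c - a) = 0"
  then show False
    using assms(4)
  proof (cases rule: collinear_cases)
    case (1 s)
    then show False
      using V_extreme2[OF assms(1) K(3,2) _ _ 1(2)] assms(5) by simp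
  next
    case (2 s)
    then show False
      using V_extreme2[OF assms(3) K(1,2) _ _ 2(3)] assms(5) by simp
  next
    case (3 s)
    then show False
      using V_extreme2[OF assms(2) K(3,1) _ _ 3(2)] assms(6) by simp
  qed
qed

text \<open>A point that is no vertex does not restrict the centres, so \<open>lc a b\<close> would
  stay admissible and \<open>p\<close> would have distance less than \<open>r\<close> from it.
  Conversely, a point strictly inside that disc and beyond the chord is strictly inside all
  admissible discs. Points on the line through \<open>a\<close> and \<open>b\<close> escape the
  strict form of \<open>cap_lemma\<close> and are treated by extremality.\<close>

lemma new_vertex_iff:
  assumes Q: "finite Q" "p \<notin> Q" "C (insert p Q) \<noteq> {}" and ab: "a \<in> Q" "b \<in> Q" "a \<noteq> b"
    and c: "lc a b \<in> C Q" and right: "cross (b - a) (p - a) \<le> 0"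
  shows "p \<in> V (insert p Q) \<longleftrightarrow> r \<le> N (p - lc a b)"
proof (rule iffI)
  assume ge: "r \<le> N (p - lc a b)"
  show "p \<in> V (insert p Q)"
  proof (rule ccontr)
    assume nv: "p \<notin> V (insert p Q)"
    then have "C (insert p Q - {p}) = C (insert p Q)"
      using Q(3) by (intro C_remove_non_vertices) auto
    then have in_C: "lc a b \<in> C (insert p Q)"
      using c Q(2) by simp
    then have "N (p - lc a b) = r"
      using C_D[OF in_C, of p] ge by simp
    then show False
      using nv V_I[OF _ in_C] by blast
  qed
next
  let ?L = "lc a b"
  assume pV: "p \<in> V (insert p Q)"
  note l = left_centre[OF ab(3) C_dist[OF c ab(1,2)]]
  obtain y where y: "y \<in> C (insert p Q)" "N (p - y) = r"
    using pV V_D by blast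
  show "r \<le> N (p - ?L)"
  proof (rule ccontr)
    assume "\<not> ?thesis"
    then have less: "N (p - ?L) < r"
      by simp
    have shift: "(\<alpha> + \<beta>) *\<^sub>R (u - ?L) = \<alpha> *\<^sub>R (v - ?L) + \<beta> *\<^sub>R (w - ?L)"
      if "(\<alpha> + \<beta>) *\<^sub>R u = \<alpha> *\<^sub>R v + \<beta> *\<^sub>R w" for u v w \<alpha> \<beta>
      using that by (simp add: algebra_simps)
    show False
    proof (cases "cross (b - a) (p - a) = 0")
      case False
      then have "N (p - y) < r"
        using cap_lemma(2)[of a ?L b p y] l right less C_D[OF y(1)] ab by auto
      then show False
        using y by simp
    next
      case True
      then show False
        using ab(3)
      proof (cases rule: collinear_cases)
        case (1 s)
        then have "N (a - ?L) < r"
          by (intro N_comb2_less[OF shift[OF 1(2)]]) (use less l ab in auto)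
        then show False
          using l by simp
      next
        case (2 s)
        then show False
          using V_extreme2[OF pV _ _ _ _ 2(3)] ab Q(2) by auto
      next
        case (3 s)
        have "s \<noteq> 0"
          using 3(2) ab Q(2) by auto
        then have "N (b - ?L) < r"
          by (intro N_comb2_less[OF shift[OF 3(2)]]) (use less l ab 3 in auto)
        then show False
          using l by simp
      qed
    qed
  qed
qed

text \<open>The new point lies beyond the closing edge from \<open>last D\<close> to
  \<open>hd D\<close>. If two survivors had the wrong order around it, it would also lie on or
  beyond their chord. When the chord shares an end with the closing edge, this puts a vertex into a
  triangle or on a line with others; when it does not, \<open>crossing_impossible\<close>
  applies.\<close>

lemma survivors_around_new:
  assumes D: "ccw_list D" "set D \<subseteq> Q" and p: "p \<in> V (insert p Q)" "p \<notin> Q"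
    and right: "cross (hd D - last D) (p - last D) \<le> 0"
    and ij: "i < j" "j < length D" "D ! i \<in> V (insert p Q)" "D ! j \<in> V (insert p Q)" "D ! i \<noteq> D ! j"
  shows "0 < cross (D ! i - p) (D ! j - p)"
proof (rule ccontr)
  define f l a b where "f = hd D" and "l = last D" and "a = D ! i" and "b = D ! j"
  let ?n = "length D - 1"
  have "D \<noteq> []"
    using ij by auto
  then have fl: "f = D ! 0" "l = D ! ?n"
    by (auto simp: f_def l_def hd_conv_nth last_conv_nth)
  have ab: "a \<in> V (insert p Q)" "b \<in> V (insert p Q)"
    using ij by (simp_all add: a_def b_def)
  have mem: "D ! k \<in> insert p Q" "p \<noteq> D ! k" if "k < length D" for k
    using D p nth_mem[OF that] by auto
  have mem4: "f \<in> insert p Q" "l \<in> insert p Q" "a \<in> insert p Q" "b \<in> insert p Q"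
    and pa: "p \<noteq> a" "p \<noteq> b"
    using \<open>D \<noteq> []\<close> mem(1)[of 0] mem(1)[of ?n] mem[of i] mem[of j] ij unfolding fl a_def b_def by auto
  have lf: "cross (f - l) (p - l) \<le> 0"
    using right by (simp add: f_def l_def)
  assume "\<not> ?thesis"
  then have "cross (a - p) (b - p) \<le> 0"
    by (simp add: a_def b_def)
  then have pab: "cross (b - a) (p - a) \<le> 0"
    by (simp add: cross_cyclic[of a p])
  note ccw = ccw_list_nth[OF D(1)]
  note behind = vertex_not_behind
  consider "i = 0" "j = ?n" | "i = 0" "j \<noteq> ?n" | "i \<noteq> 0" "j = ?n" | "i \<noteq> 0" "j \<noteq> ?n"
    by blast
  then show False
  proof cases
    case 1
    then have "f = a" "l = b"
      by (simp_all add: fl a_def b_def)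
    then have "cross (b - a) (p - a) = 0"
      using pab lf by (simp add: cross_def algebra_simps)
    then show False
      using V_not_collinear[OF ab p(1)] ij pa by (auto simp: a_def b_def)
  next
    case 2
    then have fa: "f = a"
      by (simp add: fl a_def)
    have "0 < cross (b - a) (l - a)"
      using ccw[of i j ?n] ij 2 by (simp add: a_def b_def fl)
    then have "0 < cross (a - l) (b - l)"
      by (simp add: cross_cyclic[of a l b])
    then show False
      using behind[OF ab(1) _ mem4(2,4) pa(1)] lf pab fa by simp
  next
    case 3
    then have lb: "l = b"
      by (simp add: fl b_def)
    have "0 < cross (a - f) (b - f)"
      using ccw[of 0 i j] ij 3 by (simp add: a_def b_def fl)
    then have "0 < cross (b - a) (f - a)"
      by (simp add: cross_cyclic[of a f])
    then show False
      using behind[OF ab(2) _ mem4(3,1) pa(2)] lf pab lb by simp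
  next
    case 4
    then have n: "0 < i" "j < ?n"
      using ij by auto
    have t: "0 < cross (a - f) (b - f)" "0 < cross (b - a) (l - a)" "0 < cross (b - f) (l - f)" "0 < cross (a - f) (l - f)"
      using ccw[of 0 i j] ccw[of i j ?n] ccw[of 0 j ?n] ccw[of 0 i ?n] n ij by (simp_all add: a_def b_def fl)
    \<comment> \<open>Were \<open>p\<close> not to the left of the line from \<open>f\<close> to
      \<open>a\<close>, the vertex \<open>a\<close> would lie in the triangle of \<open>p\<close>,
      \<open>f\<close> and \<open>b\<close>. The next fact is the mirror image.\<close>
    have 1: "0 < cross (a - f) (p - f)"
      using behind[OF ab(1) _ mem4(1,4) pa(1) t(1)] pab by force
    have 2: "0 < cross (l - b) (p - b)"
      using behind[OF ab(2) _ mem4(3,2) pa(2) t(2)] pab by force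
    show False
    proof (rule crossing_impossible)
      show "0 < cross (f - p) (a - p)" "0 < cross (b - p) (l - p)" "0 \<le> cross (f - p) (l - p)"
        "cross (a - p) (b - p) \<le> 0"
        using 1 2 lf pab by (simp_all add: cross_def algebra_simps)
      show "0 < cross (f - p) (a - p) + cross (a - p) (b - p) - cross (f - p) (b - p)"
        "0 < cross (a - p) (b - p) + cross (b - p) (l - p) - cross (a - p) (l - p)"
        "0 < cross (f - p) (b - p) + cross (b - p) (l - p) - cross (f - p) (l - p)"
        "0 < cross (f - p) (a - p) + cross (a - p) (l - p) - cross (f - p) (l - p)"
        using t by (simp_all add: cross_def algebra_simps)
      show "cross (f - p) (b - p) * cross (a - p) (l - p) =
          cross (f - p) (a - p) * cross (b - p) (l - p) + cross (f - p) (l - p) * cross (a - p) (b - p)"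
        by (simp add: cross_def algebra_simps)
    qed
  qed
qed

text \<open>A removed vertex between two survivors lies beyond the chord of two vertices that are
  successive in the new hull. As an old vertex it must lie on the circle over this chord, whose
  centre is admissible for the new set, so it survives after all.\<close>

lemma survivors_contiguous:
  assumes D: "ccw_list D" "distinct D" "set D = V Q" "finite Q" and p: "p \<in> V (insert p Q)" "p \<notin> Q"
    and right: "cross (hd D - last D) (p - last D) \<le> 0"
    and ijk: "i < j" "j < k" "k < length D" "D ! i \<in> V (insert p Q)" "D ! k \<in> V (insert p Q)"
  shows "D ! j \<in> V (insert p Q)"
proof (rule ccontr)
  let ?S = "V (insert p Q)"
  assume dead: "D ! j \<notin> ?S"
  \<comment> \<open>The nearest survivors on both sides. They are successive in the new hull because
    \<open>p\<close> and all other survivors lie to the left of their chord.\<close>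
  define i' where "i' = Max {e. e < j \<and> D ! e \<in> ?S}"
  define k' where "k' = Min {e. j < e \<and> e < length D \<and> D ! e \<in> ?S}"
  have "{e. e < j \<and> D ! e \<in> ?S} \<noteq> {}" "{e. j < e \<and> e < length D \<and> D ! e \<in> ?S} \<noteq> {}"
    using ijk by auto
  then have i': "i' < j" "D ! i' \<in> ?S" and k': "j < k'" "k' < length D" "D ! k' \<in> ?S"
    using Max_in[of "{e. e < j \<and> D ! e \<in> ?S}"] Min_in[of "{e. j < e \<and> e < length D \<and> D ! e \<in> ?S}"]
    by (auto simp: i'_def k'_def)
  have i'_max: "e \<le> i'" if "e < j" "D ! e \<in> ?S" for e
    unfolding i'_def using that by (intro Max_ge) auto
  have k'_min: "k' \<le> e" if "j < e" "e < length D" "D ! e \<in> ?S" for e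
    unfolding k'_def using that by (intro Min_le) auto
  define u w where "u = D ! i'" and "w = D ! k'"
  have uw: "u \<in> ?S" "w \<in> ?S" "u \<noteq> w"
    using i' k' D(2) by (auto simp: u_def w_def nth_eq_iff_index_eq)
  have sub: "set D \<subseteq> Q"
    using D V_subset by auto
  note ccw = ccw_list_nth[OF D(1)]
  have "lc u w \<in> C (insert p Q)"
  proof (rule consecutive_centre)
    show "finite (insert p Q)"
      using D by simp
    fix v assume v: "v \<in> ?S" "v \<noteq> u" "v \<noteq> w"
    show "0 < cross (w - u) (v - u)"
    proof (cases "v = p")
      case True
      have "0 < cross (u - p) (w - p)"
        using survivors_around_new[OF D(1) sub p right, of i' k'] i' k' uw by (auto simp: u_def w_def)
      then show ?thesis
        using True by (simp add: cross_cyclic[of u p w])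
    next
      case False
      then have "v \<in> V Q"
        using v V_antimono[of v "insert p Q" Q] V_subset[of "insert p Q"] by blast
      then obtain e where e: "e < length D" "v = D ! e"
        using D by (metis in_set_conv_nth)
      have "e \<noteq> i'" "e \<noteq> k'" "e \<noteq> j"
        using e v dead by (auto simp: u_def w_def)
      then consider "e < i'" | "k' < e"
        using i'_max[of e] k'_min[of e] e v by (metis linorder_neqE_nat leD le_neq_implies_less)
      then show ?thesis
      proof cases
        case 1
        then have "0 < cross (u - v) (w - v)"
          using ccw[of e i' k'] i' k' e by (simp add: u_def w_def)
        then show ?thesis
          by (simp add: cross_cyclic[of u v w])
      next
        case 2
        then show ?thesis
          using ccw[of i' k' e] i' k' e by (simp add: u_def w_def)
      qed
    qed
  qed (use uw in auto)
  note L = this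
  have in_Q: "u \<in> Q" "w \<in> Q" "D ! j \<in> Q"
    using sub nth_mem[of _ D] i' k' by (auto simp: u_def w_def)
  note l = left_centre[OF uw(3) C_dist[OF L insertI2[OF in_Q(1)] insertI2[OF in_Q(2)]]]
  have "0 < cross (D ! j - u) (w - u)"
    using ccw[of i' j k'] i' k' by (simp add: u_def w_def)
  then have right_j: "cross (w - u) (D ! j - u) < 0"
    using cross_commute[of "w - u" "D ! j - u"] by simp
  have "D ! j \<in> V Q"
    using D i' k' by (metis nth_mem less_trans)
  then obtain y where y: "y \<in> C Q" "N (D ! j - y) = r"
    using V_D by blast
  have "N (D ! j - lc u w) = r"
  proof (rule ccontr)
    assume "N (D ! j - lc u w) \<noteq> r"
    then have "N (D ! j - lc u w) < r"
      using C_D[OF L, of "D ! j"] in_Q by simp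
    then have "N (D ! j - y) < r"
      using cap_lemma(2)[of u "lc u w" w "D ! j" y] l uw right_j C_D[OF y(1)] in_Q by auto
    then show False
      using y by simp
  qed
  then show False
    using dead V_I[OF _ L] in_Q by blast
qed

end

section \<open>Inserting a point into a ball hull\<close>

text \<open>The list starts at the lexicographic maximum: the next insertion happens there, and from
  there the order along the list has a single valley.\<close>

definition hull_list :: "(point \<Rightarrow> real) \<Rightarrow> real \<Rightarrow> point set \<Rightarrow> point list \<Rightarrow> bool" where
  "hull_list N r K vs \<longleftrightarrow> vs \<noteq> [] \<and> distinct vs \<and> ccw_list vs \<and> set vs = ball_vertices N r K \<and>
     (\<forall>v\<in>set (tl vs). lex_less v (hd vs))"

text \<open>The test decides whether \<open>v\<close> remains a vertex when \<open>p\<close> is added to a hull where \<open>v\<close> has the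
  neighbours \<open>u\<close> and \<open>w\<close>.\<close>

definition survives :: "(point \<Rightarrow> real) \<Rightarrow> real \<Rightarrow> point \<Rightarrow> point \<Rightarrow> point \<Rightarrow> point \<Rightarrow> bool" where
  "survives N r p u v w \<longleftrightarrow> v \<in> ball_vertices N r (insert v {u, w, p})"

text \<open>The two edges at \<open>m\<close> lead to \<open>hd ws\<close> and come from
  \<open>last ws\<close>. In either case the list handed to \<open>trim_both\<close> is rotated so
  that the edge seen by \<open>p\<close> is the closing one; \<open>p\<close> fills this gap and, as
  the new maximum, becomes the head.\<close>

definition insert_point :: "(point \<Rightarrow> real) \<Rightarrow> real \<Rightarrow> point \<Rightarrow> point list \<Rightarrow> point list" where
  "insert_point N r p vs =
    (let m = hd vs; ws = tl vs in
     if ws = [] then [p, m]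
     else if cross (hd ws - m) (p - m) < 0 then
       (if N (p - left_centre N r m (hd ws)) < r then vs
        else p # trim_both (survives N r p) (ws @ [m]))
     else
       (if N (p - left_centre N r (last ws) m) < r then vs
        else p # trim_both (survives N r p) (m # ws)))"

lemma survives_commute: "survives N r p u v w \<longleftrightarrow> survives N r p w v u"
  by (simp add: survives_def insert_commute)

lemma lex_less_irrefl: "\<not> lex_less p p"
  by (simp add: lex_less_def)

lemma lex_less_trans: "lex_less p q \<Longrightarrow> lex_less q s \<Longrightarrow> lex_less p s"
  by (auto simp: lex_less_def)

lemma lex_less_asym: "lex_less p q \<Longrightarrow> \<not> lex_less q p"
  by (auto simp: lex_less_def)

lemma lex_less_total: "p = q \<or> lex_less p q \<or> lex_less q p"
  by (auto simp: lex_less_def prod_eq_iff)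

lemma lex_less_diff: "lex_less p q \<longleftrightarrow> lex_less 0 (q - p)"
  by (auto simp: lex_less_def)

text \<open>Lexicographically positive vectors form a convex cone without the origin. Order
  arguments thus reduce to explicit linear relations with coefficients of known sign.\<close>

lemma lex_positive_combination:
  assumes "lex_less 0 u" "lex_less 0 v" "lex_less 0 w" "0 < \<alpha>" "0 \<le> \<beta>" "0 \<le> \<gamma>"
  shows "\<alpha> *\<^sub>R u + \<beta> *\<^sub>R v + \<gamma> *\<^sub>R w \<noteq> 0"
proof -
  have scale: "lex_less 0 (s *\<^sub>R x)" if "lex_less 0 x" "0 < s" for s x
    using that by (auto simp: lex_less_def)
  have "lex_less 0 (\<alpha> *\<^sub>R u)" "\<beta> = 0 \<or> lex_less 0 (\<beta> *\<^sub>R v)" "\<gamma> = 0 \<or> lex_less 0 (\<gamma> *\<^sub>R w)"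
    using scale[OF assms(1,4)] scale[OF assms(2), of \<beta>] scale[OF assms(3), of \<gamma>] assms(5,6) by argo+
  then show ?thesis
    by (auto simp: lex_less_def prod_eq_iff)
qed

text \<open>This is why one of the two edges at \<open>m\<close> is visible from \<open>p\<close>.
  If neither were, the linear relation between \<open>m - b\<close>, \<open>m - a\<close> and
  \<open>p - m\<close> would have nonnegative coefficients, although all three vectors are
  lexicographically positive.\<close>

lemma lex_less_not_beyond:
  assumes "lex_less m p" "lex_less b m" "lex_less a m" "0 < cross (b - m) (a - m)" "0 \<le> cross (b - m) (p - m)"
  shows "cross (m - a) (p - a) \<le> 0"
proof (rule ccontr)
  assume "\<not> ?thesis"
  then have pos: "0 < cross (p - m) (a - m)"
    by (simp add: cross_def algebra_simps)
  have "cross (p - m) (a - m) *\<^sub>R (m - b) + cross (b - m) (p - m) *\<^sub>R (m - a) + cross (b - m) (a - m) *\<^sub>R (p - m) = 0"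
    by (simp add: prod_eq_iff cross_def algebra_simps)
  then show False
    using lex_positive_combination[of "m - b" "m - a" "p - m"] pos assms by (simp flip: lex_less_diff)
qed

text \<open>Appending the head turns the closing edge into an ordinary pair of neighbours.\<close>

lemma ccw_list_cyclic:
  assumes D: "ccw_list D" "distinct D" "2 \<le> length D"
    and uv: "D @ [hd D] = xs @ u # v # ys"
  shows "u \<noteq> v" "u \<in> set D" "v \<in> set D"
    and "x \<in> set D \<Longrightarrow> x \<noteq> u \<Longrightarrow> x \<noteq> v \<Longrightarrow> 0 < cross (v - u) (x - u)"
proof -
  let ?n = "length D" and ?i = "length xs"
  have hd: "hd D = D ! 0"
    using D(3) by (auto intro: hd_conv_nth)
  have len: "Suc ?i \<le> ?n"
    using arg_cong[OF uv, of length] by simp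
  have u: "u = D ! ?i"
    using arg_cong[OF uv, of "\<lambda>zs. zs ! ?i"] len by (simp add: nth_append)
  have v: "v = (D @ [hd D]) ! Suc ?i"
    using uv by (simp add: nth_append)
  define j where "j = (if Suc ?i < ?n then Suc ?i else 0)"
  have j: "j < ?n" "j \<noteq> ?i"
    using D(3) len by (auto simp: j_def)
  have v': "v = D ! j"
    using v len hd by (auto simp: j_def nth_append)
  show "u \<noteq> v"
    using u v' j len D(2) by (simp add: nth_eq_iff_index_eq)
  show "u \<in> set D" "v \<in> set D"
    using nth_mem[of ?i D] nth_mem[of j D] j(1) len unfolding u v' by simp_all
  show "0 < cross (v - u) (x - u)" if x: "x \<in> set D" "x \<noteq> u" "x \<noteq> v"
  proof -
    from x(1) obtain e where e: "e < ?n" "x = D ! e"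
      by (metis in_set_conv_nth)
    have ne: "e \<noteq> ?i" "e \<noteq> j"
      using e x u v' by auto
    note ccw = ccw_list_nth[OF D(1)]
    show "0 < cross (v - u) (x - u)"
    proof (cases "Suc ?i < ?n")
      case True
      then have jj: "j = Suc ?i"
        by (simp add: j_def)
      show ?thesis
      proof (cases "e < ?i")
        case True
        then have "0 < cross (u - x) (v - x)"
          using ccw[of e ?i j] e j u v' jj by simp
        then show ?thesis
          by (simp add: cross_cyclic[of u x v])
      next
        case False
        then show ?thesis
          using ccw[of ?i j e] e ne u v' jj by simp
      qed
    next
      case False
      then have jj: "j = 0" "?i = ?n - 1"
        using len by (auto simp: j_def)
      then have "0 < cross (x - v) (u - v)"
        using ccw[of 0 e ?i] e ne u v' by simp
      then show ?thesis
        by (simp add: cross_cyclic[of x v u] cross_cyclic[of u x v])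
    qed
  qed
qed

context ball_plane begin

lemma cyclic_centres:
  assumes D: "ccw_list D" "distinct D" "set D = V Q" "finite Q" "2 \<le> length D"
    and uv: "D @ [hd D] = xs @ u # v # ys"
  shows "lc u v \<in> C Q" "u \<noteq> v"
proof -
  note cyc = ccw_list_cyclic[OF D(1,2,5) uv]
  show "u \<noteq> v"
    by (rule cyc)
  show "lc u v \<in> C Q"
    using cyc D(3) by (intro consecutive_centre[OF D(4)]) simp_all
qed

lemma trim_new_point:
  assumes D: "ccw_list D" "distinct D" "set D = V Q" "finite Q" "2 \<le> length D"
    and p: "p \<in> V (insert p Q)" "p \<notin> Q"
    and right: "cross (hd D - last D) (p - last D) \<le> 0"
  defines "F \<equiv> filter (\<lambda>v. v \<in> V (insert p Q)) D"
  shows "trim_both (survives N r p) D = F" and "ccw_list (p # F)" "distinct (p # F)" "set (p # F) = V (insert p Q)"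
proof -
  let ?S = "V (insert p Q)"
  have Dne: "D \<noteq> []"
    using D(5) by auto
  have sub: "set D \<subseteq> Q"
    using D V_subset by auto
  have alive: "survives N r p u v w \<longleftrightarrow> v \<in> ?S" if eq: "last D # D @ [hd D] = xs @ u # v # w # ys" for xs u v w ys
  proof -
    have "\<exists>xs ys. D @ [hd D] = xs @ u # v # ys" "\<exists>xs ys. D @ [hd D] = xs @ v # w # ys"
    proof -
      have "D @ [hd D] = butlast D @ u # v # []" if "xs = []"
        using eq Dne that by (cases D) auto
      moreover have "D @ [hd D] = tl xs @ u # v # w # ys" if "xs \<noteq> []"
        using eq that by (cases xs) auto
      ultimately show "\<exists>xs ys. D @ [hd D] = xs @ u # v # ys"
        by blast
      have "D @ [hd D] = tl (xs @ [u]) @ v # w # ys"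
        using eq by (cases xs) auto
      then show "\<exists>xs ys. D @ [hd D] = xs @ v # w # ys"
        by blast
    qed
    then have uv: "lc u v \<in> C Q" "u \<noteq> v" and vw: "lc v w \<in> C Q" "v \<noteq> w"
      using cyclic_centres[OF D] by blast+
    have "set (last D # D @ [hd D]) = set D"
      using Dne by auto
    then have "u \<in> V Q" "v \<in> V Q" "w \<in> V Q"
      unfolding eq D(3)[symmetric] by auto
    then show ?thesis
      using V_insert_iff_local uv vw by (simp add: survives_def)
  qed
  have "Q \<noteq> {}"
    using sub Dne by auto
  then have "insert p Q \<noteq> {p}"
    using p(2) by blast
  \<comment> \<open>The new vertex has a successor, which can only be an old vertex: this is the
    survivor at which trimming stops.\<close>
  then obtain w where "w \<in> ?S - {p}"
    using successor_vertex[of "insert p Q" p] D(4) p(1) by blast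
  moreover have S_sub: "?S \<subseteq> insert p (V Q)"
    using V_antimono[of _ "insert p Q" Q] V_subset[of "insert p Q"] by blast
  ultimately have ex: "\<exists>v\<in>set D. v \<in> ?S"
    using D(3) by blast
  note contiguous = survivors_contiguous[OF D(1-4) p right]
  show "trim_both (survives N r p) D = F"
    unfolding F_def
    by (rule trim_both_eq_filter[OF alive survives_commute ex contiguous])
  have "sorted_wrt (\<lambda>a b. 0 < cross (a - p) (b - p)) F"
    unfolding F_def
  proof (rule sorted_wrt_filterI)
    fix i j assume "i < j" "j < length D" "D ! i \<in> ?S" "D ! j \<in> ?S"
    then show "0 < cross (D ! i - p) (D ! j - p)"
      using survivors_around_new[OF D(1) sub p right] D(2) by (simp add: nth_eq_iff_index_eq)
  qed
  then show "ccw_list (p # F)"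
    using ccw_list_filter[OF D(1)] by (simp add: F_def)
  show "distinct (p # F)"
    using D(2) sub p by (auto simp: F_def)
  show "set (p # F) = ?S"
    using S_sub p D(3) by (auto simp: F_def)
qed

lemma insert_point_hull_list:
  assumes h: "hull_list N r Q vs" and Q: "finite Q" "C (insert p Q) \<noteq> {}"
    and lex: "\<And>q. q \<in> Q \<Longrightarrow> lex_less q p"
  shows "hull_list N r (insert p Q) (insert_point N r p vs)"
proof -
  obtain m ws where vs: "vs = m # ws"
    using h by (cases vs) (auto simp: hull_list_def)
  have m: "distinct (m # ws)" "ccw_list (m # ws)" "set (m # ws) = V Q" "\<And>v. v \<in> set ws \<Longrightarrow> lex_less v m"
    using h vs by (auto simp: hull_list_def)
  have pQ: "p \<notin> Q"
    using lex lex_less_irrefl by blast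
  have CQ: "C Q \<noteq> {}"
    using Q(2) C_antimono[of Q "insert p Q"] by blast
  have sub: "set (m # ws) \<subseteq> Q"
    using m V_subset by auto
  have hull: "hull_list N r (insert p Q) (p # F)"
    if "ccw_list (p # F)" "distinct (p # F)" "set (p # F) = V (insert p Q)" for F
  proof -
    have "set F \<subseteq> Q"
      using that V_subset[of "insert p Q"] by auto
    then show ?thesis
      using that lex by (auto simp: hull_list_def)
  qed
  \<comment> \<open>A point that is no vertex leaves the admissible centres unchanged, and with them
    the list.\<close>
  have dropped: "hull_list N r (insert p Q) vs" if "p \<notin> V (insert p Q)"
  proof -
    have "C (insert p Q - {p}) = C (insert p Q)"
      using that Q(2) by (intro C_remove_non_vertices) auto
    then have "C (insert p Q) = C Q"
      using pQ by simp
    then have "V (insert p Q) = V Q"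
      using that unfolding ball_vertices_def by auto
    then show ?thesis
      using h by (simp add: hull_list_def)
  qed
  show ?thesis
  proof (cases "ws = []")
    case True
    have mQ: "m \<in> Q" "p \<noteq> m" and Vm: "V Q = {m}"
      using m True pQ sub by auto
    obtain x where x: "x \<in> C (insert p Q)"
      using Q(2) by blast
    have d: "N (m - p) \<le> 2 * r"
      using C_dist[OF x] mQ by auto
    note l = left_centre[OF mQ(2) d]
    have "C Q = C {m}"
      using C_V[OF CQ Q(1)] Vm by simp
    then have "lc p m \<in> C (insert p Q)"
      using l by (simp add: C_insert) (simp add: common_centres_def)
    then have "p \<in> V (insert p Q)" "m \<in> V (insert p Q)"
      using l mQ by (auto intro: V_I)
    moreover have "V (insert p Q) \<subseteq> insert p (V Q)"
      using V_antimono[of _ "insert p Q" Q] V_subset[of "insert p Q"] by blast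
    ultimately have "V (insert p Q) = {p, m}"
      using Vm by auto
    then show ?thesis
      using True mQ hull[of "[m]"] by (simp add: insert_point_def vs)
  next
    case False
    define b a where "b = hd ws" and "a = last ws"
    have ab: "a \<in> set ws" "b \<in> set ws"
      using False by (simp_all add: a_def b_def)
    have in_Q: "m \<in> Q" "b \<in> Q" "a \<in> Q" "m \<noteq> b" "a \<noteq> m"
      using ab sub m by auto
    have len: "2 \<le> length (m # ws)"
      using False by (cases ws) auto
    show ?thesis
    proof (cases "cross (b - m) (p - m) < 0")
      case True
      have "(m # ws) @ [hd (m # ws)] = [] @ m # b # (tl ws @ [m])"
        using False by (cases ws) (auto simp: b_def)
      then have c: "lc m b \<in> C Q"
        by (rule cyclic_centres[OF m(2,1,3) Q(1) len])
      have iff: "p \<in> V (insert p Q) \<longleftrightarrow> r \<le> N (p - lc m b)"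
        using new_vertex_iff[OF Q(1) pQ Q(2) in_Q(1,2,4) c] True by simp
      have D: "ccw_list (ws @ [m])" "distinct (ws @ [m])" "set (ws @ [m]) = V Q" "2 \<le> length (ws @ [m])"
        using m ccw_list_rotate1 len by auto
      have right: "cross (hd (ws @ [m]) - last (ws @ [m])) (p - last (ws @ [m])) \<le> 0"
        using True False by (simp add: b_def)
      show ?thesis
      proof (cases "N (p - lc m b) < r")
        case less: True
        then show ?thesis
          using dropped iff True False by (simp add: insert_point_def vs b_def)
      next
        case nless: False
        then have "p \<in> V (insert p Q)"
          using iff by simp
        note t = trim_new_point[OF D(1-3) Q(1) D(4) this pQ right]
        show ?thesis
          using t(1) hull[OF t(2-4)] True False nless by (simp add: insert_point_def vs b_def)
      qed
    next
      case left: False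
      have eq: "(m # ws) @ [hd (m # ws)] = (m # butlast ws) @ a # m # []"
        using False by (simp add: a_def)
      note c = cyclic_centres(1)[OF m(2,1,3) Q(1) len eq]
      have lexs: "lex_less m p" "lex_less b m" "lex_less a m"
        using lex in_Q m ab by auto
      have right: "cross (m - a) (p - a) \<le> 0"
      \<comment> \<open>With two vertices both edges at \<open>m\<close> run along the same chord in
        opposite directions, and there is no proper turn for
        \<open>lex_less_not_beyond\<close>.\<close>
      proof (cases "length ws = 1")
        case True
        then have "a = b"
          by (cases ws) (auto simp: a_def b_def)
        then show ?thesis
          using left by (simp add: cross_def algebra_simps)
      next
        case nsingle: False
        have "ws ! 0 = b" "ws ! (length ws - 1) = a"
          using False by (simp_all add: a_def b_def hd_conv_nth last_conv_nth)
        moreover have "sorted_wrt (\<lambda>a b. 0 < cross (a - m) (b - m)) ws"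
          using m by simp
        moreover have "0 < length ws - 1"
          using nsingle False by (cases ws) auto
        ultimately have "0 < cross (b - m) (a - m)"
          using sorted_wrt_nth_less[of "\<lambda>a b. 0 < cross (a - m) (b - m)" ws 0 "length ws - 1"] by auto
        then show ?thesis
          using lex_less_not_beyond[OF lexs] left by simp
      qed
      have iff: "p \<in> V (insert p Q) \<longleftrightarrow> r \<le> N (p - lc a m)"
        by (rule new_vertex_iff[OF Q(1) pQ Q(2) in_Q(3,1,5) c right])
      have right': "cross (hd (m # ws) - last (m # ws)) (p - last (m # ws)) \<le> 0"
        using right False by (simp add: a_def)
      show ?thesis
      proof (cases "N (p - lc a m) < r")
        case less: True
        then show ?thesis
          using dropped iff left False by (simp add: insert_point_def vs a_def b_def)
      next
        case nless: False
        then have "p \<in> V (insert p Q)"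
          using iff by simp
        note t = trim_new_point[OF m(2,1,3) Q(1) len this pQ right']
        show ?thesis
          using t(1) hull[OF t(2-4)] left False nless by (simp add: insert_point_def vs a_def b_def)
      qed
    qed
  qed
qed

end

section \<open>The boundary of a ball hull and the circumradius\<close>

lemma ball_hull_eq: "ball_hull N K r = {z. \<forall>x\<in>common_centres N r K. N (z - x) \<le> r}"
proof -
  have "K \<subseteq> disc N x r \<longleftrightarrow> x \<in> common_centres N r K" for x
    by (simp add: disc_def common_centres_def subset_eq)
  then have "ball_hull N K r = (\<Inter>x\<in>common_centres N r K. disc N x r)"
    by (simp only: ball_hull_def Setcompr_eq_image Collect_mem_eq)
  then show ?thesis
    by (simp add: disc_def set_eq_iff)
qed

context strictly_convex_plane begin

lemma N_pos: "p \<noteq> 0 \<Longrightarrow> 0 < N p"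
  by (metis N_eq_0 N_nonneg order_le_less)

lemma N_lower_bound: "\<exists>c>0. \<forall>x. c * norm x \<le> N x"
proof -
  have "compact (sphere (0 :: point) 1)" "sphere (0 :: point) 1 \<noteq> {}"
    by simp_all
  then obtain u where u: "u \<in> sphere 0 1" "\<And>v. v \<in> sphere 0 1 \<Longrightarrow> N u \<le> N v"
    using continuous_attains_inf[OF _ _ continuous_on_N] by metis
  have "0 < N u"
    using u(1) by (intro N_pos) auto
  moreover have "N u * norm x \<le> N x" for x
  proof (cases "x = 0")
    case True
    then show ?thesis
      using N_nonneg by simp
  next
    case False
    have "N u \<le> N ((1 / norm x) *\<^sub>R x)"
      using False by (intro u(2)) simp
    also have "\<dots> = N x / norm x"
      by (simp add: N_scale)
    finally show ?thesis
      using False by (simp add: field_simps)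
  qed
  ultimately show ?thesis
    by blast
qed

lemma compact_common_centres:
  assumes "K \<noteq> {}"
  shows "compact (common_centres N \<rho> K)"
proof -
  obtain k where k: "k \<in> K"
    using assms by blast
  obtain c where c: "0 < c" "\<And>x. c * norm x \<le> N x"
    using N_lower_bound by blast
  have "common_centres N \<rho> K \<subseteq> cball k (\<rho> / c)"
  proof
    fix x assume "x \<in> common_centres N \<rho> K"
    then have "c * norm (k - x) \<le> \<rho>"
      using k c(2)[of "k - x"] by (force simp: common_centres_def)
    then show "x \<in> cball k (\<rho> / c)"
      using c(1) by (simp add: dist_norm field_simps)
  qed
  then have "bounded (common_centres N \<rho> K)"
    using bounded_cball bounded_subset by blast
  moreover have "common_centres N \<rho> K = (\<Inter>k\<in>K. {x. N (k - x) \<le> \<rho>})"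
    by (auto simp: common_centres_def)
  then have "closed (common_centres N \<rho> K)"
    by (auto intro!: closed_INT closed_Collect_le continuous_intros)
  ultimately show ?thesis
    by (simp add: compact_eq_bounded_closed)
qed

text \<open>A \<open>LEAST\<close> over the reals says something only if the minimum is attained.
  The centre sets for the radii \<open>R + 1 / Suc n\<close> above the infimum \<open>R\<close> are
  compact, nonempty and nested; a common point is a centre for \<open>R\<close> itself.\<close>

lemma circumradius_le_imp_centre:
  assumes "finite K" "circumradius N K \<le> r"
  shows "common_centres N r K \<noteq> {}"
proof (cases "K = {}")
  case True
  then show ?thesis
    by (simp add: common_centres_def)
next
  case False
  have disc: "K \<subseteq> disc N x \<rho> \<longleftrightarrow> x \<in> common_centres N \<rho> K" for x \<rho>
    by (auto simp: disc_def common_centres_def)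
  define S where "S = {\<rho>. 0 \<le> \<rho> \<and> (\<exists>x. K \<subseteq> disc N x \<rho>)}"
  define R where "R = Inf S"
  have "(\<Sum>k\<in>K. N k) \<in> S"
  proof -
    have "0 \<in> common_centres N (\<Sum>k\<in>K. N k) K"
      using member_le_sum[of _ K N] assms(1) N_nonneg by (simp add: common_centres_def)
    then show ?thesis
      unfolding S_def disc mem_Collect_eq by (intro conjI sum_nonneg exI) (use N_nonneg in simp_all)
  qed
  then have ne: "S \<noteq> {}"
    by blast
  have bdd: "bdd_below S"
    by (rule bdd_belowI[of _ 0]) (simp add: S_def)
  have R0: "0 \<le> R"
    unfolding R_def using ne by (intro cInf_greatest) (simp_all add: S_def)
  define F where "F = (\<lambda>n :: nat. common_centres N (R + 1 / Suc n) K)"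
  have mono: "common_centres N \<rho> K \<subseteq> common_centres N \<rho>' K" if "\<rho> \<le> \<rho>'" for \<rho> \<rho>'
    using that by (force simp: common_centres_def)
  have "F n \<noteq> {}" for n
  proof -
    have "Inf S < R + 1 / Suc n"
      by (simp add: R_def)
    then obtain \<rho> where "\<rho> \<in> S" "\<rho> < R + 1 / Suc n"
      using cInf_less_iff[OF ne bdd] by blast
    then show ?thesis
      unfolding F_def S_def disc using mono[of \<rho> "R + 1 / Suc n"] by auto
  qed
  moreover have "F n \<subseteq> F m" if "m \<le> n" for m n
    unfolding F_def using that by (intro mono) (simp add: field_simps)
  moreover have "compact (F n)" for n
    unfolding F_def by (rule compact_common_centres[OF False])
  ultimately have "\<Inter> (range F) \<noteq> {}"
    by (rule compact_nest[rotated])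
  then obtain x where x: "\<And>n. x \<in> F n"
    by blast
  have "N (k - x) \<le> R" if "k \<in> K" for k
  proof (rule field_le_epsilon)
    fix e :: real assume "0 < e"
    then obtain n where "1 / Suc n < e"
      using nat_approx_posE by blast
    moreover have "N (k - x) \<le> R + 1 / Suc n"
      using x[of n] that by (simp add: F_def common_centres_def)
    ultimately show "N (k - x) \<le> R + e"
      by simp
  qed
  then have xR: "x \<in> common_centres N R K"
    by (simp add: common_centres_def)
  have "circumradius N K = R"
    unfolding circumradius_def
  proof (rule Least_equality)
    show "0 \<le> R \<and> (\<exists>x. K \<subseteq> disc N x R)"
      using R0 xR disc by blast
    fix \<rho> assume "0 \<le> \<rho> \<and> (\<exists>x. K \<subseteq> disc N x \<rho>)"
    then show "R \<le> \<rho>"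
      unfolding R_def using bdd by (intro cInf_lower) (simp_all add: S_def)
  qed
  then show ?thesis
    using xR mono assms(2) by blast
qed

text \<open>Every disc contains the empty set, and every point is outside some disc of the given
  radius.\<close>

lemma ball_hull_empty: "ball_hull N {} r = {}"
proof -
  have "\<exists>x. r < N (z - x)" for z
  proof -
    have n: "N (1, 0) > 0"
      by (intro N_pos) (simp add: zero_prod_def)
    have "z - (z - ((\<bar>r\<bar> + 1) / N (1, 0)) *\<^sub>R (1, 0)) = ((\<bar>r\<bar> + 1) / N (1, 0)) *\<^sub>R (1, 0)"
      by simp
    then have "N (z - (z - ((\<bar>r\<bar> + 1) / N (1, 0)) *\<^sub>R (1, 0))) = \<bar>r\<bar> + 1"
      using n by (simp only: N_scale) (simp add: zero_prod_def)
    then show ?thesis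
      by (intro exI[of _ "z - ((\<bar>r\<bar> + 1) / N (1, 0)) *\<^sub>R (1, 0)"]) linarith
  qed
  then show ?thesis
    by (auto simp: ball_hull_eq common_centres_def not_le)
qed

lemma ball_hull_singleton:
  assumes "0 \<le> r"
  shows "ball_hull N {p} r = {p}"
proof -
  have "\<exists>x. N (p - x) \<le> r \<and> r < N (z - x)" if "z \<noteq> p" for z
  proof -
    define w where "w = z - p"
    have "0 < N w"
      unfolding w_def using that by (intro N_pos) simp
    have "z - (p - (r / N w) *\<^sub>R w) = (1 + r / N w) *\<^sub>R w"
      by (simp add: w_def algebra_simps)
    then have "N (z - (p - (r / N w) *\<^sub>R w)) = (1 + r / N w) * N w"
      using \<open>0 < N w\<close> assms by (simp add: N_scale)
    also have "\<dots> = N w + r"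
    proof -
      have "r / N w * N w = r"
        using \<open>0 < N w\<close> by (metis nonzero_eq_divide_eq order_less_irrefl)
      then show ?thesis
        by (simp only: distrib_right mult_1)
    qed
    finally show ?thesis
      using \<open>0 < N w\<close> assms by (intro exI[of _ "p - (r / N w) *\<^sub>R w"]) (auto simp: N_scale)
  qed
  then show ?thesis
    by (force simp: ball_hull_eq common_centres_def)
qed

lemma lists_hull_vertices_empty: "lists_hull_vertices N {} r []"
  by (simp add: lists_hull_vertices_def hull_vertices_def ball_hull_empty)

lemma centre_exists:
  assumes "0 \<le> r"
  shows "\<exists>x. N (p - x) = r"
proof -
  define w :: point where "w = (1, 0)"
  have w0: "w \<noteq> 0"
    by (simp add: w_def zero_prod_def)
  then have "N (p - (p - (r / N w) *\<^sub>R w)) = r"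
    using assms N_pos[OF w0] by (simp add: N_scale)
  then show ?thesis ..
qed

lemma lists_hull_vertices_singleton:
  assumes "0 \<le> r"
  shows "lists_hull_vertices N {p} r [p]"
proof -
  obtain x where "N (p - x) = r"
    using centre_exists[OF assms] by blast
  then have "p \<in> circle N x r"
    by (simp add: circle_def)
  then show ?thesis
    unfolding lists_hull_vertices_def hull_vertices_def ball_hull_singleton[OF assms]
    by (intro conjI exI[of _ "\<lambda>_. x"]) (simp_all add: ccw_arc_def lessThan_Suc frontier_def)
qed

end

context ball_plane begin

text \<open>From a point at distance \<open>r\<close> from an admissible centre, a small step away
  from that centre leaves the hull. If there is no such centre, compactness of \<open>C K\<close>
  keeps all distances below \<open>r\<close> by a fixed amount, and a neighbourhood fits into the
  hull.\<close>

lemma frontier_ball_hull: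
  assumes "K \<noteq> {}" "C K \<noteq> {}"
  shows "frontier (ball_hull N K r) = {z \<in> ball_hull N K r. \<exists>x\<in>C K. N (z - x) = r}"
proof -
  let ?H = "ball_hull N K r"
  have "?H = (\<Inter>x\<in>C K. {z. N (z - x) \<le> r})"
    by (auto simp: ball_hull_eq)
  then have "closed ?H"
    by (auto intro!: closed_INT closed_Collect_le continuous_intros)
  have "z \<notin> interior ?H" if z: "x \<in> C K" "N (z - x) = r" for z x
  proof
    assume "z \<in> interior ?H"
    then obtain e where e: "0 < e" "ball z e \<subseteq> ?H"
      by (meson mem_interior)
    \<comment> \<open>Small enough for the step \<open>d *\<^sub>R (z - x)\<close> to stay within
      \<open>e\<close>; adding 1 avoids a zero denominator.\<close>
    define d where "d = e / (2 * (norm (z - x) + 1))"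
    have d: "0 < d"
      using e by (simp add: d_def add_nonneg_pos)
    have "e / (2 * n) * n = e / 2" if "n \<noteq> 0" for n :: real
      using that by simp
    then have "d * (norm (z - x) + 1) = e / 2"
      unfolding d_def using norm_ge_zero[of "z - x"] by (smt (verit))
    then have "d * norm (z - x) < e"
      using d e by (simp add: distrib_left)
    then have "norm (d *\<^sub>R (z - x)) < e"
      using d by simp
    then have "z + d *\<^sub>R (z - x) \<in> ball z e"
      by (simp add: dist_norm)
    then have "N (z + d *\<^sub>R (z - x) - x) \<le> r"
      using e z by (force simp: ball_hull_eq)
    moreover have "z + d *\<^sub>R (z - x) - x = (1 + d) *\<^sub>R (z - x)"
      by (simp add: algebra_simps)
    ultimately have "(1 + d) * r \<le> r"
      using d z by (simp add: N_scale)
    then show False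
      using d r_pos by simp
  qed
  moreover have "z \<in> interior ?H" if z: "z \<in> ?H" "\<And>x. x \<in> C K \<Longrightarrow> N (z - x) \<noteq> r" for z
  proof -
    have "continuous_on (C K) (\<lambda>x. N (z - x))"
      by (intro continuous_intros)
    then obtain x0 where x0: "x0 \<in> C K" "\<And>x. x \<in> C K \<Longrightarrow> N (z - x) \<le> N (z - x0)"
      using continuous_attains_sup[OF compact_common_centres[OF assms(1), of r] assms(2)] by blast
    have M: "N (z - x0) < r"
    proof -
      have "N (z - x0) \<le> r"
        using z(1) x0(1) unfolding ball_hull_eq by blast
      then show ?thesis
        using z(2)[OF x0(1)] by simp
    qed
    define L where "L = N (1, 0) + N (0, 1) + 1"
    have L: "0 < L"
      using N_nonneg by (simp add: L_def add_nonneg_pos)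
    have "ball z ((r - N (z - x0)) / L) \<subseteq> ?H"
    proof
      fix y assume "y \<in> ball z ((r - N (z - x0)) / L)"
      then have "L * norm (y - z) < r - N (z - x0)"
        using L by (simp add: dist_norm norm_minus_commute field_simps)
      moreover have "N (y - z) \<le> L * norm (y - z)"
        using N_le_norm[of "y - z"] by (simp add: L_def distrib_right add_increasing2)
      ultimately have y: "N (y - z) < r - N (z - x0)"
        by simp
      have "N (y - x) \<le> r" if "x \<in> C K" for x
        using N_triangle[of "y - z" "z - x"] y x0(2)[OF that] by simp
      then show "y \<in> ?H"
        by (simp add: ball_hull_eq)
    qed
    then show ?thesis
      using M L by (auto simp: mem_interior intro!: exI[of _ "(r - N (z - x0)) / L"])
  qed
  ultimately show ?thesis
    using closure_closed[OF \<open>closed ?H\<close>] unfolding frontier_def by blast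
qed

lemma hull_vertices_eq:
  assumes "K \<noteq> {}" "C K \<noteq> {}"
  shows "hull_vertices N K r = V K"
  unfolding hull_vertices_def frontier_ball_hull[OF assms]
  by (auto simp: ball_vertices_def ball_hull_eq common_centres_def)

end

section \<open>Combining two ball hulls\<close>

fun lex_merge :: "point list \<Rightarrow> point list \<Rightarrow> point list" where
  "lex_merge [] ys = ys"
| "lex_merge (x # xs) [] = x # xs"
| "lex_merge (x # xs) (y # ys) =
    (if lex_less x y then x # lex_merge xs (y # ys) else y # lex_merge (x # xs) ys)"

lemma set_lex_merge [simp]: "set (lex_merge xs ys) = set xs \<union> set ys"
  by (induction xs ys rule: lex_merge.induct) auto

lemma length_lex_merge [simp]: "length (lex_merge xs ys) = length xs + length ys"
  by (induction xs ys rule: lex_merge.induct) auto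

lemma sorted_lex_merge:
  assumes "sorted_wrt lex_less xs" "sorted_wrt lex_less ys" "set xs \<inter> set ys = {}"
  shows "sorted_wrt lex_less (lex_merge xs ys)"
  using assms
proof (induction xs ys rule: lex_merge.induct)
  case (3 x xs y ys)
  have "lex_less y x" if "\<not> lex_less x y"
    using that lex_less_total[of x y] 3(5) by auto
  then show ?case
    using 3 by (auto intro: lex_less_trans)
qed auto

text \<open>Starting at its greatest element, the list of vertices of a hull first decreases and then
  increases, so that it can be sorted in linear time.\<close>

fun unroll :: "point list \<Rightarrow> point list \<Rightarrow> point list" where
  "unroll [] acc = acc"
| "unroll (x # xs) [] = unroll xs [x]"
| "unroll (x # xs) (a # acc) =
    (if lex_less x a then unroll xs (x # a # acc) else lex_merge (a # acc) (x # xs))"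

text \<open>No element exceeds both an earlier and a later one. For distinct points this means that
  the list decreases and then increases.\<close>

fun no_peak :: "point list \<Rightarrow> bool" where
  "no_peak [] \<longleftrightarrow> True"
| "no_peak (x # xs) \<longleftrightarrow> sorted_wrt (\<lambda>b c. \<not> (lex_less x b \<and> lex_less c b)) xs \<and> no_peak xs"

lemma set_unroll [simp]: "set (unroll xs acc) = set xs \<union> set acc"
  by (induction xs acc rule: unroll.induct) auto

lemma length_unroll [simp]: "length (unroll xs acc) = length xs + length acc"
  by (induction xs acc rule: unroll.induct) auto

lemma no_peak_increasing:
  assumes "no_peak (a # x # xs)" "lex_less a x" "distinct (x # xs)"
  shows "sorted_wrt lex_less (x # xs)"
  using assms
proof (induction xs arbitrary: a x)
  case Nil
  then show ?case by simp
next
  case (Cons y ys)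
  have le: "lex_less x z" if "z \<in> set (y # ys)" for z
    using Cons.prems that lex_less_total[of x z] by auto
  have "sorted_wrt lex_less (y # ys)"
    using Cons.prems le by (intro Cons.IH[of x y]) auto
  then show ?case
    using le by simp
qed

lemma sorted_unroll:
  assumes "sorted_wrt lex_less acc" "acc \<noteq> [] \<Longrightarrow> no_peak (hd acc # xs)" "no_peak xs" "distinct (xs @ acc)"
  shows "sorted_wrt lex_less (unroll xs acc)"
  using assms
proof (induction xs acc rule: unroll.induct)
  case (1 acc)
  then show ?case by simp
next
  case (2 x xs)
  then show ?case by simp
next
  case (3 x xs a acc)
  show ?case
  proof (cases "lex_less x a")
    case True
    then show ?thesis
      using 3 by (auto intro: lex_less_trans)
  next
    case False
    then have "lex_less a x"
      using 3(5) lex_less_total[of a x] by auto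
    then have "sorted_wrt lex_less (x # xs)"
      using 3(3,5) by (intro no_peak_increasing[of a]) auto
    then show ?thesis
      using False 3(2,5) by (auto intro!: sorted_lex_merge simp del: lex_merge.simps)
  qed
qed

text \<open>For \<open>m\<close>, \<open>a\<close>, \<open>b\<close>, \<open>c\<close> in convex
  position, \<open>m - b\<close>, \<open>b - a\<close> and \<open>b - c\<close> satisfy a linear
  relation with positive coefficients. With \<open>m\<close> above \<open>b\<close> and a peak at
  \<open>b\<close>, all three vectors would be lexicographically positive.\<close>

lemma ccw_no_peak_aux:
  assumes "lex_less b m" "lex_less a b" "lex_less c b"
    and "0 < cross (a - m) (b - m)" "0 < cross (b - m) (c - m)" "0 < cross (b - a) (c - a)"
  shows False
proof -
  have "cross (b - a) (c - a) *\<^sub>R (m - b) + cross (b - m) (c - m) *\<^sub>R (b - a) + cross (a - m) (b - m) *\<^sub>R (b - c) = 0"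
    by (simp add: prod_eq_iff cross_def algebra_simps)
  then show False
    using lex_positive_combination[of "m - b" "b - a" "b - c"] assms by (simp flip: lex_less_diff)
qed

lemma ccw_list_no_peak:
  assumes "ccw_list (m # ws)" "\<And>v. v \<in> set ws \<Longrightarrow> lex_less v m"
  shows "no_peak (m # ws)"
proof -
  have "no_peak ws"
    using assms
  proof (induction ws)
    case Nil
    then show ?case by simp
  next
    case (Cons x xs)
    have "sorted_wrt (\<lambda>b c. \<not> (lex_less x b \<and> lex_less c b)) xs"
      unfolding sorted_wrt_iff_nth_less
    proof (intro allI impI notI)
      fix i j assume ij: "i < j" "j < length xs" "lex_less x (xs ! i) \<and> lex_less (xs ! j) (xs ! i)"
      have mem: "xs ! i \<in> set xs" "xs ! j \<in> set xs"
        using ij by auto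
      have "0 < cross (xs ! i - m) (xs ! j - m)" "0 < cross (xs ! i - x) (xs ! j - x)"
        using Cons.prems(1) ij sorted_wrt_nth_less[of _ xs i j] by auto
      then show False
        using ccw_no_peak_aux[of "xs ! i" m x "xs ! j"] ij Cons.prems mem by auto
    qed
    moreover have "no_peak xs"
      using Cons.prems by (intro Cons.IH) auto
    ultimately show ?case
      by simp
  qed
  moreover have "sorted_wrt (\<lambda>b c. \<not> (lex_less m b \<and> lex_less c b)) ws"
    unfolding sorted_wrt_iff_nth_less using assms(2) lex_less_asym nth_mem by (meson less_trans)
  ultimately show ?thesis
    by simp
qed

lemma sorted_unroll_hull_list:
  assumes "hull_list N r K vs"
  shows "sorted_wrt lex_less (unroll vs [])"
proof -
  obtain m ws where "vs = m # ws"
    using assms by (cases vs) (auto simp: hull_list_def)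
  then show ?thesis
    using assms ccw_list_no_peak[of m ws] by (intro sorted_unroll) (auto simp: hull_list_def)
qed

definition combine :: "(point \<Rightarrow> real) \<Rightarrow> real \<Rightarrow> point list \<Rightarrow> point list \<Rightarrow> point list" where
  "combine N r ls rs = fold (insert_point N r) (unroll rs []) ls"

context ball_plane begin

lemma fold_insert_point:
  assumes "hull_list N r Q vs" "finite Q" "C (Q \<union> set ps) \<noteq> {}" "sorted_wrt lex_less ps"
    and "\<And>q p. q \<in> Q \<Longrightarrow> p \<in> set ps \<Longrightarrow> lex_less q p"
  shows "hull_list N r (Q \<union> set ps) (fold (insert_point N r) ps vs)"
  using assms
proof (induction ps arbitrary: Q vs)
  case Nil
  then show ?case by simp
next
  case (Cons p ps)
  have "C (insert p Q) \<noteq> {}"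
    using Cons.prems(3) C_antimono[of "insert p Q" "Q \<union> set (p # ps)"] by auto
  then have "hull_list N r (insert p Q) (insert_point N r p vs)"
    using Cons.prems by (intro insert_point_hull_list) auto
  then have "hull_list N r (insert p Q \<union> set ps) (fold (insert_point N r) ps (insert_point N r p vs))"
    using Cons.prems by (intro Cons.IH) auto
  then show ?case
    by simp
qed

text \<open>Only the vertices of the right half are inserted. This loses nothing: the other points
  of \<open>B\<close> do not restrict the centres, and no point becomes a vertex when more points
  are added.\<close>

lemma hull_list_combine:
  assumes h: "hull_list N r A ls" "hull_list N r B rs" and fin: "finite A" "finite B"
    and ne: "C (A \<union> B) \<noteq> {}" and lex: "\<And>a b. a \<in> A \<Longrightarrow> b \<in> B \<Longrightarrow> lex_less a b"
  shows "hull_list N r (A \<union> B) (combine N r ls rs)"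
proof -
  have rs: "set rs = V B"
    using h(2) by (simp add: hull_list_def)
  have "C B \<noteq> {}"
    using ne C_antimono[of B "A \<union> B"] by auto
  then have C_eq: "C (A \<union> V B) = C (A \<union> B)"
    by (simp add: C_Un C_V fin)
  have V_eq: "V (A \<union> V B) = V (A \<union> B)"
  proof
    have "k \<in> V (A \<union> B)" if k: "k \<in> V (A \<union> V B)" for k
    proof -
      obtain x where "x \<in> C (A \<union> V B)" "N (k - x) = r"
        using V_D[OF k] by auto
      moreover have "k \<in> A \<union> B"
        using k V_subset[of "A \<union> V B"] V_subset[of B] by auto
      ultimately show ?thesis
        unfolding C_eq by (intro V_I)
    qed
    then show "V (A \<union> V B) \<subseteq> V (A \<union> B)"
      by blast
    have "k \<in> V (A \<union> V B)" if k: "k \<in> V (A \<union> B)" for k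
    proof -
      have "k \<in> A \<union> V B"
        using V_antimono[OF k, of B] k V_subset[of "A \<union> B"] by auto
      moreover obtain x where "x \<in> C (A \<union> B)" "N (k - x) = r"
        using V_D[OF k] by auto
      ultimately show ?thesis
        by (intro V_I) (simp_all add: C_eq)
    qed
    then show "V (A \<union> B) \<subseteq> V (A \<union> V B)"
      by blast
  qed
  have "hull_list N r (A \<union> set (unroll rs [])) (combine N r ls rs)"
    unfolding combine_def
  proof (rule fold_insert_point[OF h(1) fin(1)])
    show "sorted_wrt lex_less (unroll rs [])"
      by (rule sorted_unroll_hull_list[OF h(2)])
    show "C (A \<union> set (unroll rs [])) \<noteq> {}"
      using ne C_eq rs by simp
    show "lex_less q p" if "q \<in> A" "p \<in> set (unroll rs [])" for q p
      using that rs V_subset[of B] by (intro lex) auto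
  qed
  then show ?thesis
    using V_eq rs by (simp add: hull_list_def)
qed

lemma hull_list_singleton: "hull_list N r {p} [p]"
proof -
  obtain x where x: "N (p - x) = r"
    using centre_exists[OF less_imp_le[OF r_pos]] by blast
  then have "x \<in> C {p}"
    by (simp add: common_centres_def)
  from V_I[OF singletonI this x] have "p \<in> V {p}" .
  then have "V {p} = {p}"
    using V_subset[of "{p}"] by blast
  then show ?thesis
    by (simp add: hull_list_def)
qed

text \<open>The polygon is divided into triangles that share \<open>vs ! 0\<close>, and
  \<open>z\<close> lies in one of them. Its weight at \<open>vs ! 0\<close> is strictly positive
  because \<open>z\<close> is strictly to the left of the opposite edge.\<close>

lemma fan_triangle:
  assumes n: "2 \<le> length vs"
    and left: "\<And>i. i < length vs \<Longrightarrow> 0 < cross (vs ! (Suc i mod length vs) - vs ! i) (z - vs ! i)"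
  obtains i j \<alpha> \<beta> \<gamma> where "i < length vs" "j < length vs" "0 < \<alpha>" "0 \<le> \<beta>" "0 \<le> \<gamma>"
    "(\<alpha> + \<beta> + \<gamma>) *\<^sub>R z = \<alpha> *\<^sub>R (vs ! 0) + \<beta> *\<^sub>R (vs ! i) + \<gamma> *\<^sub>R (vs ! j)"
proof -
  let ?n = "length vs" and ?v = "vs ! 0"
  define s where "s = (\<lambda>j. cross (vs ! j - ?v) (z - ?v))"
  have "0 < s 1"
  proof -
    have "0 < ?n"
      using n by linarith
    from left[OF this] n show ?thesis
      by (simp add: s_def)
  qed
  have "Suc (?n - 1) = ?n"
    using n by simp
  then have "Suc (?n - 1) mod ?n = 0"
    by simp
  then have "0 < cross (?v - vs ! (?n - 1)) (z - vs ! (?n - 1))"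
    using left[of "?n - 1"] n by simp
  then have last: "s (?n - 1) < 0"
    by (simp add: s_def cross_def algebra_simps)
  \<comment> \<open>\<open>j\<close> is the first vertex for which \<open>z\<close> is no longer to
    the left of the diagonal from \<open>vs ! 0\<close>; the triangle is spanned with its
    predecessor.\<close>
  define j where "j = (LEAST j. 1 \<le> j \<and> s j \<le> 0)"
  have "1 \<le> ?n - 1 \<and> s (?n - 1) \<le> 0"
    using n last by simp
  then have j: "1 \<le> j" "s j \<le> 0" "j \<le> ?n - 1"
    unfolding j_def by (metis (mono_tags, lifting) LeastI, metis (mono_tags, lifting) LeastI, metis (mono_tags, lifting) Least_le)
  have "j \<noteq> 1"
    using j \<open>0 < s 1\<close> by auto
  then obtain i where i: "j = Suc i" "1 \<le> i"
    using j(1) by (cases j) auto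
  have "0 < s i"
    using not_less_Least[of i "\<lambda>j. 1 \<le> j \<and> s j \<le> 0"] i unfolding j_def[symmetric] by auto
  have "Suc i mod ?n = j"
    using i j(3) n by simp
  then have pos: "0 < cross (vs ! j - vs ! i) (z - vs ! i)"
    using left[of i] i j(3) n by simp
  show thesis
  proof (rule that[of i j])
    show "(cross (vs ! j - vs ! i) (z - vs ! i) + - s j + s i) *\<^sub>R z =
        cross (vs ! j - vs ! i) (z - vs ! i) *\<^sub>R ?v + (- s j) *\<^sub>R (vs ! i) + s i *\<^sub>R (vs ! j)"
      by (simp add: prod_eq_iff s_def cross_def) (simp add: algebra_simps)
  qed (use i j n pos \<open>0 < s i\<close> in auto)
qed

text \<open>The arcs lie in the frontier by \<open>cap_lemma\<close>. Conversely, a frontier point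
  other than a vertex is not inside the polygon of vertices, hence is strictly beyond some edge, and
  the strict part of \<open>cap_lemma\<close> forces it onto the arc over that edge. Two points in
  \<open>K\<close> ensure two vertices, so that no arc degenerates.\<close>

lemma lists_hull_vertices_hull_list:
  assumes h: "hull_list N r K vs" and K: "finite K" "C K \<noteq> {}" and two: "\<And>p. K \<noteq> {p}"
  shows "lists_hull_vertices N K r vs"
proof -
  let ?n = "length vs"
  define nxt where "nxt = (\<lambda>i. vs ! (Suc i mod ?n))"
  define c where "c = (\<lambda>i. lc (vs ! i) (nxt i))"
  define arc where "arc = (\<lambda>i. ccw_arc N (c i) r (vs ! i) (nxt i))"
  have vs: "vs \<noteq> []" "distinct vs" "ccw_list vs" "set vs = V K"
    using h by (auto simp: hull_list_def)
  have Kne: "K \<noteq> {}"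
    using vs V_subset[of K] by auto
  have "hd vs \<in> V K"
    using vs by (metis list.set_sel(1))
  then obtain w where "w \<in> V K - {hd vs}"
    using successor_vertex[OF K(1) _ two] by blast
  with \<open>hd vs \<in> V K\<close> have "card {hd vs, w} \<le> card (V K)" "hd vs \<noteq> w"
    using finite_subset[OF V_subset K(1)] by (auto intro!: card_mono)
  then have n: "2 \<le> ?n"
    using vs by (metis card_2_iff distinct_card)
  have decomp: "vs @ [hd vs] = take i vs @ vs ! i # nxt i # drop (Suc (Suc i)) (vs @ [hd vs])" if i: "i < ?n" for i
  proof -
    let ?zs = "vs @ [hd vs]"
    have "?zs = take i ?zs @ ?zs ! i # ?zs ! Suc i # drop (Suc (Suc i)) ?zs"
      using i id_take_nth_drop[of i ?zs] Cons_nth_drop_Suc[of "Suc i" ?zs] by simp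
    moreover have "?zs ! Suc i = nxt i"
    proof (cases "Suc i < ?n")
      case True
      then show ?thesis
        by (simp add: nxt_def nth_append)
    next
      case False
      then have "Suc i = ?n"
        using i by simp
      then show ?thesis
        using vs by (simp add: nxt_def hd_conv_nth nth_append)
    qed
    ultimately show ?thesis
      using i by (simp add: nth_append)
  qed
  have nxt: "nxt i \<in> V K" "vs ! i \<in> V K" "vs ! i \<noteq> nxt i" "lc (vs ! i) (nxt i) \<in> C K" if i: "i < ?n" for i
  proof -
    have "Suc i mod ?n < ?n"
      using n by (intro mod_less_divisor) linarith
    then show "nxt i \<in> V K" "vs ! i \<in> V K"
      using i unfolding nxt_def vs(4)[symmetric] by simp_all
    show "lc (vs ! i) (nxt i) \<in> C K" "vs ! i \<noteq> nxt i"
      by (rule cyclic_centres[OF vs(3,2,4) K(1) n decomp[OF i]])+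
  qed
  have in_K: "nxt i \<in> K" "vs ! i \<in> K" if "i < ?n" for i
    using nxt(1,2)[OF that] V_subset[of K] by auto
  have circ: "N (vs ! i - c i) = r" "N (nxt i - c i) = r" "0 \<le> cross (nxt i - vs ! i) (c i - vs ! i)" if i: "i < ?n" for i
    unfolding c_def using left_centre[OF nxt(3)[OF i] C_dist[OF nxt(4)[OF i] in_K(2,1)[OF i]]] by simp_all
  have arc_eq: "arc i = {z. N (z - c i) = r \<and> cross (nxt i - vs ! i) (z - vs ! i) \<le> 0}" if "i < ?n" for i
    using nxt(3)[OF that] by (simp add: arc_def ccw_arc_def circle_def)
  have zero: "cross a 0 = 0" "cross a a = 0" for a
    by (simp_all add: cross_def)
  have ends: "vs ! i \<in> arc i" "nxt i \<in> arc i" if "i < ?n" for i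
    using circ[OF that] by (simp_all add: arc_eq[OF that] zero)
  have arc_vs: "arc i \<inter> set vs = {vs ! i, nxt i}" if i: "i < ?n" for i
  proof (intro equalityI subsetI)
    fix z assume z: "z \<in> arc i \<inter> set vs"
    then have "cross (nxt i - vs ! i) (z - vs ! i) \<le> 0"
      by (simp add: arc_eq[OF i])
    moreover have "0 < cross (nxt i - vs ! i) (z - vs ! i)" if "z \<noteq> vs ! i" "z \<noteq> nxt i"
      using z by (intro ccw_list_cyclic(4)[OF vs(3,2) n decomp[OF i] _ that]) simp
    ultimately show "z \<in> {vs ! i, nxt i}"
      by force
  next
    fix z assume "z \<in> {vs ! i, nxt i}"
    moreover have "vs ! i \<in> arc i \<inter> set vs" "nxt i \<in> arc i \<inter> set vs"
      using ends[OF i] nxt(1,2)[OF i] by (simp_all add: vs(4))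
    ultimately show "z \<in> arc i \<inter> set vs"
      by blast
  qed
  have arc_frontier: "z \<in> frontier (ball_hull N K r)" if i: "i < ?n" and z: "z \<in> arc i" for i z
  proof -
    have z': "N (z - c i) \<le> r" "cross (nxt i - vs ! i) (z - vs ! i) \<le> 0" "N (z - c i) = r"
      using z by (simp_all add: arc_eq[OF i])
    have "N (z - x) \<le> r" if "x \<in> C K" for x
      by (rule cap_lemma(1)[OF circ(1,2)[OF i] nxt(3)[OF i] circ(3)[OF i] z'(1,2)])
        (use C_D[OF that] in_K[OF i] in simp_all)
    then have "z \<in> ball_hull N K r"
      by (simp add: ball_hull_eq)
    then show ?thesis
      unfolding frontier_ball_hull[OF Kne K(2)] mem_Collect_eq
      using nxt(4)[OF i] z'(3) unfolding c_def by (intro conjI bexI)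
  qed
  have frontier_arc: "\<exists>i<?n. z \<in> arc i" if "z \<in> frontier (ball_hull N K r)" for z
  proof (cases "z \<in> set vs")
    case True
    then obtain i where "i < ?n" "z = vs ! i"
      by (metis in_set_conv_nth)
    then show ?thesis
      using ends by blast
  next
    case False
    from that obtain x where z: "z \<in> ball_hull N K r" "x \<in> C K" "N (z - x) = r"
      unfolding frontier_ball_hull[OF Kne K(2)] by auto
    have zC: "N (z - y) \<le> r" if "y \<in> C K" for y
      using z(1) that by (simp add: ball_hull_eq)
    \<comment> \<open>Every admissible disc contains \<open>z\<close>, so \<open>z\<close> can be
      added to \<open>K\<close>. It becomes a vertex next to the old ones, and extremality applies
      to it.\<close>
    have C_eq: "C (insert z K) = C K"
      using zC by (auto simp: C_insert)
    have zV: "z \<in> V (insert z K)"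
      using z C_eq by (intro V_I[of _ _ x]) simp_all
    have V_sub: "v \<in> V (insert z K)" if v: "v \<in> V K" for v
    proof -
      obtain y where "y \<in> C K" "N (v - y) = r"
        using V_D[OF v] by auto
      then show ?thesis
        using v V_subset[of K] by (intro V_I[of _ _ y]) (auto simp: C_eq)
    qed
    have "\<exists>i<?n. cross (nxt i - vs ! i) (z - vs ! i) \<le> 0"
    proof (rule ccontr)
      assume "\<not> ?thesis"
      then have left: "0 < cross (vs ! (Suc i mod ?n) - vs ! i) (z - vs ! i)" if "i < ?n" for i
        using that by (auto simp: nxt_def not_le)
      obtain i j \<alpha> \<beta> \<gamma> where ij: "i < ?n" "j < ?n" "0 < \<alpha>" "0 \<le> \<beta>" "0 \<le> \<gamma>"
        "(\<alpha> + \<beta> + \<gamma>) *\<^sub>R z = \<alpha> *\<^sub>R (vs ! 0) + \<beta> *\<^sub>R (vs ! i) + \<gamma> *\<^sub>R (vs ! j)"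
        by (rule fan_triangle[OF n left])
      have "0 < ?n"
        using n by linarith
      then have "vs ! 0 = z"
        using ij in_K(2) by (intro V_extreme[OF zV _ _ _ ij(3-6)]) auto
      then show False
        using False nth_mem[OF \<open>0 < ?n\<close>] by simp
    qed
    then obtain i where i: "i < ?n" "cross (nxt i - vs ! i) (z - vs ! i) \<le> 0"
      by blast
    have "cross (nxt i - vs ! i) (z - vs ! i) \<noteq> 0"
    proof (rule V_not_collinear[OF V_sub V_sub zV])
      show "vs ! i \<noteq> z" "nxt i \<noteq> z"
        using False nxt(1,2)[OF i(1)] vs(4) by auto
    qed (use nxt[OF i(1)] in auto)
    then have neg: "cross (nxt i - vs ! i) (z - vs ! i) < 0"
      using i by simp
    have le: "N (z - c i) \<le> r"
      unfolding c_def by (rule zC[OF nxt(4)[OF i(1)]])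
    have "N (z - c i) = r"
    proof (rule ccontr)
      assume "N (z - c i) \<noteq> r"
      then have less: "N (z - c i) < r"
        using le by simp
      have "N (z - x) < r"
        by (rule cap_lemma(2)[OF circ(1,2)[OF i(1)] nxt(3)[OF i(1)] circ(3)[OF i(1)] le i(2)
              C_D[OF z(2) in_K(2)[OF i(1)]] C_D[OF z(2) in_K(1)[OF i(1)]] neg less])
      then show False
        using z(3) by simp
    qed
    then show ?thesis
      using i by (intro exI[of _ i]) (simp add: arc_eq)
  qed
  have "frontier (ball_hull N K r) = (\<Union>i<?n. arc i)"
  proof (intro equalityI subsetI)
    fix z assume "z \<in> frontier (ball_hull N K r)"
    from frontier_arc[OF this] obtain i where "i < ?n" "z \<in> arc i"
      by (elim exE conjE)
    then show "z \<in> (\<Union>i<?n. arc i)"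
      by (intro UN_I[of i]) simp_all
  next
    fix z assume "z \<in> (\<Union>i<?n. arc i)"
    then show "z \<in> frontier (ball_hull N K r)"
      by (elim UN_E) (rule arc_frontier, simp_all)
  qed
  then show ?thesis
    unfolding lists_hull_vertices_def Let_def hull_vertices_eq[OF Kne K(2)]
    using vs circ arc_vs
    by (intro conjI exI[of _ c]) (simp_all add: circle_def nxt_def arc_def)
qed

end

section \<open>The program\<close>

definition prim_value :: "(point \<Rightarrow> real) \<Rightarrow> prim \<Rightarrow> val list \<Rightarrow> val option" where
  "prim_value N g us = (if \<exists>v. apply_prim N g us v then Some (THE v. apply_prim N g us v) else None)"

text \<open>A call is looked up in the big-step relation and not unfolded. So evaluation by
  rewriting is structurally recursive although the program is recursive, and recursive procedures
  are handled by induction on their arguments.\<close>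

definition call_value :: "(point \<Rightarrow> real) \<Rightarrow> expr list \<Rightarrow> nat \<Rightarrow> val list \<Rightarrow> (val \<times> nat) option" where
  "call_value N P k us =
    (if \<exists>w. k < length P \<and> evaluates N P us (P ! k) (fst w) (snd w)
     then Some (THE w. evaluates N P us (P ! k) (fst w) (snd w)) else None)"

text \<open>A denotational version of \<open>evaluates\<close>, so that programs can be executed by rewriting.\<close>

fun value_of :: "(point \<Rightarrow> real) \<Rightarrow> expr list \<Rightarrow> val list \<Rightarrow> expr \<Rightarrow> (val \<times> nat) option"
  and values_of :: "(point \<Rightarrow> real) \<Rightarrow> expr list \<Rightarrow> val list \<Rightarrow> expr list \<Rightarrow> (val list \<times> nat) option"
where
  "value_of N P env (EVar i) = (if i < length env then Some (env ! i, 1) else None)"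
| "value_of N P env (ELet e f) =
    (case value_of N P env e of None \<Rightarrow> None | Some (u, s) \<Rightarrow>
      (case value_of N P (u # env) f of None \<Rightarrow> None | Some (v, t) \<Rightarrow> Some (v, Suc (s + t))))"
| "value_of N P env (EIf b e f) =
    (case value_of N P env b of
      Some (VBool c, s) \<Rightarrow>
        (case (if c then value_of N P env e else value_of N P env f) of
          None \<Rightarrow> None | Some (v, t) \<Rightarrow> Some (v, Suc (s + t)))
    | _ \<Rightarrow> None)"
| "value_of N P env (EPrim g es) =
    (case values_of N P env es of None \<Rightarrow> None | Some (us, s) \<Rightarrow>
      (case prim_value N g us of None \<Rightarrow> None | Some v \<Rightarrow> Some (v, Suc s)))"
| "value_of N P env (ECall k es) =
    (case values_of N P env es of None \<Rightarrow> None | Some (us, s) \<Rightarrow>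
      (case call_value N P k us of None \<Rightarrow> None | Some (v, t) \<Rightarrow> Some (v, Suc (s + t))))"
| "values_of N P env [] = Some ([], 0)"
| "values_of N P env (e # es) =
    (case value_of N P env e of None \<Rightarrow> None | Some (u, s) \<Rightarrow>
      (case values_of N P env es of None \<Rightarrow> None | Some (us, t) \<Rightarrow> Some (u # us, s + t)))"

lemma prim_value_eq_Some: "prim_value N g us = Some v \<longleftrightarrow> apply_prim N g us v"
proof
  assume "apply_prim N g us v"
  moreover from this have "(THE v. apply_prim N g us v) = v"
    using apply_prim_deterministic by blast
  ultimately show "prim_value N g us = Some v"
    by (auto simp: prim_value_def)
next
  assume a: "prim_value N g us = Some v"
  then obtain w where w: "apply_prim N g us w"
    by (auto simp: prim_value_def split: if_splits)
  then have "(THE v. apply_prim N g us v) = w"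
    using apply_prim_deterministic by blast
  then show "apply_prim N g us v"
    using a w by (auto simp: prim_value_def split: if_splits)
qed

lemma call_value_eq_Some:
  "call_value N P k us = Some (v, t) \<longleftrightarrow> k < length P \<and> evaluates N P us (P ! k) v t"
proof
  have the: "(THE w. evaluates N P us (P ! k) (fst w) (snd w)) = (v, t)" if "evaluates N P us (P ! k) v t" for v t
  proof (rule the_equality)
    fix w assume "evaluates N P us (P ! k) (fst w) (snd w)"
    then show "w = (v, t)"
      using evaluates_deterministic(1)[OF that] by (metis prod.collapse)
  qed (use that in simp)
  {
    assume a: "k < length P \<and> evaluates N P us (P ! k) v t"
    then have ex: "\<exists>w. k < length P \<and> evaluates N P us (P ! k) (fst w) (snd w)"
      by (intro exI[of _ "(v, t)"]) simp
    then show "call_value N P k us = Some (v, t)"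
      unfolding call_value_def if_P[OF ex] using the a by simp
  next
    assume a: "call_value N P k us = Some (v, t)"
    then obtain w where w: "k < length P" "evaluates N P us (P ! k) (fst w) (snd w)"
      unfolding call_value_def by (meson option.distinct(1))
    then have "call_value N P k us = Some w"
      using the[OF w(2)] unfolding call_value_def by (simp only: prod.collapse) (metis (mono_tags, lifting))
    then show "k < length P \<and> evaluates N P us (P ! k) v t"
      using a w by (metis fst_conv snd_conv option.inject)
  }
qed

lemma value_of_sound:
  "value_of N P env e = Some (v, t) \<Longrightarrow> evaluates N P env e v t"
  "values_of N P env es = Some (us, t) \<Longrightarrow> evaluates_list N P env es us t"
proof (induction N P env e and N P env es arbitrary: v t and us t rule: value_of_values_of.induct)
  case (1 N P env i)
  then show ?case
    using Var[of i env N P] by (auto split: if_splits)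
next
  case (2 N P env e f)
  then obtain u s w where e: "value_of N P env e = Some (u, s)"
    and f: "value_of N P (u # env) f = Some (v, w)" "t = Suc (s + w)"
    by (auto split: option.splits)
  show ?case
    unfolding f(2) by (rule Let[OF 2(1)[OF e] 2(2)[OF e refl f(1)]])
next
  case (3 N P env b e f)
  then obtain c s w where b: "value_of N P env b = Some (VBool c, s)"
    and w: "(if c then value_of N P env e else value_of N P env f) = Some (v, w)" "t = Suc (s + w)"
    by (auto split: option.splits val.splits)
  have "evaluates N P env b (VBool c) s"
    by (rule 3(1)[OF b])
  moreover have "evaluates N P env e v w" if c
    using 3(2)[OF b refl refl that] w that by simp
  moreover have "evaluates N P env f v w" if "\<not> c"
    using 3(3)[OF b refl refl that] w that by simp
  ultimately show ?case
    unfolding w(2) by (cases c) (auto intro: evaluates_evaluates_list.intros)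
next
  case (4 N P env g es)
  then obtain us s where "values_of N P env es = Some (us, s)" "apply_prim N g us v" "t = Suc s"
    by (auto split: option.splits simp: prim_value_eq_Some)
  then show ?case
    using 4(1) Prim by blast
next
  case (5 N P env k es)
  then obtain us s w where "values_of N P env es = Some (us, s)" "k < length P"
    "evaluates N P us (P ! k) v w" and t: "t = Suc (s + w)"
    by (auto split: option.splits simp: call_value_eq_Some)
  then show ?case
    unfolding t using 5(1) Call by blast
next
  case (6 N P env)
  then show ?case
    using Nil[of N P env] by simp
next
  case (7 N P env e es)
  then obtain u s us' w where e: "value_of N P env e = Some (u, s)"
    and es: "values_of N P env es = Some (us', w)" "us = u # us'" "t = s + w"
    by (auto split: option.splits)
  show ?case
    unfolding es(2,3) by (rule Cons[OF 7(1)[OF e] 7(2)[OF e refl es(1)]])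
qed

lemma call_valueI:
  assumes "k < length P" "value_of N P us (P ! k) = Some (v, t)"
  shows "call_value N P k us = Some (v, t)"
  using assms value_of_sound(1) by (simp add: call_value_eq_Some)

lemma enc_point_eq: "enc_point p = VCons (VReal (fst p)) (VReal (snd p))"
  by (cases p) simp

lemma prim_values:
  "prim_value N PZero [] = Some (VReal 0)"
  "prim_value N POne [] = Some (VReal 1)"
  "prim_value N PSub [VReal a, VReal b] = Some (VReal (a - b))"
  "prim_value N PMul [VReal a, VReal b] = Some (VReal (a * b))"
  "prim_value N PLess [VReal a, VReal b] = Some (VBool (a < b))"
  "prim_value N PNorm [enc_point p] = Some (VReal (N p))"
  "prim_value N PNil [] = Some (enc_points [])"
  "prim_value N PCons [VReal a, VReal b] = Some (enc_point (a, b))"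
  "prim_value N PCons [enc_point p, enc_points ps] = Some (enc_points (p # ps))"
  "prim_value N PCons [enc_points ps, enc_points qs] = Some (VCons (enc_points ps) (enc_points qs))"
  "prim_value N PCons [enc_point p, VCons u v] = Some (VCons (enc_point p) (VCons u v))"
  "prim_value N PHead [VCons u v] = Some u"
  "prim_value N PTail [VCons u v] = Some v"
  "prim_value N PHead [enc_point p] = Some (VReal (fst p))"
  "prim_value N PTail [enc_point p] = Some (VReal (snd p))"
  "prim_value N PHead [enc_points (p # ps)] = Some (enc_point p)"
  "prim_value N PTail [enc_points (p # ps)] = Some (enc_points ps)"
  "prim_value N PIsNil [enc_points ps] = Some (VBool (ps = []))"
proof -
  show "prim_value N PIsNil [enc_points ps] = Some (VBool (ps = []))"
    by (cases ps) (auto simp: prim_value_eq_Some intro: apply_prim.intros)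
  show "prim_value N PNorm [enc_point p] = Some (VReal (N p))"
    by (auto simp: prim_value_eq_Some intro: apply_prim.intros)
qed (auto simp: prim_value_eq_Some enc_point_eq intro: apply_prim.intros)

lemma prim_value_intersect:
  assumes "sorted_wrt lex_less ps" "set ps = circle N c r \<inter> circle N d r"
  shows "prim_value N PIntersect [enc_point c, enc_point d, VReal r] = Some (enc_points ps)"
  unfolding prim_value_eq_Some by (rule Intersect[OF assms])

section \<open>The procedures of the program\<close>

abbreviation "eZero \<equiv> EPrim PZero []"
abbreviation "eSub a b \<equiv> EPrim PSub [a, b]"
abbreviation "eMul a b \<equiv> EPrim PMul [a, b]"
abbreviation "eLess a b \<equiv> EPrim PLess [a, b]"
abbreviation "eNil \<equiv> EPrim PNil []"
abbreviation "eCons a b \<equiv> EPrim PCons [a, b]"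
abbreviation "eHead a \<equiv> EPrim PHead [a]"
abbreviation "eTail a \<equiv> EPrim PTail [a]"
abbreviation "eIsNil a \<equiv> EPrim PIsNil [a]"
text \<open>Expressions contain no truth value literals; truth values arise only from tests.\<close>

abbreviation "eTrue \<equiv> eLess eZero (EPrim POne [])"
abbreviation "eFalse \<equiv> eLess eZero eZero"

definition sort_body :: expr where
  "sort_body = EIf (eIsNil (EVar 0)) (EVar 0)
    (EIf (eIsNil (eTail (EVar 0))) (EVar 0)
      (ELet (ECall 3 [EVar 0]) (ECall 6 [ECall 2 [eHead (EVar 0)], ECall 2 [eTail (EVar 0)]])))"

definition split_body :: expr where
  "split_body = ECall 8 [EVar 0, EVar 0, eNil]"

definition combine_body :: expr where
  "combine_body = ECall 18 [eHead (EVar 0), eTail (EVar 0), eNil, ECall 19 [EVar 1, eNil], EVar 2]"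

definition lex_less_body :: expr where
  "lex_less_body = EIf (eLess (eHead (EVar 0)) (eHead (EVar 1))) eTrue
    (EIf (eLess (eHead (EVar 1)) (eHead (EVar 0))) eFalse (eLess (eTail (EVar 0)) (eTail (EVar 1))))"

definition merge_body :: expr where
  "merge_body = EIf (eIsNil (EVar 0)) (EVar 1) (EIf (eIsNil (EVar 1)) (EVar 0)
    (EIf (ECall 5 [eHead (EVar 0), eHead (EVar 1)])
      (eCons (eHead (EVar 0)) (ECall 6 [eTail (EVar 0), EVar 1]))
      (eCons (eHead (EVar 1)) (ECall 6 [EVar 0, eTail (EVar 1)]))))"

definition rev_append_body :: expr where
  "rev_append_body = EIf (eIsNil (EVar 0)) (EVar 1)
    (ECall 7 [eTail (EVar 0), eCons (eHead (EVar 0)) (EVar 1)])"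

text \<open>Walks through the list at single and at double speed, with frame \<open>[slow, fast, acc]\<close>.\<close>

definition halve_body :: expr where
  "halve_body = EIf (eIsNil (EVar 1)) (eCons (ECall 7 [EVar 2, eNil]) (EVar 0))
    (EIf (eIsNil (eTail (EVar 1))) (eCons (ECall 7 [EVar 2, eNil]) (EVar 0))
      (ECall 8 [eTail (EVar 0), eTail (eTail (EVar 1)), eCons (eHead (EVar 0)) (EVar 2)]))"

text \<open>A double-ended queue is a pair \<open>(xs, ys)\<close> of lists that stands for \<open>xs @ rev ys\<close>. If \<open>xs\<close> is
  empty, half of \<open>ys\<close> is moved over.\<close>

definition balance_body :: expr where
  "balance_body = EIf (eIsNil (EVar 0))
    (EIf (eIsNil (EVar 1)) (eCons (EVar 0) (EVar 1))
      (ELet (ECall 3 [EVar 1]) (eCons (ECall 7 [eTail (EVar 0), eNil]) (eHead (EVar 0)))))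
    (eCons (EVar 0) (EVar 1))"

definition cross_body :: expr where
  "cross_body = eSub
    (eMul (eSub (eHead (EVar 1)) (eHead (EVar 0))) (eSub (eTail (EVar 2)) (eTail (EVar 0))))
    (eMul (eSub (eTail (EVar 1)) (eTail (EVar 0))) (eSub (eHead (EVar 2)) (eHead (EVar 0))))"

text \<open>The intersection consists of the wanted centre and its mirror image. If the first point
  returned lies strictly to the right, the second one is the answer.\<close>

definition left_centre_body :: expr where
  "left_centre_body = ELet (EPrim PIntersect [EVar 0, EVar 1, EVar 2])
    (EIf (eLess (ECall 10 [EVar 1, EVar 2, eHead (EVar 0)]) eZero)
      (eHead (eTail (EVar 0))) (eHead (EVar 0)))"

definition distance_body :: expr where
  "distance_body = EPrim PNorm [eCons (eSub (eHead (EVar 1)) (eHead (EVar 0)))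
    (eSub (eTail (EVar 1)) (eTail (EVar 0)))]"

text \<open>The frame is \<open>[v, t, u, w, p, r]\<close>; under the let, \<open>u\<close>,
  \<open>w\<close>, \<open>p\<close> are variables 3, 4, 5. The test is one candidate of
  \<open>V_iff_successor\<close>, and \<open>survives_body\<close> tries all three.\<close>

definition successor_body :: expr where
  "successor_body = ELet (ECall 11 [EVar 0, EVar 1, EVar 5])
    (EIf (eLess (EVar 6) (ECall 12 [EVar 0, EVar 3])) eFalse
      (EIf (eLess (EVar 6) (ECall 12 [EVar 0, EVar 4])) eFalse
        (EIf (eLess (EVar 6) (ECall 12 [EVar 0, EVar 5])) eFalse eTrue)))"

definition survives_body :: expr where
  "survives_body = EIf (ECall 13 [EVar 1, EVar 0, EVar 0, EVar 2, EVar 3, EVar 4]) eTrue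
    (EIf (ECall 13 [EVar 1, EVar 2, EVar 0, EVar 2, EVar 3, EVar 4]) eTrue
      (ECall 13 [EVar 1, EVar 3, EVar 0, EVar 2, EVar 3, EVar 4]))"

text \<open>The frames are \<open>[u, v, xs, ys, p, r]\<close> for \<open>trim_body\<close> and \<open>trim_both_body\<close>, \<open>[m, xs, ys, p, r]\<close> for
  \<open>insert_body\<close> and \<open>[m, xs, ys, ps, r]\<close> for \<open>insert_all_body\<close>, where \<open>(xs, ys)\<close> is a queue.\<close>

definition trim_body :: expr where
  "trim_body = ELet (ECall 9 [EVar 2, EVar 3])
    (EIf (eIsNil (eHead (EVar 0))) (eCons (eCons (EVar 2) eNil) (eTail (EVar 0)))
      (EIf (ECall 14 [EVar 1, EVar 2, eHead (eHead (EVar 0)), EVar 5, EVar 6])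
        (eCons (eCons (EVar 2) (eHead (EVar 0))) (eTail (EVar 0)))
        (ECall 15 [EVar 2, eHead (eHead (EVar 0)), eTail (eHead (EVar 0)), eTail (EVar 0), EVar 5, EVar 6])))"

definition trim_both_body :: expr where
  "trim_both_body = ELet (ECall 15 [EVar 0, EVar 1, EVar 2, EVar 3, EVar 4, EVar 5])
    (ELet (ECall 9 [eTail (EVar 0), eHead (EVar 0)])
      (ELet (ECall 15 [EVar 3, eHead (eHead (EVar 0)), eTail (eHead (EVar 0)), eTail (EVar 0), EVar 6, EVar 7])
        (eCons (eTail (EVar 0)) (eHead (EVar 0)))))"

definition insert_body :: expr where
  "insert_body = ELet (ECall 9 [EVar 1, EVar 2])
    (EIf (eIsNil (eHead (EVar 0))) (eCons (EVar 4) (eCons (eCons (EVar 1) eNil) eNil))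
      (EIf (eLess (ECall 10 [EVar 1, eHead (eHead (EVar 0)), EVar 4]) eZero)
        (EIf (eLess (ECall 12 [ECall 11 [EVar 1, eHead (eHead (EVar 0)), EVar 5], EVar 4]) (EVar 5))
          (eCons (EVar 1) (EVar 0))
          (eCons (EVar 4) (ECall 16
            [EVar 1, eHead (eHead (EVar 0)), eTail (eHead (EVar 0)), eCons (EVar 1) (eTail (EVar 0)), EVar 4, EVar 5])))
        (ELet (ECall 9 [eTail (EVar 0), eHead (EVar 0)])
          (EIf (eLess (ECall 12 [ECall 11 [eHead (eHead (EVar 0)), EVar 2, EVar 6], EVar 5]) (EVar 6))
            (eCons (EVar 2) (eCons (eTail (EVar 0)) (eHead (EVar 0))))
            (eCons (EVar 5)
              (ECall 16 [eHead (eHead (EVar 0)), EVar 2, eTail (EVar 0), eHead (EVar 0), EVar 5, EVar 6]))))))"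

definition insert_all_body :: expr where
  "insert_all_body = EIf (eIsNil (EVar 3))
    (eCons (EVar 0) (ECall 7 [ECall 7 [EVar 1, eNil], ECall 7 [EVar 2, eNil]]))
    (ELet (ECall 17 [EVar 0, EVar 1, EVar 2, eHead (EVar 3), EVar 4])
      (ECall 18 [eHead (EVar 0), eHead (eTail (EVar 0)), eTail (eTail (EVar 0)), eTail (EVar 4), EVar 5]))"

definition unroll_body :: expr where
  "unroll_body = EIf (eIsNil (EVar 0)) (EVar 1)
    (EIf (eIsNil (EVar 1)) (ECall 19 [eTail (EVar 0), eCons (eHead (EVar 0)) eNil])
      (EIf (ECall 5 [eHead (EVar 0), eHead (EVar 1)])
        (ECall 19 [eTail (EVar 0), eCons (eHead (EVar 0)) (EVar 1)])
        (ECall 6 [EVar 1, EVar 0])))"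

definition hull_program :: "expr list" where
  "hull_program = [main_body, build_body, sort_body, split_body, combine_body,
    lex_less_body, merge_body, rev_append_body, halve_body, balance_body, cross_body,
    left_centre_body, distance_body, successor_body, survives_body, trim_body, trim_both_body,
    insert_body, insert_all_body, unroll_body]"

section \<open>Calls of the program and bounds on their cost\<close>

lemma length_hull_program: "length hull_program = 20"
  by (simp add: hull_program_def)

lemmas bodies = main_body_def build_body_def sort_body_def split_body_def combine_body_def
  lex_less_body_def merge_body_def rev_append_body_def halve_body_def balance_body_def cross_body_def
  left_centre_body_def distance_body_def successor_body_def survives_body_def trim_body_def
  trim_both_body_def insert_body_def insert_all_body_def unroll_body_def

lemma nth_hull_program:
  "hull_program ! 0 = main_body" "hull_program ! Suc 0 = build_body" "hull_program ! 2 = sort_body"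
  "hull_program ! 3 = split_body" "hull_program ! 4 = combine_body" "hull_program ! 5 = lex_less_body"
  "hull_program ! 6 = merge_body" "hull_program ! 7 = rev_append_body" "hull_program ! 8 = halve_body"
  "hull_program ! 9 = balance_body" "hull_program ! 10 = cross_body" "hull_program ! 11 = left_centre_body"
  "hull_program ! 12 = distance_body" "hull_program ! 13 = successor_body" "hull_program ! 14 = survives_body"
  "hull_program ! 15 = trim_body" "hull_program ! 16 = trim_both_body" "hull_program ! 17 = insert_body"
  "hull_program ! 18 = insert_all_body" "hull_program ! 19 = unroll_body"
  by (simp_all add: hull_program_def)

abbreviation call :: "(point \<Rightarrow> real) \<Rightarrow> nat \<Rightarrow> val list \<Rightarrow> (val \<times> nat) option" where
  "call N \<equiv> call_value N hull_program"

definition call_time :: "(point \<Rightarrow> real) \<Rightarrow> nat \<Rightarrow> val list \<Rightarrow> nat" where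
  "call_time N k us = snd (the (call N k us))"

text \<open>Exact step counts depend on the branches taken, so only an upper bound is recorded; the
  constants below are generous. \<open>call_time\<close> names the exact count where a rewrite rule
  needs one.\<close>

definition computes :: "(point \<Rightarrow> real) \<Rightarrow> nat \<Rightarrow> val list \<Rightarrow> val \<Rightarrow> nat \<Rightarrow> bool" where
  "computes N k us v b \<longleftrightarrow> (\<exists>t\<le>b. call N k us = Some (v, t))"

lemma computesD:
  assumes "computes N k us v b"
  shows "call N k us = Some (v, call_time N k us)" "call_time N k us \<le> b"
  using assms by (auto simp: computes_def call_time_def)

lemma computesI:
  assumes "k < 20" "value_of N hull_program us (hull_program ! k) = Some (v, t)" "t \<le> b"
  shows "computes N k us v b"
  using assms call_valueI[of k hull_program] by (auto simp: computes_def length_hull_program)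

declare enc_point.simps [simp del] enc_points.simps [simp del]

lemma computes_lex_less: "computes N 5 [enc_point p, enc_point q] (VBool (lex_less p q)) 40"
  by (cases "fst p < fst q"; cases "fst q < fst p";
    rule computesI, simp, simp add: nth_hull_program bodies prim_values lex_less_def, linarith)

section \<open>Running the program\<close>

lemmas run_simps = nth_hull_program bodies prim_values

lemma computes_merge:
  "computes N 6 [enc_points xs, enc_points ys] (enc_points (lex_merge xs ys)) (100 * (length xs + length ys) + 20)"
proof (induction xs ys rule: lex_merge.induct)
  case (1 ys)
  show ?case
    by (rule computesI, simp, simp add: run_simps, simp)
next
  case (2 x xs)
  show ?case
    by (rule computesI, simp, simp add: run_simps, simp)
next
  case (3 x xs y ys)
  note L = computesD[OF computes_lex_less[of N x y]]
  show ?case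
  proof (cases "lex_less x y")
    case True
    note IH = computesD[OF 3(1)[OF True]]
    show ?thesis
      by (rule computesI, simp, simp add: run_simps IH(1) L(1) True, use IH(2) L(2) in simp)
  next
    case False
    note IH = computesD[OF 3(2)[OF False]]
    show ?thesis
      by (rule computesI, simp, simp add: run_simps IH(1) L(1) False, use IH(2) L(2) in simp)
  qed
qed

lemma computes_rev_append:
  "computes N 7 [enc_points xs, enc_points acc] (enc_points (rev xs @ acc)) (20 * length xs + 10)"
proof (induction xs arbitrary: acc)
  case Nil
  show ?case
    by (rule computesI, simp, simp add: run_simps, simp)
next
  case (Cons x xs)
  note IH = computesD[OF Cons[of "x # acc"]]
  show ?case
    by (rule computesI, simp, simp add: run_simps IH(1), use IH(2) in simp)
qed

text \<open>Each round consumes two elements of \<open>fast\<close> and adds one to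
  \<open>acc\<close>; the summand in \<open>length acc\<close> pays for its final reversal.\<close>

lemma computes_halve:
  "length fast \<le> length slow \<Longrightarrow>
    computes N 8 [enc_points slow, enc_points fast, enc_points acc]
      (VCons (enc_points (rev acc @ take (length fast div 2) slow)) (enc_points (drop (length fast div 2) slow)))
      (60 * length fast + 30 * length acc + 40)"
proof (induction fast arbitrary: slow acc rule: induct_list012)
  case 1
  note R = computesD[OF computes_rev_append[of N acc "[]"]]
  show ?case
    by (rule computesI, simp, simp add: run_simps R(1)[simplified], use R(2) in simp)
next
  case (2 x)
  note R = computesD[OF computes_rev_append[of N acc "[]"]]
  show ?case
    by (rule computesI, simp, simp add: run_simps R(1)[simplified], use R(2) in simp)
next
  case (3 x y zs)
  then obtain s slow' where slow: "slow = s # slow'"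
    by (cases slow) auto
  have "length zs \<le> length slow'"
    using 3 slow by simp
  note IH = computesD[OF 3(1)[OF this, of "s # acc"]]
  show ?case
    unfolding slow by (rule computesI, simp, simp add: run_simps IH(1)[simplified], use IH(2) in simp)
qed

lemma computes_split:
  "computes N 3 [enc_points xs]
    (VCons (enc_points (take (length xs div 2) xs)) (enc_points (drop (length xs div 2) xs))) (60 * length xs + 60)"
proof -
  note H = computesD[OF computes_halve[of xs xs N "[]", simplified]]
  show ?thesis
    by (rule computesI, simp, simp add: run_simps H(1), use H(2) in simp)
qed

text \<open>Moving an element from \<open>xs\<close> to \<open>acc\<close> lowers
  \<open>2 * length xs + length acc\<close> by one, which pays for the round; what is left pays for
  the closing merge.\<close>

lemma computes_unroll:
  "computes N 19 [enc_points xs, enc_points acc] (enc_points (unroll xs acc)) (200 * (2 * length xs + length acc) + 40)"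
proof (induction xs acc rule: unroll.induct)
  case (1 acc)
  show ?case
    by (rule computesI, simp, simp add: run_simps, simp)
next
  case (2 x xs)
  note IH = computesD[OF 2]
  show ?case
    by (rule computesI, simp, simp add: run_simps IH(1), use IH(2) in simp)
next
  case (3 x xs a acc)
  note L = computesD[OF computes_lex_less[of N x a]]
  show ?case
  proof (cases "lex_less x a")
    case True
    note IH = computesD[OF 3[OF True]]
    show ?thesis
      by (rule computesI, simp, simp add: run_simps IH(1) L(1) True, use IH(2) L(2) in simp)
  next
    case False
    note M = computesD[OF computes_merge[of N "a # acc" "x # xs"]]
    show ?thesis
      by (rule computesI, simp, simp add: run_simps M(1) L(1) False del: lex_merge.simps, use M(2) L(2) in simp)
  qed
qed

text \<open>Subtraction is truncated, so at least one summand is zero and the sum is the absolute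
  difference of the lengths.\<close>

definition imbalance :: "'a list \<Rightarrow> 'a list \<Rightarrow> nat" where
  "imbalance A B = (length A - length B) + (length B - length A)"

definition balance :: "'a list \<Rightarrow> 'a list \<Rightarrow> 'a list \<times> 'a list" where
  "balance A B = (if A = [] then (rev (drop (length B div 2) B), take (length B div 2) B) else (A, B))"

lemma imbalance_commute: "imbalance A B = imbalance B A"
  by (simp add: imbalance_def)

text \<open>Rounding favours the front list: an empty front receives at least one element unless the
  whole queue is empty.\<close>

lemma balance:
  assumes "balance A B = (A', B')"
  shows "A' @ rev B' = A @ rev B" "length A' + length B' = length A + length B" "A' = [] \<Longrightarrow> B' = []"
proof -
  show "A' @ rev B' = A @ rev B"
    using assms by (auto simp: balance_def simp flip: rev_append split: if_splits)
  from arg_cong[OF this, of length] show "length A' + length B' = length A + length B"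
    by simp
  show "A' = [] \<Longrightarrow> B' = []"
    using assms by (cases B) (auto simp: balance_def split: if_splits)
qed

text \<open>The imbalance is the potential that pays for moving half of the queue.\<close>

lemma call_balance:
  assumes "balance A B = (A', B')"
  obtains t where "call N 9 [enc_points A, enc_points B] = Some (VCons (enc_points A') (enc_points B'), t)"
    "t + 100 * imbalance A' B' \<le> 100 * imbalance A B + 400"
proof -
  have "computes N 9 [enc_points A, enc_points B] (VCons (enc_points A') (enc_points B'))
      (100 * imbalance A B + 400 - 100 * imbalance A' B')"
  proof (cases "A = []")
    case True
    show ?thesis
    proof (cases "B = []")
      case B: True
      have "A' = []" "B' = []"
        using assms True B by (auto simp: balance_def)
      then show ?thesis
        unfolding True B by (intro computesI, simp, simp add: run_simps, simp)
    next
      case B: False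
      have A': "A' = rev (drop (length B div 2) B)" "B' = take (length B div 2) B"
        using assms True by (auto simp: balance_def)
      \<comment> \<open>The imbalance drops from \<open>length B\<close> to at most 1, and the
        released potential pays for splitting and reversing.\<close>
      have im: "imbalance A B = length B" "imbalance A' B' \<le> 1"
        using True by (auto simp: imbalance_def A')
      note S = computesD[OF computes_split[of N B]]
      note R = computesD[OF computes_rev_append[of N "drop (length B div 2) B" "[]"]]
      show ?thesis
        unfolding True A' using B im
        by (intro computesI, simp, simp add: run_simps S(1) R(1)[simplified], use S(2) R(2) im True A' in simp)
    qed
  next
    case False
    then have "A' = A" "B' = B"
      using assms by (auto simp: balance_def)
    then show ?thesis
      using False by (intro computesI, simp, simp add: run_simps, simp)
  qed
  moreover have "imbalance A' B' \<le> imbalance A B + 1"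
    using assms by (auto simp: balance_def imbalance_def split: if_splits)
  ultimately show thesis
    using that by (auto simp: computes_def)
qed

section \<open>Geometric tests in constant time\<close>

lemma computes_cross:
  "computes N 10 [enc_point p, enc_point q, enc_point z] (VReal (cross (q - p) (z - p))) 60"
  by (rule computesI, simp, simp add: run_simps cross_def, linarith)

lemma computes_distance: "computes N 12 [enc_point c, enc_point z] (VReal (N (z - c))) 40"
proof -
  have "(fst z - fst c, snd z - snd c) = z - c"
    by (simp add: prod_eq_iff)
  then show ?thesis
    by (intro computesI, simp, simp add: run_simps, linarith)
qed

context ball_plane begin

lemma computes_left_centre:
  assumes "p \<noteq> q" "N (q - p) \<le> 2 * r"
  shows "computes N 11 [enc_point p, enc_point q, VReal r] (enc_point (lc p q)) 200"
proof -
  let ?L = "lc p q" and ?L' = "p + q - lc p q"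
  note l = left_centre[OF assms]
  \<comment> \<open>The two centres may coincide, when the chord is a diameter; the primitive then
    returns a single point.\<close>
  have "\<exists>ps. sorted_wrt lex_less ps \<and> set ps = {?L, ?L'}"
    using lex_less_total[of ?L ?L']
  proof (elim disjE)
    assume "?L = ?L'"
    then show ?thesis
      by (intro exI[of _ "[?L]"]) simp
  next
    assume "lex_less ?L ?L'"
    then show ?thesis
      by (intro exI[of _ "[?L, ?L']"]) simp
  next
    assume "lex_less ?L' ?L"
    then show ?thesis
      by (intro exI[of _ "[?L', ?L]"]) auto
  qed
  then obtain ps where ps: "sorted_wrt lex_less ps" "set ps = {?L, ?L'}"
    by blast
  then obtain c cs where c: "ps = c # cs"
    by (cases ps) auto
  note P = prim_value_intersect[OF ps(1) ps(2)[folded circles_inter[OF assms]], unfolded c]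
  note X = computesD[OF computes_cross[of N p q c]]
  have c_cases: "c = ?L \<or> c = ?L'"
    using ps c by auto
  show ?thesis
  proof (cases "cross (q - p) (c - p) < 0")
    case True
    then have "c \<noteq> ?L"
      using l by auto
    then have "c = ?L'"
      using c_cases by blast
    have "cs \<noteq> []"
      using ps c \<open>c \<noteq> ?L\<close> by auto
    then obtain d ds where d: "cs = d # ds"
      by (cases cs) auto
    have "c \<noteq> d"
      using ps(1) c d lex_less_irrefl[of c] by auto
    then have "d = ?L"
      using ps(2) c d \<open>c = ?L'\<close> by auto
    show ?thesis
      by (rule computesI, simp, simp add: run_simps P X(1) True d \<open>d = ?L\<close>, use X(2) in simp)
  next
    case False
    have "N (?L' - p) = r" "N (?L' - q) = r"
      using left_centre_diff[OF assms] l by simp_all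
    then have "c = ?L"
      using left_centre_unique[OF assms(1), of c] False c_cases N_commute by (metis not_le)
    show ?thesis
      by (rule computesI, simp, simp add: run_simps P X(1)[unfolded \<open>c = ?L\<close>] False[unfolded \<open>c = ?L\<close>] \<open>c = ?L\<close>,
        use X(2) in \<open>simp add: \<open>c = ?L\<close>\<close>)
  qed
qed

lemma computes_successor:
  assumes "v \<noteq> t" "N (t - v) \<le> 2 * r"
  shows "computes N 13 [enc_point v, enc_point t, enc_point u, enc_point w, enc_point p, VReal r]
    (VBool (lc v t \<in> C {u, w, p})) 500"
proof -
  note L = computesD[OF computes_left_centre[OF assms]]
  note D = computesD[OF computes_distance[of N "lc v t" u]] computesD[OF computes_distance[of N "lc v t" w]]
    computesD[OF computes_distance[of N "lc v t" p]]
  have iff: "lc v t \<in> C {u, w, p} \<longleftrightarrow> \<not> r < N (u - lc v t) \<and> \<not> r < N (w - lc v t) \<and> \<not> r < N (p - lc v t)"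
    by (auto simp: common_centres_def)
  show ?thesis
    unfolding iff
    by (cases "r < N (u - lc v t)"; cases "r < N (w - lc v t)"; cases "r < N (p - lc v t)";
      rule computesI, simp, simp add: run_simps L(1) D(1,3,5), use L(2) D(2,4,6) in simp)
qed

lemma computes_survives:
  assumes "v \<notin> {u, w, p}" "\<And>t. t \<in> {u, w, p} \<Longrightarrow> N (t - v) \<le> 2 * r"
  shows "computes N 14 [enc_point u, enc_point v, enc_point w, enc_point p, VReal r]
    (VBool (survives N r p u v w)) 2000"
proof -
  have ne: "v \<noteq> u" "v \<noteq> w" "v \<noteq> p"
    using assms by auto
  have "N (u - v) \<le> 2 * r" "N (w - v) \<le> 2 * r" "N (p - v) \<le> 2 * r"
    using assms(2) by simp_all
  note S = computesD[OF computes_successor[OF ne(1) this(1), of u w p]]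
    computesD[OF computes_successor[OF ne(2) this(2), of u w p]]
    computesD[OF computes_successor[OF ne(3) this(3), of u w p]]
  have "survives N r p u v w \<longleftrightarrow> (\<exists>t\<in>{u, w, p}. lc v t \<in> C {u, w, p})"
    unfolding survives_def using assms by (intro V_iff_successor) auto
  then have iff: "survives N r p u v w \<longleftrightarrow> lc v u \<in> C {u, w, p} \<or> lc v w \<in> C {u, w, p} \<or> lc v p \<in> C {u, w, p}"
    by auto
  show ?thesis
    unfolding iff
    by (cases "lc v u \<in> C {u, w, p}"; cases "lc v w \<in> C {u, w, p}"; cases "lc v p \<in> C {u, w, p}";
      rule computesI, simp, simp add: run_simps S(1,3,5), use S(2,4,6) in simp)
qed

end

lemma call_valueI_hull:
  assumes "k < 20" "value_of N hull_program us (hull_program ! k) = Some (v, t)"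
  shows "call N k us = Some (v, t)"
  using assms call_valueI[of k hull_program] by (simp add: length_hull_program)

text \<open>The credit of 4000 per vertex covers one survival test (at most 2000) and the
  surrounding operations when it is removed.\<close>

abbreviation potential :: "'a list \<Rightarrow> 'a list \<Rightarrow> nat" where
  "potential A B \<equiv> 100 * imbalance A B + 4000 * (length A + length B)"

lemma imbalance_simps: "imbalance A (b # B) \<le> imbalance A B + 1" "imbalance (a # A) B \<le> imbalance A B + 1"
  "imbalance (tl A) B \<le> imbalance A B + 1" "imbalance A B \<le> imbalance (a # A) B + 1"
  by (auto simp: imbalance_def)

lemma trim_suffix: "\<exists>E. vs = E @ trim alive u vs"
proof (induction alive u vs rule: trim.induct)
  case (1 alive u v w ws)
  then show ?case
    by (metis append.simps trim.simps(1))
qed auto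

lemma trim_eq_Nil_iff: "trim alive u vs = [] \<longleftrightarrow> vs = []"
  by (induction alive u vs rule: trim.induct) auto

lemma trim_properties:
  "set (trim alive u vs) \<subseteq> set vs" "distinct vs \<Longrightarrow> distinct (trim alive u vs)"
  "vs \<noteq> [] \<Longrightarrow> last (trim alive u vs) = last vs"
proof -
  obtain T E where T: "trim alive u vs = T" and E: "vs = E @ T"
    using trim_suffix by metis
  show "set (trim alive u vs) \<subseteq> set vs"
    unfolding T by (simp add: E)
  show "distinct (trim alive u vs)" if "distinct vs"
    unfolding T using that by (simp add: E)
  show "last (trim alive u vs) = last vs" if "vs \<noteq> []"
    using that unfolding T trim_eq_Nil_iff[of alive u vs, unfolded T, symmetric] by (simp add: E)
qed

lemma trim_both_properties:
  "set (trim_both alive D) \<subseteq> set D" "distinct D \<Longrightarrow> distinct (trim_both alive D)"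
proof -
  show "set (trim_both alive D) \<subseteq> set D"
    unfolding trim_both_def set_rev using trim_properties(1)[of alive "hd D" "rev (trim alive (last D) D)"]
      trim_properties(1)[of alive "last D" D] by simp
  show "distinct (trim_both alive D)" if "distinct D"
    unfolding trim_both_def distinct_rev using that by (intro trim_properties(2)) (simp add: trim_properties(2))
qed

text \<open>The cost analysis does not need that the list is a hull: distinct points with a common
  centre keep all primitives defined. These are the invariants that carry this through the
  loop.\<close>

lemma insert_point_properties:
  assumes "vs \<noteq> []" "distinct vs" "p \<notin> set vs"
  shows "insert_point N r p vs \<noteq> []" "distinct (insert_point N r p vs)" "set (insert_point N r p vs) \<subseteq> insert p (set vs)"
proof -
  obtain m ws where vs: "vs = m # ws"
    using assms by (cases vs) auto
  let ?P = "\<lambda>us. us \<noteq> [] \<and> distinct us \<and> set us \<subseteq> insert p (set vs)"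
  have "?P vs" "?P [p, m]"
    using assms vs by auto
  moreover have "?P (p # trim_both (survives N r p) (ws @ [m]))"
    using trim_both_properties(1)[of "survives N r p" "ws @ [m]"]
      trim_both_properties(2)[of "ws @ [m]" "survives N r p"] assms vs by auto
  moreover have "?P (p # trim_both (survives N r p) (m # ws))"
    using trim_both_properties(1)[of "survives N r p" "m # ws"]
      trim_both_properties(2)[of "m # ws" "survives N r p"] assms vs by auto
  moreover have "insert_point N r p vs \<in> {vs, [p, m], p # trim_both (survives N r p) (ws @ [m]),
      p # trim_both (survives N r p) (m # ws)}"
    by (simp add: insert_point_def vs Let_def)
  ultimately have "?P (insert_point N r p vs)"
    by (elim insertE emptyE) simp_all
  then show "insert_point N r p vs \<noteq> []" "distinct (insert_point N r p vs)" "set (insert_point N r p vs) \<subseteq> insert p (set vs)"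
    by blast+
qed

context ball_plane begin

text \<open>Every removal is paid by the potential of the removed vertex, so the amortised cost is
  constant. The common centre bounds pairwise distances by \<open>2 * r\<close>, which the circle
  intersections rely on.\<close>

lemma call_trim:
  assumes K: "C K \<noteq> {}" "set (u # v # p # A @ B) \<subseteq> K"
    and "distinct (v # A @ rev B)" "p \<notin> set (u # v # A @ B)" "A @ rev B \<noteq> [] \<Longrightarrow> u \<noteq> v"
  shows "\<exists>A' B' t.
    call N 15 [enc_point u, enc_point v, enc_points A, enc_points B, enc_point p, VReal r] =
      Some (VCons (enc_points A') (enc_points B'), t) \<and>
    A' @ rev B' = trim (survives N r p) u (v # A @ rev B) \<and>
    t + potential A' B' \<le> potential A B + 8000"
  using assms
proof (induction "length A + length B" arbitrary: u v A B)
  case 0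
  then have AB: "A = []" "B = []"
    by auto
  obtain t where t: "call N 9 [enc_points [], enc_points []] = Some (VCons (enc_points []) (enc_points []), t)"
    "t + 100 * imbalance ([] :: point list) ([] :: point list) \<le> 100 * imbalance ([] :: point list) ([] :: point list) + 400"
    by (rule call_balance[of "[]" "[]" "[]" "[]" N]) (auto simp: balance_def)
  show ?case
    unfolding AB
    apply (intro exI conjI)
      apply (rule call_valueI_hull, simp, simp add: run_simps t(1))
     apply simp
    using t(2) by (simp add: imbalance_def)
next
  case (Suc n)
  obtain A1 B1 where bal: "balance A B = (A1, B1)"
    by fastforce
  note b = balance[OF bal]
  obtain t1 where t1: "call N 9 [enc_points A, enc_points B] = Some (VCons (enc_points A1) (enc_points B1), t1)"
    "t1 + 100 * imbalance A1 B1 \<le> 100 * imbalance A B + 400"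
    by (rule call_balance[OF bal])
  have "A1 \<noteq> []"
    using b(2,3) Suc(2) by fastforce
  then obtain w A2 where A1: "A1 = w # A2"
    by (cases A1) auto
  have ws: "w # A2 @ rev B1 = A @ rev B"
    using b(1) A1 by simp
  then have sets: "set (w # A2 @ B1) = set (A @ B)"
    by (metis set_append set_rev append_Cons)
  have mem: "u \<in> K" "v \<in> K" "p \<in> K" "w \<in> K"
    using Suc.prems(2) sets by auto
  obtain x where x: "x \<in> C K"
    using Suc.prems(1) by blast
  have ne: "v \<notin> {u, w, p}"
  proof -
    have "u \<noteq> v"
      using Suc.prems(5) ws by (metis list.distinct(1))
    moreover have "v \<notin> set (A @ B)" "p \<noteq> v"
      using Suc.prems(3,4) by auto
    ultimately show ?thesis
      using sets by auto
  qed
  have "computes N 14 [enc_point u, enc_point v, enc_point w, enc_point p, VReal r] (VBool (survives N r p u v w)) 2000"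
    by (rule computes_survives[OF ne]) (use C_dist[OF x mem(2)] mem in auto)
  note S = computesD[OF this]
  show ?case
  proof (cases "survives N r p u v w")
    case True
    show ?thesis
      apply (rule exI[of _ "v # A1"], rule exI[of _ B1], rule exI, intro conjI)
        apply (rule call_valueI_hull, simp, simp add: run_simps t1(1) A1 S(1) True)
       apply (simp add: A1 True flip: ws)
      using t1(2) S(2) b(2) imbalance_simps(2)[of v A1 B1] by (simp add: A1)
  next
    case False
    have "n = length A2 + length B1"
      using Suc(2) b(2) A1 by simp
    moreover have "set (v # w # p # A2 @ B1) \<subseteq> K" "distinct (w # A2 @ rev B1)" "p \<notin> set (v # w # A2 @ B1)" "v \<noteq> w"
      using Suc.prems(2-4) sets ne ws by auto
    ultimately obtain A' B' t where IH:
      "call N 15 [enc_point v, enc_point w, enc_points A2, enc_points B1, enc_point p, VReal r] =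
        Some (VCons (enc_points A') (enc_points B'), t)"
      "A' @ rev B' = trim (survives N r p) v (w # A2 @ rev B1)"
      "t + potential A' B' \<le> potential A2 B1 + 8000"
      using Suc(1)[of A2 B1 v w] Suc.prems(1) by blast
    show ?thesis
      apply (rule exI[of _ A'], rule exI[of _ B'], rule exI, intro conjI)
        apply (rule call_valueI_hull, simp, simp add: run_simps t1(1) A1 S(1) False IH(1))
       apply (simp add: IH(2) False flip: ws)
      using t1(2) S(2) IH(3) b(2) imbalance_simps(4)[of A2 B1 w] by (simp add: A1)
  qed
qed

text \<open>Exchanging the two lists reverses the queue at no cost, so the second pass is
  \<open>call_trim\<close> again. It starts at \<open>u\<close>, the last element, which the first
  pass never removes.\<close>

lemma call_trim_both:
  assumes K: "C K \<noteq> {}" "set (p # x # X @ Y) \<subseteq> K"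
    and dist: "distinct (x # X @ rev Y)" "p \<notin> set (x # X @ Y)" "X @ rev Y \<noteq> []" "u = last (X @ rev Y)"
  obtains X' Y' t where
    "call N 16 [enc_point u, enc_point x, enc_points X, enc_points Y, enc_point p, VReal r] =
      Some (VCons (enc_points X') (enc_points Y'), t)"
    "X' @ rev Y' = trim_both (survives N r p) (x # X @ rev Y)"
    "t + potential X' Y' \<le> potential X Y + 20000"
proof -
  let ?s = "survives N r p"
  have u: "u \<in> set (X @ Y)"
    using last_in_set[OF dist(3)] by (simp add: dist(4))
  then have "u \<noteq> x"
    using dist(1) by auto
  have su: "set (u # x # p # X @ Y) \<subseteq> K" "p \<notin> set (u # x # X @ Y)"
    using K(2) dist(2) u by auto
  obtain X1 Y1 t1 where 1:
    "call N 15 [enc_point u, enc_point x, enc_points X, enc_points Y, enc_point p, VReal r] =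
      Some (VCons (enc_points X1) (enc_points Y1), t1)"
    "X1 @ rev Y1 = trim ?s u (x # X @ rev Y)"
    "t1 + potential X1 Y1 \<le> potential X Y + 8000"
    using call_trim[OF K(1) su(1) dist(1) su(2)] \<open>u \<noteq> x\<close> by blast
  note trimmed = trim_properties[where alive = ?s and u = u and vs = "x # X @ rev Y", folded 1(2)]
  obtain Y2 X2 where bal: "balance Y1 X1 = (Y2, X2)"
    by fastforce
  note b = balance[OF bal]
  obtain t2 where 2: "call N 9 [enc_points Y1, enc_points X1] = Some (VCons (enc_points Y2) (enc_points X2), t2)"
    "t2 + 100 * imbalance Y2 X2 \<le> 100 * imbalance Y1 X1 + 400"
    by (rule call_balance[OF bal])
  have ne: "X1 @ rev Y1 \<noteq> []"
    by (simp only: 1(2) trim_eq_Nil_iff) simp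
  have rv: "Y2 @ rev X2 = rev (X1 @ rev Y1)"
    using b(1) by simp
  have "Y2 \<noteq> []"
    using ne rv b(3) by fastforce
  then obtain y Y3 where Y2: "Y2 = y # Y3"
    by (cases Y2) auto
  have rv': "y # Y3 @ rev X2 = rev (X1 @ rev Y1)"
    using rv Y2 by simp
  then have sets: "set (y # Y3 @ X2) = set (X1 @ Y1)"
    by (metis append_Cons set_append set_rev)
  have "y = last (X1 @ rev Y1)"
    using ne rv' by (metis hd_rev list.sel(1))
  moreover have lst: "last (x # X @ rev Y) = u"
    unfolding dist(4) by (rule last_ConsR[OF dist(3)])
  ultimately have yu: "y = u"
    using trimmed(3) by (metis list.distinct(1))
  have sub: "set (X1 @ Y1) \<subseteq> set (x # X @ Y)"
    using trimmed(1) by simp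
  have pre: "set (x # y # p # Y3 @ X2) \<subseteq> K" "distinct (y # Y3 @ rev X2)" "p \<notin> set (x # y # Y3 @ X2)"
  proof -
    show "distinct (y # Y3 @ rev X2)"
      unfolding rv' distinct_rev by (rule trimmed(2)[OF dist(1)])
    have "set (y # Y3 @ X2) \<subseteq> set (x # X @ Y)"
      unfolding sets by (rule sub)
    then show "set (x # y # p # Y3 @ X2) \<subseteq> K" "p \<notin> set (x # y # Y3 @ X2)"
      using K(2) dist(2) by auto
  qed
  obtain Y' X' t3 where 3:
    "call N 15 [enc_point x, enc_point y, enc_points Y3, enc_points X2, enc_point p, VReal r] =
      Some (VCons (enc_points Y') (enc_points X'), t3)"
    "Y' @ rev X' = trim ?s x (y # Y3 @ rev X2)"
    "t3 + potential Y' X' \<le> potential Y3 X2 + 8000"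
    using call_trim[OF K(1) pre] \<open>u \<noteq> x\<close> yu by blast
  have "X' @ rev Y' = rev (Y' @ rev X')"
    by simp
  also have "\<dots> = trim_both ?s (x # X @ rev Y)"
    unfolding 3(2) rv' 1(2) trim_both_def lst by simp
  finally have result: "X' @ rev Y' = trim_both ?s (x # X @ rev Y)" .
  show thesis
    apply (rule that[OF _ result])
     apply (rule call_valueI_hull, simp, simp add: run_simps 1(1) 2(1) Y2 3(1))
    using 1(3) 2(2) 3(3) b(2) imbalance_simps(4)[of Y3 X2 y]
    by (simp add: Y2 imbalance_commute[of X' Y'] imbalance_commute[of X1 Y1])
qed

end

lemma sorted_lex_distinct: "sorted_wrt lex_less xs \<Longrightarrow> distinct xs"
  by (induction xs) (auto simp: lex_less_irrefl)

context ball_plane begin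

lemma call_insert:
  assumes K: "C K \<noteq> {}" "set (p # m # A @ B) \<subseteq> K"
    and dist: "distinct (m # A @ rev B)" "p \<notin> set (m # A @ B)"
  obtains m' A' B' t where
    "call N 17 [enc_point m, enc_points A, enc_points B, enc_point p, VReal r] =
      Some (VCons (enc_point m') (VCons (enc_points A') (enc_points B')), t)"
    "m' # A' @ rev B' = insert_point N r p (m # A @ rev B)"
    "t + potential A' B' \<le> potential A B + 40000"
proof -
  let ?s = "survives N r p"
  obtain x where x: "x \<in> C K"
    using K(1) by blast
  obtain A1 B1 where bal: "balance A B = (A1, B1)"
    by fastforce
  note b = balance[OF bal]
  obtain t1 where 1: "call N 9 [enc_points A, enc_points B] = Some (VCons (enc_points A1) (enc_points B1), t1)"
    "t1 + 100 * imbalance A1 B1 \<le> 100 * imbalance A B + 400"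
    by (rule call_balance[OF bal])
  show thesis
  proof (cases "A1 = []")
    case True
    then have e: "B1 = []" "A = []" "B = []"
      using b by auto
    show thesis
      apply (rule that[of p "[m]" "[]"])
        apply (rule call_valueI_hull, simp, simp add: run_simps 1(1) True)
       apply (simp add: insert_point_def e)
      using 1(2) by (simp add: imbalance_def e True)
  next
    case False
    then obtain y A2 where A1: "A1 = y # A2"
      by (cases A1) auto
    have ws: "y # A2 @ rev B1 = A @ rev B"
      using b(1) A1 by simp
    then have sets: "set (y # A2 @ B1) = set (A @ B)"
      by (metis append_Cons set_append set_rev)
    have dist1: "distinct (y # A2 @ rev B1)"
      unfolding ws using dist(1) by simp
    have y: "y \<in> K" "m \<noteq> y" "m \<in> K"
      using K(2) dist(1) sets by auto
    note X = computesD[OF computes_cross[of N m y p]]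
    show thesis
    proof (cases "cross (y - m) (p - m) < 0")
      case cr: True
      note L = computesD[OF computes_left_centre[OF y(2) C_dist[OF x y(3,1)]]]
      note D = computesD[OF computes_distance[of N "lc m y" p]]
      show thesis
      proof (cases "N (p - lc m y) < r")
        case True
        show thesis
          apply (rule that[of m A1 B1])
            apply (rule call_valueI_hull, simp, simp add: run_simps 1(1) A1 X(1) cr L(1) D(1) True)
           apply (simp add: insert_point_def A1 cr True flip: ws)
          using 1(2) X(2) L(2) D(2) b(2) by simp
      next
        case False
        have pre: "set (p # y # A2 @ (m # B1)) \<subseteq> K" "distinct (y # A2 @ rev (m # B1))"
          "p \<notin> set (y # A2 @ (m # B1))" "A2 @ rev (m # B1) \<noteq> []" "m = last (A2 @ rev (m # B1))"
          using K(2) dist dist1 sets by auto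
        obtain A3 B3 t3 where 3:
          "call N 16 [enc_point m, enc_point y, enc_points A2, enc_points (m # B1), enc_point p, VReal r] =
            Some (VCons (enc_points A3) (enc_points B3), t3)"
          "A3 @ rev B3 = trim_both ?s (y # A2 @ rev (m # B1))"
          "t3 + potential A3 B3 \<le> potential A2 (m # B1) + 20000"
          using call_trim_both[OF K(1) pre] by blast
        have ins: "p # A3 @ rev B3 = insert_point N r p (m # A @ rev B)"
          unfolding 3(2) by (simp add: insert_point_def cr False flip: ws)
        show thesis
          apply (rule that[OF _ ins])
           apply (rule call_valueI_hull, simp, simp add: run_simps 1(1) A1 X(1) cr L(1) D(1) False 3(1))
          using 1(2) X(2) L(2) D(2) 3(3) b(2) imbalance_simps(1)[of A2 m B1] imbalance_simps(4)[of A2 B1 y]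
          by (simp add: A1)
      qed
    next
      case cr: False
      \<comment> \<open>The last vertex is needed, so the exchanged queue is balanced to bring it to
        the front.\<close>
      obtain B2 A3 where bal2: "balance B1 A1 = (B2, A3)"
        by fastforce
      note b2 = balance[OF bal2]
      obtain t2 where 2: "call N 9 [enc_points B1, enc_points A1] = Some (VCons (enc_points B2) (enc_points A3), t2)"
        "t2 + 100 * imbalance B2 A3 \<le> 100 * imbalance B1 A1 + 400"
        by (rule call_balance[OF bal2])
      have "B2 \<noteq> []"
        using b2(2,3) A1 by fastforce
      then obtain a B3 where B2: "B2 = a # B3"
        by (cases B2) auto
      have ws2: "A3 @ rev B2 = A @ rev B"
        using b2(1) unfolding b(1)[symmetric] by (metis rev_append rev_rev_ident)
      have sets2: "set (A3 @ B2) = set (A @ B)"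
        using arg_cong[OF ws2, of set] by simp
      have "a \<in> set (A @ B)"
        unfolding sets2[symmetric] B2 by simp
      then have a: "a \<in> K" "a \<noteq> m"
        using K(2) dist(1) by auto
      note L = computesD[OF computes_left_centre[OF a(2) C_dist[OF x a(1) y(3)]]]
      note D = computesD[OF computes_distance[of N "lc a m" p]]
      have ne: "A @ rev B \<noteq> []" "hd (A @ rev B) = y" "last (A @ rev B) = a"
      proof -
        show "A @ rev B \<noteq> []" "hd (A @ rev B) = y"
          unfolding ws[symmetric] by simp_all
        show "last (A @ rev B) = a"
          unfolding ws2[symmetric] B2 by simp
      qed
      show thesis
      proof (cases "N (p - lc a m) < r")
        case True
        have "insert_point N r p (m # W) = m # W" if "W \<noteq> []" "hd W = y" "last W = a" for W
          using that cr True by (simp add: insert_point_def)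
        from this[OF ne] have ins: "m # A3 @ rev B2 = insert_point N r p (m # A @ rev B)"
          unfolding ws2 by simp
        show thesis
          apply (rule that[OF _ ins])
           apply (rule call_valueI_hull, simp, simp add: run_simps 1(1) A1 X(1) cr 2(1)[unfolded A1] B2 L(1) D(1) True)
          using 1(2) 2(2) X(2) L(2) D(2) b(2) b2(2) by (simp add: imbalance_commute[of A3] imbalance_commute[of A1])
      next
        case False
        have pre: "set (p # m # A3 @ B2) \<subseteq> K" "distinct (m # A3 @ rev B2)" "p \<notin> set (m # A3 @ B2)"
          "A3 @ rev B2 \<noteq> []" "a = last (A3 @ rev B2)"
          using K(2) dist sets2 ne(1,3) unfolding ws2 by auto
        obtain A4 B4 t3 where 3:
          "call N 16 [enc_point a, enc_point m, enc_points A3, enc_points B2, enc_point p, VReal r] =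
            Some (VCons (enc_points A4) (enc_points B4), t3)"
          "A4 @ rev B4 = trim_both ?s (m # A3 @ rev B2)"
          "t3 + potential A4 B4 \<le> potential A3 B2 + 20000"
          using call_trim_both[OF K(1) pre] by blast
        have "insert_point N r p (m # W) = p # trim_both ?s (m # W)"
          if "W \<noteq> []" "hd W = y" "last W = a" for W
          using that cr False by (simp add: insert_point_def)
        from this[OF ne] have ins: "p # A4 @ rev B4 = insert_point N r p (m # A @ rev B)"
          unfolding 3(2) ws2 by simp
        show thesis
          apply (rule that[OF _ ins])
           apply (rule call_valueI_hull, simp, simp add: run_simps 1(1) A1 X(1) cr 2(1)[unfolded A1] B2 L(1) D(1) False 3(1)[unfolded B2])
          using 1(2) 2(2) X(2) L(2) D(2) 3(3) b(2) b2(2)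
          by (simp add: imbalance_commute[of A3] imbalance_commute[of A1])
      qed
    qed
  qed
qed

lemma computes_insert_all:
  assumes "C K \<noteq> {}" "set (m # A @ B @ ps) \<subseteq> K" "distinct (m # A @ rev B)" "distinct ps" "set ps \<inter> set (m # A @ B) = {}"
  shows "computes N 18 [enc_point m, enc_points A, enc_points B, enc_points ps, VReal r]
    (enc_points (fold (insert_point N r) ps (m # A @ rev B)))
    (potential A B + 50000 * length ps + 1000)"
  using assms
proof (induction ps arbitrary: m A B)
  case Nil
  note R = computesD[OF computes_rev_append[of N A "[]"]] computesD[OF computes_rev_append[of N B "[]"]]
    computesD[OF computes_rev_append[of N "rev A" "rev B"]]
  show ?case
    by (rule computesI, simp, simp add: run_simps R(1,3)[simplified] R(5)[simplified], use R(2,4,6) in simp)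
next
  case (Cons p ps)
  have pre: "set (p # m # A @ B) \<subseteq> K" "p \<notin> set (m # A @ B)"
    using Cons.prems by auto
  obtain m' A' B' t where 1:
    "call N 17 [enc_point m, enc_points A, enc_points B, enc_point p, VReal r] =
      Some (VCons (enc_point m') (VCons (enc_points A') (enc_points B')), t)"
    "m' # A' @ rev B' = insert_point N r p (m # A @ rev B)"
    "t + potential A' B' \<le> potential A B + 40000"
    using call_insert[OF Cons.prems(1) pre(1) Cons.prems(3) pre(2)] by blast
  have "p \<notin> set (m # A @ rev B)"
    using pre(2) by simp
  note ins = insert_point_properties[OF list.distinct(2) Cons.prems(3) this, of N r, folded 1(2)]
  have sub: "set (m' # A' @ B') \<subseteq> insert p (set (m # A @ B))"
    using ins(3) by simp
  have d: "distinct (m' # A' @ rev B')"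
    by (rule ins(2))
  have "set (m' # A' @ B' @ ps) \<subseteq> K" "set ps \<inter> set (m' # A' @ B') = {}"
    using sub Cons.prems(2,4,5) by auto
  note IH = computesD[OF Cons.IH[OF Cons.prems(1) this(1) d _ this(2)]]
  note IH = IH[unfolded 1(2)]
  have dps: "distinct ps"
    using Cons.prems by simp
  show ?case
    by (rule computesI, simp, simp add: run_simps 1(1) IH(1)[OF dps], use IH(2)[OF dps] 1(3) in simp)
qed

lemma computes_combine:
  assumes "C K \<noteq> {}" "set (ls @ rs) \<subseteq> K" "distinct (ls @ rs)" "ls \<noteq> []" "sorted_wrt lex_less (unroll rs [])"
  shows "computes N 4 [enc_points ls, enc_points rs, VReal r] (enc_points (combine N r ls rs))
    (60000 * (length ls + length rs))"
proof -
  obtain m ws where ls: "ls = m # ws"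
    using assms(4) by (cases ls) auto
  note U = computesD[OF computes_unroll[of N rs "[]"]]
  have d: "distinct (unroll rs [])"
    by (rule sorted_lex_distinct[OF assms(5)])
  have "computes N 18 [enc_point m, enc_points ws, enc_points [], enc_points (unroll rs []), VReal r]
    (enc_points (fold (insert_point N r) (unroll rs []) (m # ws @ rev [])))
    (potential ws ([] :: point list) + 50000 * length (unroll rs []) + 1000)"
    using assms d by (intro computes_insert_all[OF assms(1)]) (auto simp: ls)
  note I = computesD[OF this, simplified]
  show ?thesis
    by (rule computesI, simp, simp add: run_simps ls U(1) I(1) combine_def, use U(2) I(2) in \<open>simp add: imbalance_def ls\<close>)
qed

end

section \<open>Sorting, building and the total cost\<close>

lemma computes_mono: "computes N k us v b \<Longrightarrow> b \<le> b' \<Longrightarrow> computes N k us v b'"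
  by (auto simp: computes_def)

lemma computes_sort_short: "length xs \<le> 1 \<Longrightarrow> computes N 2 [enc_points xs] (enc_points xs) (b + 100)"
  by (cases xs; cases "tl xs"; rule computesI, simp, simp add: run_simps, simp)

text \<open>The bound \<open>2 ^ k\<close> on the length makes the recursion depth the induction
  variable: halving lowers \<open>k\<close> by one, and each level costs linear time.\<close>

lemma computes_sort:
  assumes "distinct xs" "length xs \<le> 2 ^ k"
  shows "\<exists>ys. computes N 2 [enc_points xs] (enc_points ys) (500 * (k + 1) * length xs + 100) \<and>
    set ys = set xs \<and> length ys = length xs \<and> sorted_wrt lex_less ys"
  using assms
proof (induction k arbitrary: xs)
  case 0
  then show ?case
    by (intro exI[of _ xs] conjI computes_sort_short) (cases xs; simp)+
next
  case (Suc k)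
  show ?case
  proof (cases "length xs \<le> 1")
    case True
    then show ?thesis
      by (intro exI[of _ xs] conjI computes_sort_short) (cases xs; simp)+
  next
    case False
    define ls rs where "ls = take (length xs div 2) xs" and "rs = drop (length xs div 2) xs"
    have xs: "xs = ls @ rs"
      by (simp add: ls_def rs_def)
    have "length ls \<le> 2 ^ k" "length rs \<le> 2 ^ k"
      using Suc.prems(2) by (simp_all add: ls_def rs_def)
    moreover have d: "distinct ls" "distinct rs" "set ls \<inter> set rs = {}"
      using Suc.prems(1) unfolding xs by simp_all
    ultimately obtain as bs where
      a: "computes N 2 [enc_points ls] (enc_points as) (500 * (k + 1) * length ls + 100)"
        "set as = set ls" "length as = length ls" "sorted_wrt lex_less as" and
      b: "computes N 2 [enc_points rs] (enc_points bs) (500 * (k + 1) * length rs + 100)"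
        "set bs = set rs" "length bs = length rs" "sorted_wrt lex_less bs"
      using Suc.IH[of ls] Suc.IH[of rs] by blast
    note A = computesD[OF a(1)] and B = computesD[OF b(1)]
    note S = computesD[OF computes_split[of N xs], folded ls_def rs_def]
    note M = computesD[OF computes_merge[of N as bs]]
    obtain x y zs where xyz: "xs = x # y # zs"
      using False by (cases xs; cases "tl xs") auto
    then have tl: "xs \<noteq> []" "prim_value N PTail [enc_points xs] = Some (enc_points (y # zs))"
      by (simp_all add: prim_values)
    have len: "length ls + length rs = length xs" "2 \<le> length xs"
      using False by (simp_all add: xs)
    have distr: "500 * (k + 1) * length ls + 500 * (k + 1) * length rs = 500 * (k + 1) * length xs"
      using len(1) by (metis distrib_left)
    have "computes N 2 [enc_points xs] (enc_points (lex_merge as bs)) (500 * (Suc k + 1) * length xs + 100)"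
    proof (rule computesI)
      show "value_of N hull_program [enc_points xs] (hull_program ! 2) = Some (enc_points (lex_merge as bs),
          call_time N 3 [enc_points xs] + call_time N 2 [enc_points ls] + call_time N 2 [enc_points rs] +
          call_time N 6 [enc_points as, enc_points bs] + 17)"
        by (simp add: run_simps tl S(1) A(1) B(1) M(1))
      have total: "500 * (Suc k + 1) * length xs = 500 * (k + 1) * length xs + 500 * length xs"
        by (simp add: algebra_simps)
      have "c + a + b + m + 17 \<le> Z + 100"
        if "Z = X + 500 * n" "P + Q = X" "a \<le> P + 100" "b \<le> Q + 100" "c \<le> 60 * n + 60" "m \<le> 100 * n + 20"
          "2 \<le> n" for a b c m n P Q X Z :: nat
        using that by linarith
      from this[OF total distr A(2) B(2) S(2) M(2)[unfolded a(3) b(3) len(1)] len(2)] show "call_time N 3 [enc_points xs] + call_time N 2 [enc_points ls] + call_time N 2 [enc_points rs] +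
          call_time N 6 [enc_points as, enc_points bs] + 17 \<le> 500 * (Suc k + 1) * length xs + 100" .
    qed simp
    moreover have "set (lex_merge as bs) = set xs"
      unfolding xs set_lex_merge a(2) b(2) set_append by (rule refl)
    moreover have "length (lex_merge as bs) = length xs"
      unfolding length_lex_merge a(3) b(3) by (rule len)
    moreover have "sorted_wrt lex_less (lex_merge as bs)"
      using d(3) by (intro sorted_lex_merge a(4) b(4)) (simp only: a(2) b(2))
    ultimately show ?thesis
      by blast
  qed
qed

context ball_plane begin

lemma build_short:
  assumes "xs \<noteq> []" "length xs \<le> 1"
  shows "\<exists>vs. computes N 1 [enc_points xs, VReal r] (enc_points vs) (b + 100) \<and> hull_list N r (set xs) vs"
proof -
  obtain x where x: "xs = [x]"
    using assms by (cases xs) auto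
  have "computes N 1 [enc_points [x], VReal r] (enc_points [x]) (b + 100)"
    by (rule computesI, simp, simp add: run_simps, simp)
  then show ?thesis
    using hull_list_singleton[of x] by (auto simp: x)
qed

lemma computes_build:
  assumes "xs \<noteq> []" "sorted_wrt lex_less xs" "C (set xs) \<noteq> {}" "length xs \<le> 2 ^ k"
  shows "\<exists>vs. computes N 1 [enc_points xs, VReal r] (enc_points vs) (70000 * (k + 1) * length xs + 100) \<and>
    hull_list N r (set xs) vs"
  using assms
proof (induction k arbitrary: xs)
  case 0
  then show ?case
    by (intro build_short) simp_all
next
  case (Suc k)
  show ?case
  proof (cases "length xs \<le> 1")
    case True
    then show ?thesis
      by (intro build_short Suc.prems)
  next
    case False
    define ls rs where "ls = take (length xs div 2) xs" and "rs = drop (length xs div 2) xs"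
    have xs: "xs = ls @ rs"
      by (simp add: ls_def rs_def)
    have "length ls \<le> 2 ^ k" "length rs \<le> 2 ^ k" "ls \<noteq> []" "rs \<noteq> []"
      using Suc.prems(4) False by (auto simp: ls_def rs_def)
    moreover have sorted: "sorted_wrt lex_less ls" "sorted_wrt lex_less rs"
      "\<And>p q. p \<in> set ls \<Longrightarrow> q \<in> set rs \<Longrightarrow> lex_less p q"
      using Suc.prems(2) unfolding xs sorted_wrt_append by auto
    moreover have "C (set ls) \<noteq> {}" "C (set rs) \<noteq> {}"
      using Suc.prems(3) C_antimono[of "set ls" "set xs"] C_antimono[of "set rs" "set xs"] xs by auto
    ultimately obtain as bs where
      a: "computes N 1 [enc_points ls, VReal r] (enc_points as) (70000 * (k + 1) * length ls + 100)"
        "hull_list N r (set ls) as" and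
      b: "computes N 1 [enc_points rs, VReal r] (enc_points bs) (70000 * (k + 1) * length rs + 100)"
        "hull_list N r (set rs) bs"
      using Suc.IH[of ls] Suc.IH[of rs] by blast
    have sub: "set as \<subseteq> set ls" "set bs \<subseteq> set rs" and dist: "distinct as" "distinct bs" "as \<noteq> []"
      using a(2) b(2) V_subset by (auto simp: hull_list_def)
    have le: "length as \<le> length ls" "length bs \<le> length rs"
      using sub dist by (metis card_length card_mono distinct_card finite_set le_trans)+
    have disj: "set ls \<inter> set rs = {}"
      using sorted_lex_distinct[OF Suc.prems(2)] unfolding xs by simp
    have Cxs: "C (set ls \<union> set rs) \<noteq> {}"
      using Suc.prems(3) xs by simp
    have "computes N 4 [enc_points as, enc_points bs, VReal r] (enc_points (combine N r as bs))
        (60000 * (length as + length bs))"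
      using sub dist disj sorted_unroll_hull_list[OF b(2)] by (intro computes_combine[OF Cxs]) auto
    note M = computesD[OF this]
    note A = computesD[OF a(1)] and B = computesD[OF b(1)]
    note S = computesD[OF computes_split[of N xs], folded ls_def rs_def]
    obtain x y zs where xyz: "xs = x # y # zs"
      using False by (cases xs; cases "tl xs") auto
    then have tl: "xs \<noteq> []" "prim_value N PTail [enc_points xs] = Some (enc_points (y # zs))"
      by (simp_all add: prim_values)
    have len: "length ls + length rs = length xs" "2 \<le> length xs"
      using False by (simp_all add: xs)
    have distr: "70000 * (k + 1) * length ls + 70000 * (k + 1) * length rs = 70000 * (k + 1) * length xs"
      using len(1) by (metis distrib_left)
    have "computes N 1 [enc_points xs, VReal r] (enc_points (combine N r as bs)) (70000 * (Suc k + 1) * length xs + 100)"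
    proof (rule computesI)
      show "value_of N hull_program [enc_points xs, VReal r] (hull_program ! 1) = Some (enc_points (combine N r as bs),
          call_time N 3 [enc_points xs] + call_time N 1 [enc_points ls, VReal r] + call_time N 1 [enc_points rs, VReal r] +
          call_time N 4 [enc_points as, enc_points bs, VReal r] + 20)"
        by (simp add: run_simps tl S(1) A(1)[simplified] B(1)[simplified] M(1))
      have "70000 * (Suc k + 1) * length xs = 70000 * (k + 1) * length xs + 70000 * length xs"
        by (simp add: algebra_simps)
      moreover have "60000 * (length as + length bs) \<le> 60000 * length xs"
        using le len by simp
      ultimately show "call_time N 3 [enc_points xs] + call_time N 1 [enc_points ls, VReal r] + call_time N 1 [enc_points rs, VReal r] +
          call_time N 4 [enc_points as, enc_points bs, VReal r] + 20 \<le> 70000 * (Suc k + 1) * length xs + 100"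
        using A(2) B(2) S(2) M(2) distr len by linarith
    qed simp
    moreover have "hull_list N r (set xs) (combine N r as bs)"
      using hull_list_combine[OF a(2) b(2) _ _ Cxs sorted(3)] xs by simp
    ultimately show ?thesis
      by blast
  qed
qed

end

lemma runs_iff: "runs N hull_program k us v t \<longleftrightarrow> call N k us = Some (v, t)"
  by (simp add: runs_def call_value_eq_Some)

lemma divide_and_conquer_hull_program: "divide_and_conquer N hull_program"
  unfolding divide_and_conquer_def
proof (intro conjI allI impI)
  show "\<exists>sort_body split_body combine_body aux.
      hull_program = [main_body, build_body, sort_body, split_body, combine_body] @ aux \<and>
      (\<forall>e \<in> set ([sort_body, split_body, combine_body] @ aux). callees e \<inter> {0, 1} = {})"
    apply (rule exI[of _ sort_body], rule exI[of _ split_body], rule exI[of _ combine_body],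
      rule exI[of _ "drop 5 hull_program"], intro conjI)
     apply (simp add: hull_program_def)
    apply (simp add: hull_program_def bodies)
    done
next
  fix xs :: "point list" assume "distinct xs"
  moreover have "length xs \<le> 2 ^ length xs"
    by (simp add: less_imp_le)
  ultimately obtain ys where "computes N 2 [enc_points xs] (enc_points ys) (500 * (length xs + 1) * length xs + 100)"
    "set ys = set xs" "sorted_wrt lex_less ys"
    using computes_sort by blast
  then show "\<exists>ys t. runs N hull_program 2 [enc_points xs] (enc_points ys) t \<and> set ys = set xs \<and> sorted_wrt lex_less ys"
    unfolding runs_iff using computesD(1) by blast
next
  fix xs :: "point list"
  show "\<exists>ls rs t. runs N hull_program 3 [enc_points xs] (VCons (enc_points ls) (enc_points rs)) t \<and>
      xs = ls @ rs \<and> length ls \<le> Suc (length rs) \<and> length rs \<le> Suc (length ls)"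
    unfolding runs_iff
    apply (rule exI[of _ "take (length xs div 2) xs"], rule exI[of _ "drop (length xs div 2) xs"], rule exI, intro conjI)
       apply (rule computesD(1)[OF computes_split])
      apply auto
    done
qed

lemma computes_main:
  assumes "computes N 2 [enc_points xs] (enc_points ys) a" "computes N 1 [enc_points ys, VReal r] (enc_points vs) b"
  shows "computes N 0 [enc_points xs, VReal r] (enc_points vs) (a + b + 10)"
proof -
  note A = computesD[OF assms(1)] and B = computesD[OF assms(2)]
  show ?thesis
    by (rule computesI, simp, simp add: run_simps A(1) B(1)[simplified], use A(2) B(2) in simp)
qed

text \<open>Two different points in one disc force \<open>0 < r\<close>, so the theory of discs of
  positive radius applies. A single point allows \<open>r = 0\<close> and is treated directly, as is
  the empty set.\<close>

lemma (in strictly_convex_plane) hull_program_correct: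
  assumes xs: "distinct xs" "length xs \<le> 2 ^ k" and r: "circumradius N (set xs) \<le> r"
  shows "\<exists>vs. computes N 0 [enc_points xs, VReal r] (enc_points vs) (71000 * (k + 1) * length xs + 300) \<and>
    lists_hull_vertices N (set xs) r vs"
proof -
  have ne: "common_centres N r (set xs) \<noteq> {}"
    using circumradius_le_imp_centre[OF _ r] by simp
  obtain ys where ys: "computes N 2 [enc_points xs] (enc_points ys) (500 * (k + 1) * length xs + 100)"
    "set ys = set xs" "length ys = length xs" "sorted_wrt lex_less ys"
    using computes_sort[OF xs] by blast
  have "\<exists>vs. computes N 1 [enc_points ys, VReal r] (enc_points vs) (70000 * (k + 1) * length xs + 100) \<and>
    lists_hull_vertices N (set xs) r vs"
  proof -
    consider "ys = []" | p where "ys = [p]" | p q zs where "ys = p # q # zs"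
      by (cases ys; cases "tl ys") auto
    then show ?thesis
    proof cases
      case 1
      then have xs: "xs = []"
        using ys(3) by simp
      show ?thesis
        unfolding 1 xs
        by (rule exI[of _ "[]"], intro conjI, rule computesI, simp, simp add: run_simps, simp)
          (simp add: lists_hull_vertices_empty)
    next
      case (2 p)
      then have p: "set xs = {p}"
        using ys(2) by simp
      obtain x where "N (p - x) \<le> r"
        using ne unfolding p common_centres_def by auto
      then have r0: "0 \<le> r"
        using N_nonneg[of "p - x"] by linarith
      show ?thesis
        unfolding 2 p
        by (rule exI[of _ "[p]"], intro conjI, rule computesI, simp, simp add: run_simps, simp)
          (rule lists_hull_vertices_singleton[OF r0])
    next
      case (3 p q zs)
      then have pq: "p \<in> set xs" "q \<in> set xs" "p \<noteq> q"
        using ys(4) lex_less_irrefl[of p] unfolding ys(2)[symmetric] by auto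
      obtain x where x: "N (p - x) \<le> r" "N (q - x) \<le> r"
        using ne pq unfolding common_centres_def by auto
      have "0 < r"
      proof (rule ccontr)
        assume "\<not> 0 < r"
        then have "N (p - x) = 0" "N (q - x) = 0"
          using x N_nonneg[of "p - x"] N_nonneg[of "q - x"] by linarith+
        then show False
          using pq by simp
      qed
      then interpret ball_plane N r
        by unfold_locales
      have "ys \<noteq> []"
        using 3 by simp
      then obtain vs where vs: "computes N 1 [enc_points ys, VReal r] (enc_points vs) (70000 * (k + 1) * length ys + 100)"
        "hull_list N r (set ys) vs"
        using computes_build[OF _ ys(4), of k] ne xs(2) ys(2,3) by auto
      have "lists_hull_vertices N (set xs) r vs"
        using pq by (intro lists_hull_vertices_hull_list[OF vs(2)[unfolded ys(2)] _ ne]) auto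
      then show ?thesis
        using vs(1) ys(3) by auto
    qed
  qed
  then obtain vs where vs: "computes N 1 [enc_points ys, VReal r] (enc_points vs) (70000 * (k + 1) * length xs + 100)"
    "lists_hull_vertices N (set xs) r vs"
    by blast
  have "computes N 0 [enc_points xs, VReal r] (enc_points vs) (71000 * (k + 1) * length xs + 300)"
    by (rule computes_mono[OF computes_main[OF ys(1) vs(1)]]) (simp add: algebra_simps)
  then show ?thesis
    using vs(2) by blast
qed

theorem theorem7:
  fixes N :: "real \<times> real \<Rightarrow> real"
  assumes "strictly_convex_norm N"
  shows "\<exists>P (T :: nat \<Rightarrow> real).
    divide_and_conquer N P \<and>
    T \<in> O(\<lambda>n. real n * ln (real n)) \<and>
    (\<forall>K xs r. finite K \<and> distinct xs \<and> set xs = K \<and> circumradius N K \<le> r \<longrightarrow>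
       (\<exists>vs t. runs N P 0 [enc_points xs, VReal r] (enc_points vs) t \<and>
          lists_hull_vertices N K r vs \<and>
          real t \<le> T (card K)))"
proof -
  interpret strictly_convex_plane N
    by unfold_locales (rule assms)
  \<comment> \<open>The depth \<open>k\<close> is the logarithm rounded up, so \<open>k + 1\<close>
    is at most the logarithm plus 2. For the empty set the first summand vanishes and 300
    remains.\<close>
  define T :: "nat \<Rightarrow> real" where "T = (\<lambda>n. 71000 * (ln (real n) / ln 2 + 2) * real n + 300)"
  have "T \<in> O(\<lambda>n. real n * ln (real n))"
  proof (rule bigoI)
    \<comment> \<open>213300 is 3 * 71000 + 300: for \<open>n \<ge> 2\<close> the quotient
      \<open>q\<close> is at least 1, so \<open>q + 2 \<le> 3 * q\<close>, and the additive constant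
      is absorbed as well.\<close>
    show "\<forall>\<^sub>F n in sequentially. norm (T n) \<le> (213300 / ln 2) * norm (real n * ln (real n))"
      unfolding eventually_sequentially
    proof (intro exI[of _ 2] allI impI)
      fix n :: nat assume n: "2 \<le> n"
      define q where "q = ln (real n) / ln 2"
      have q: "1 \<le> q"
        using n by (simp add: q_def)
      have "1 * 1 \<le> q * real n"
        using q n by (intro mult_mono) auto
      moreover have "(q + 2) * real n \<le> (3 * q) * real n"
        using q by (intro mult_right_mono) auto
      ultimately have "71000 * ((q + 2) * real n) + 300 \<le> 213300 * (q * real n)"
        unfolding mult.assoc by linarith
      then have "71000 * (q + 2) * real n + 300 \<le> 213300 * (q * real n)"
        by (simp only: mult.assoc)
      moreover have "0 \<le> 71000 * (q + 2) * real n + 300"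
        using q by simp
      moreover have "0 \<le> real n * ln (real n)"
        using n by simp
      ultimately show "norm (T n) \<le> (213300 / ln 2) * norm (real n * ln (real n))"
        by (simp add: T_def q_def abs_of_nonneg mult.commute)
    qed
  qed
  moreover have "\<exists>vs t. runs N hull_program 0 [enc_points xs, VReal r] (enc_points vs) t \<and>
      lists_hull_vertices N K r vs \<and> real t \<le> T (card K)"
    if K: "distinct xs" "set xs = K" "circumradius N K \<le> r" for K xs r
  proof -
    let ?n = "length xs"
    define k where "k = nat \<lceil>log 2 (real ?n)\<rceil>"
    have "?n \<le> 2 ^ k"
    proof (cases "?n = 0")
      case False
      then have "real ?n = 2 powr log 2 (real ?n)"
        by simp
      also have "\<dots> \<le> 2 powr real k"
        unfolding k_def by (intro powr_mono) (auto simp: real_nat_ceiling_ge)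
      also have "\<dots> = real (2 ^ k)"
        by (simp add: powr_realpow)
      finally show ?thesis
        by linarith
    qed simp
    from hull_program_correct[OF K(1) this K(3)[folded K(2)]] obtain vs where
      vs: "computes N 0 [enc_points xs, VReal r] (enc_points vs) (71000 * (k + 1) * ?n + 300)"
        "lists_hull_vertices N K r vs"
      unfolding K(2) by blast
    obtain t where t: "t \<le> 71000 * (k + 1) * ?n + 300" "runs N hull_program 0 [enc_points xs, VReal r] (enc_points vs) t"
      using vs(1) unfolding runs_iff computes_def by blast
    have "real t \<le> real (71000 * (k + 1) * ?n + 300)"
      using t(1) by (rule of_nat_mono)
    also have "\<dots> = 71000 * (real k + 1) * real ?n + 300"
      by simp
    also have "\<dots> \<le> T ?n"
    proof (cases "?n = 0")
      case True
      then show ?thesis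
        by (simp add: T_def)
    next
      case False
      then have "0 \<le> log 2 (real ?n)"
        by (cases xs) auto
      then have "real k + 1 \<le> log 2 (real ?n) + 2"
        unfolding k_def by linarith
      then show ?thesis
        unfolding T_def log_def by (intro add_right_mono mult_right_mono mult_left_mono) simp_all
    qed
    also have "?n = card K"
      using K(1,2) distinct_card by metis
    finally show ?thesis
      using t(2) vs(2) by blast
  qed
  ultimately show ?thesis
    using divide_and_conquer_hull_program by blast
qed

end
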